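(* Let $P=(X,\prec)$ be a finite poset, let $x,y,z\in X$ be distinct, and let $k,\ell\ge1$ be integers. Let $\mathrm{F}(a,b)$ denote the number of linear extensions $L$ of $P$ with $L(y)-L(x)=a$ and $L(z)-L(y)=b$. Then at least two of the following three inequalities hold: $$\mathrm{F}(k+1,\ell)\,\mathrm{F}(k,\ell+1)\ \ge\ \mathrm{F}(k,\ell)\,\mathrm{F}(k+1,\ell+1);$$ $$\mathrm{F}(k+2,\ell)\,\mathrm{F}(k,\ell+1)\ \le\ \mathrm{F}(k+1,\ell)\,\mathrm{F}(k+1,\ell+1);$$ $$\mathrm{F}(k,\ell+2)\,\mathrm{F}(k+1,\ell)\ \le\ \mathrm{F}(k,\ell+1)\,\mathrm{F}(k+1,\ell+1).$$
   Context: A linear extension of a finite poset $P=(X,\prec)$ with $|X|=n$ is a bijection $L:X\to\{1,\dots,n\}$ with $L(u)<L(v)$ whenever $u\prec v$. *)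

theory Defs
  imports Main "HOL-Library.FuncSet"
begin

definition strict_poset_on :: "'a set \<Rightarrow> ('a \<Rightarrow> 'a \<Rightarrow> bool) \<Rightarrow> bool" where
  "strict_poset_on X lt \<longleftrightarrow> irreflp_on X lt \<and> transp_on X lt"

text \<open>
  A linear extension is a map defined on \<open>X\<close> only; the condition \<open>L \<in> extensional X\<close> pins down
  its irrelevant values outside \<open>X\<close>, so that each linear extension is counted exactly once.
\<close>
definition linear_extensions :: "'a set \<Rightarrow> ('a \<Rightarrow> 'a \<Rightarrow> bool) \<Rightarrow> ('a \<Rightarrow> nat) set" where
  "linear_extensions X lt =
     {L \<in> extensional X. bij_betw L X {1..card X} \<and>
        (\<forall>u\<in>X. \<forall>v\<in>X. lt u v \<longrightarrow> L u < L v)}"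

definition F :: "'a set \<Rightarrow> ('a \<Rightarrow> 'a \<Rightarrow> bool) \<Rightarrow> 'a \<Rightarrow> 'a \<Rightarrow> 'a \<Rightarrow> int \<Rightarrow> int \<Rightarrow> nat" where
  "F X lt x y z a b =
     card {L \<in> linear_extensions X lt. int (L y) - int (L x) = a \<and> int (L z) - int (L y) = b}"

end

theory Submission
  imports Defs "HOL-Analysis.Analysis"
begin

text \<open>
  If two of the three inequalities fail, multiplying them contradicts one of
  \<open>F(k+1,l)\<^sup>2 \<ge> F(k+2,l) F(k,l)\<close>, \<open>F(k,l+1)\<^sup>2 \<ge> F(k,l+2) F(k,l)\<close>,
  \<open>F(k+1,l+1)\<^sup>2 \<ge> F(k+2,l) F(k,l+2)\<close>. As in the theorem of Kahn and Saks these are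
  Alexandrov--Fenchel inequalities for slices of the order polytope: with a bottom and a top element
  adjoined, the slice on which \<open>x, y, z\<close> have prescribed gaps has a volume that is a polynomial in the gaps
  \<open>(y - x, z - y, (x - bot) + (top - z))\<close>, whose normalised coefficients are the numbers \<open>F(a,b)\<close>.
  Here everything is done combinatorially, with weighted counts of linear extensions in place of
  mixed volumes. A weight is a product of directions in gap space, and for each weight there is a
  quadratic form on the facets (the relations that can be contracted). It has at most one positive
  eigenvalue: contracting a facet lowers the dimension, and by Bochner's method the form inherits
  the property from the forms on all contractions as soon as its facets are connected. The step needs
  the form to be at most the weighted sum of its restrictions to the facets; the difference is a
  nonnegative combination of squares, one for each four-cycle of facets. The induction ends
  at dimension two, and letting positive directions tend to unit vectors isolates single counts.
\<close>

text \<open>Order polytopes are not simple, and this shapes the proof: a diamond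
  \<open>a < b, c < d\<close> or a bowtie \<open>a, b < c, d\<close> gives a codimension-three face
  that lies on four facets. For simple polytopes, the comparison of the form with its restrictions
  to the facets in Bochner's method is an identity. Perturbing to a simple polytope would leave the
  class of posets. So every triple of facets whose contribution fails to cancel is completed to a
  diamond or a bowtie, and the sum over these turns out to have a sign. Bottom and top share the
  third gap, so that the three gaps always add up to the height of the top; a count with prescribed
  \<open>(a, b)\<close> is then a single coefficient. The price is that one of the two outer steps
  may vanish while the other keeps the gap positive. Values of one strictly increasing map are
  compared where one would otherwise argue by transitivity.\<close>

text \<open>
  The marks 0 and 4 are the bottom and the top element, the marks 1, 2, 3 the elements whose gaps
  are recorded; bottom and mark 1, or mark 3 and top, may get identified by contractions.
\<close>

record 'b marked =
  elems :: "'b set"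
  rels :: "('b \<times> 'b) set"
  mark :: "nat \<Rightarrow> 'b"

definition gaps :: "'b marked \<Rightarrow> ('b \<Rightarrow> 'n::ab_group_add) \<Rightarrow> 'n \<times> 'n \<times> 'n" where
  "gaps P f = (f (mark P 2) - f (mark P 1), f (mark P 3) - f (mark P 2),
     f (mark P 1) - f (mark P 0) + (f (mark P 4) - f (mark P 3)))"

definition pos_gaps :: "int \<times> int \<times> int \<Rightarrow> bool" where
  "pos_gaps s \<longleftrightarrow> 1 \<le> fst s \<and> 1 \<le> fst (snd s) \<and> 1 \<le> snd (snd s)"

text \<open>
  When the pairs in \<open>B\<close> can be contracted one after the other, \<open>layer P B\<close> consists of the linear
  extensions of the resulting poset, written as maps on the original elements.
\<close>

definition layer :: "'b marked \<Rightarrow> ('b \<times> 'b) set \<Rightarrow> ('b \<Rightarrow> int) set" where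
  "layer P B = {L \<in> extensional (elems P).
     L ` elems P = {0..<int (card (elems P)) - int (card B)} \<and>
     (\<forall>(p, q)\<in>rels P. L p \<le> L q) \<and> (\<forall>(p, q)\<in>B. L p = L q) \<and> pos_gaps (gaps P L)}"

definition vol :: "'b marked \<Rightarrow> ('b \<times> 'b) set \<Rightarrow> (int \<times> int \<times> int \<Rightarrow> real) \<Rightarrow> real" where
  "vol P B \<omega> = (\<Sum>L\<in>layer P B. \<omega> (gaps P L))"

text \<open>Reading \<open>\<omega>\<close> as the coefficients of a polynomial in three variables,
  this is multiplication by the linear form with coefficients \<open>\<tau>\<close>; so
  \<open>vol\<close> of an iterated shift plays the role of a mixed volume.\<close>

definition shift :: "real \<times> real \<times> real \<Rightarrow> (int \<times> int \<times> int \<Rightarrow> real) \<Rightarrow> int \<times> int \<times> int \<Rightarrow> real" where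
  "shift \<tau> \<omega> = (\<lambda>(s1, s2, s3). fst \<tau> * \<omega> (s1 - 1, s2, s3) + fst (snd \<tau>) * \<omega> (s1, s2 - 1, s3)
     + snd (snd \<tau>) * \<omega> (s1, s2, s3 - 1))"

definition supported :: "(int \<times> int \<times> int \<Rightarrow> real) \<Rightarrow> bool" where
  "supported \<omega> \<longleftrightarrow> (\<forall>s. \<not> pos_gaps s \<longrightarrow> \<omega> s = 0)"

text \<open>For a field \<open>a\<close> of displacements this is the change of the support number
  of the facet \<open>k\<close>.\<close>

definition df :: "('b \<Rightarrow> real) \<Rightarrow> 'b \<times> 'b \<Rightarrow> real" where
  "df a k = a (snd k) - a (fst k)"

text \<open>A relation with an element between its ends, or one whose contraction closes a gap,
  bounds no facet; emptiness of the layer detects both.\<close>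

definition facets :: "'b marked \<Rightarrow> ('b \<times> 'b) set" where
  "facets P = {k \<in> rels P. layer P {k} \<noteq> {}}"

text \<open>The nonempty layer gives acyclicity. Through the third gap it also forbids that bottom
  coincides with mark 1 while mark 3 coincides with top.\<close>

definition valid :: "'b marked \<Rightarrow> bool" where
  "valid P \<longleftrightarrow> finite (elems P) \<and> rels P \<subseteq> elems P \<times> elems P \<and> irrefl (rels P) \<and>
     (\<forall>i. mark P i \<in> elems P) \<and>
     (\<forall>e\<in>elems P. e \<noteq> mark P 0 \<longrightarrow> (mark P 0, e) \<in> rels P) \<and>
     (\<forall>e\<in>elems P. e \<noteq> mark P 4 \<longrightarrow> (e, mark P 4) \<in> rels P) \<and>
     (mark P 1, mark P 2) \<in> rels P \<and> (mark P 2, mark P 3) \<in> rels P \<and> layer P {} \<noteq> {}"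

definition glue :: "'b \<times> 'b \<Rightarrow> 'b \<Rightarrow> 'b" where
  "glue k e = (if e = snd k then fst k else e)"

definition contract :: "'b marked \<Rightarrow> 'b \<times> 'b \<Rightarrow> 'b marked" where
  "contract P k = \<lparr>elems = elems P - {snd k},
     rels = map_prod (glue k) (glue k) ` rels P - Id, mark = glue k \<circ> mark P\<rparr>"

section \<open>Layers and their fibres\<close>

lemma supported_shift: "supported \<omega> \<Longrightarrow> supported (shift \<tau> \<omega>)"
  unfolding supported_def shift_def pos_gaps_def by (auto simp: split_beta)

lemma shift_zero: "shift (0, 0, 0) \<omega> = (\<lambda>_. 0)"
  unfolding shift_def by (auto simp: fun_eq_iff)

lemma vol_zero [simp]: "vol P B (\<lambda>_. 0) = 0"
  unfolding vol_def by simp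

lemma
  assumes "valid P"
  shows valid_finite: "finite (elems P)"
    and valid_rels: "\<And>p q. (p, q) \<in> rels P \<Longrightarrow> p \<in> elems P \<and> q \<in> elems P \<and> p \<noteq> q"
    and valid_mark: "\<And>i. mark P i \<in> elems P"
    and valid_bot: "\<And>e. e \<in> elems P \<Longrightarrow> e \<noteq> mark P 0 \<Longrightarrow> (mark P 0, e) \<in> rels P"
    and valid_top: "\<And>e. e \<in> elems P \<Longrightarrow> e \<noteq> mark P 4 \<Longrightarrow> (e, mark P 4) \<in> rels P"
    and valid_12: "(mark P 1, mark P 2) \<in> rels P"
    and valid_23: "(mark P 2, mark P 3) \<in> rels P"
    and valid_nonempty: "layer P {} \<noteq> {}"
    and valid_finite_rels: "finite (rels P)"
  using assms unfolding valid_def irrefl_def by (auto intro: finite_subset)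

lemma
  assumes "L \<in> layer P B"
  shows layer_ext: "L \<in> extensional (elems P)"
    and layer_image: "L ` elems P = {0..<int (card (elems P)) - int (card B)}"
    and layer_mono: "\<And>p q. (p, q) \<in> rels P \<Longrightarrow> L p \<le> L q"
    and layer_eq: "\<And>p q. (p, q) \<in> B \<Longrightarrow> L p = L q"
    and layer_positive: "pos_gaps (gaps P L)"
  using assms unfolding layer_def by auto

lemma layerI:
  assumes "L \<in> extensional (elems P)"
    and "L ` elems P = {0..<int (card (elems P)) - int (card B)}"
    and "\<And>p q. (p, q) \<in> rels P \<Longrightarrow> L p \<le> L q"
    and "\<And>p q. (p, q) \<in> B \<Longrightarrow> L p = L q"
    and "pos_gaps (gaps P L)"
  shows "L \<in> layer P B"
  using assms unfolding layer_def by auto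

lemma finite_layer:
  assumes "valid P" shows "finite (layer P B)"
proof (rule finite_subset)
  show "layer P B \<subseteq> (\<Pi>\<^sub>E e\<in>elems P. {0..<int (card (elems P)) - int (card B)})"
  proof
    fix L assume L: "L \<in> layer P B"
    then have "\<And>e. e \<in> elems P \<Longrightarrow> L e \<in> {0..<int (card (elems P)) - int (card B)}"
      using layer_image[OF L] by blast
    then show "L \<in> (\<Pi>\<^sub>E e\<in>elems P. {0..<int (card (elems P)) - int (card B)})"
      using layer_ext[OF L] by (auto simp: PiE_def)
  qed
  show "finite (\<Pi>\<^sub>E e\<in>elems P. {0..<int (card (elems P)) - int (card B)})"
    using valid_finite[OF assms] by (intro finite_PiE) auto
qed

text \<open>The third gap is a sum of two nonnegative steps, so one positive step suffices; this is
  what allows the other one to be contracted.\<close>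

lemma pos_gaps_iff:
  fixes L :: "'b \<Rightarrow> int"
  assumes "valid P" and "\<And>p q. (p, q) \<in> rels P \<Longrightarrow> L p \<le> L q"
  shows "pos_gaps (gaps P L) \<longleftrightarrow> L (mark P 1) < L (mark P 2) \<and> L (mark P 2) < L (mark P 3) \<and>
    (L (mark P 0) < L (mark P 1) \<or> L (mark P 3) < L (mark P 4))"
proof -
  have "L (mark P 0) \<le> L (mark P 1)" "L (mark P 3) \<le> L (mark P 4)"
    using assms valid_bot[OF assms(1) valid_mark[OF assms(1), of 1]]
      valid_top[OF assms(1) valid_mark[OF assms(1), of 3]] by force+
  then show ?thesis unfolding pos_gaps_def gaps_def by auto
qed

text \<open>Positivity of the gaps depends only on strict inequalities between marks, so surgery on
  a linear extension has to preserve nothing more.\<close>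

lemma pos_gaps_transfer:
  fixes L L' :: "'b \<Rightarrow> int"
  assumes P: "valid P" and "pos_gaps (gaps P L)"
    and m: "\<And>p q. (p, q) \<in> rels P \<Longrightarrow> L p \<le> L q" and m': "\<And>p q. (p, q) \<in> rels P \<Longrightarrow> L' p \<le> L' q"
    and lt: "\<And>i j. i \<le> 4 \<Longrightarrow> j \<le> 4 \<Longrightarrow> L (mark P i) < L (mark P j) \<Longrightarrow> L' (mark P i) < L' (mark P j)"
  shows "pos_gaps (gaps P L')"
proof -
  have "pos_gaps (gaps P L) \<longleftrightarrow> L (mark P 1) < L (mark P 2) \<and> L (mark P 2) < L (mark P 3) \<and>
    (L (mark P 0) < L (mark P 1) \<or> L (mark P 3) < L (mark P 4))"
    using P m by (rule pos_gaps_iff)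
  moreover have "pos_gaps (gaps P L') \<longleftrightarrow> L' (mark P 1) < L' (mark P 2) \<and> L' (mark P 2) < L' (mark P 3) \<and>
    (L' (mark P 0) < L' (mark P 1) \<or> L' (mark P 3) < L' (mark P 4))"
    using P m' by (rule pos_gaps_iff)
  ultimately show ?thesis using assms(2) lt[of 1 2] lt[of 2 3] lt[of 0 1] lt[of 3 4] by auto
qed

text \<open>A layer takes \<open>card (elems P) - card B\<close> values, so at most
  \<open>card B\<close> elements can repeat a value already taken.\<close>

lemma card_fibre_le:
  assumes P: "valid P" and L: "L \<in> layer P B" and T: "T \<subseteq> elems P" and c: "\<And>e. e \<in> T \<Longrightarrow> L e = j"
  shows "card T \<le> card B + 1"
proof -
  have fin: "finite (elems P)" using valid_finite[OF P] .
  have "L ` elems P \<subseteq> insert j (L ` (elems P - T))" using c by auto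
  then have "card (L ` elems P) \<le> card (insert j (L ` (elems P - T)))"
    using fin by (intro card_mono) auto
  also have "\<dots> \<le> card (L ` (elems P - T)) + 1" by (simp add: card_insert_le_m1 card_insert_if fin)
  also have "\<dots> \<le> card (elems P - T) + 1" using card_image_le[of "elems P - T" L] fin by simp
  also have "card (elems P - T) = card (elems P) - card T"
    using T fin by (simp add: card_Diff_subset finite_subset)
  finally have 1: "card (L ` elems P) \<le> card (elems P) - card T + 1" by simp
  have "card (L ` elems P) = nat (int (card (elems P)) - int (card B))"
    unfolding layer_image[OF L] by simp
  moreover have "L ` elems P \<noteq> {}" using valid_mark[OF P] by auto
  then have "int (card B) < int (card (elems P))" unfolding layer_image[OF L] by auto
  moreover have "card T \<le> card (elems P)" using T fin card_mono by blast
  ultimately show ?thesis using 1 by simp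
qed

lemma layer_empty_inj:
  assumes P: "valid P" and L: "L \<in> layer P {}"
  shows "inj_on L (elems P)"
proof (rule inj_onI, rule ccontr)
  fix p q assume "p \<in> elems P" "q \<in> elems P" "L p = L q" "p \<noteq> q"
  then show False using card_fibre_le[OF P L, of "{p, q}" "L p"] by auto
qed

lemma layer_empty_less:
  assumes P: "valid P" and L: "L \<in> layer P {}" and "(p, q) \<in> rels P"
  shows "L p < L q"
  using layer_mono[OF L assms(3)] layer_empty_inj[OF P L] valid_rels[OF P assms(3)]
  by (metis inj_on_def order_le_less)

lemma valid_asym:
  assumes P: "valid P" and "(p, q) \<in> rels P" shows "(q, p) \<notin> rels P"
proof -
  obtain L where L: "L \<in> layer P {}" using valid_nonempty[OF P] by auto
  show ?thesis using layer_empty_less[OF P L assms(2)] layer_empty_less[OF P L, of q p] by auto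
qed

lemma layer_bot:
  assumes P: "valid P" and L: "L \<in> layer P B" shows "L (mark P 0) = 0"
proof -
  have ne: "L (mark P 0) \<in> L ` elems P" using valid_mark[OF P] by auto
  then have "(0::int) \<in> {0..<int (card (elems P)) - int (card B)}" and ge: "0 \<le> L (mark P 0)"
    unfolding layer_image[OF L] by auto
  then obtain e where "e \<in> elems P" "L e = 0" unfolding layer_image[OF L, symmetric] by auto
  then show ?thesis using ge valid_bot[OF P, of e] layer_mono[OF L] by force
qed

lemma layer_top:
  assumes P: "valid P" and L: "L \<in> layer P B"
  shows "L (mark P 4) = int (card (elems P)) - int (card B) - 1"
proof -
  have ne: "L (mark P 4) \<in> L ` elems P" using valid_mark[OF P] by auto
  then have "int (card (elems P)) - int (card B) - 1 \<in> {0..<int (card (elems P)) - int (card B)}"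
    and le: "L (mark P 4) \<le> int (card (elems P)) - int (card B) - 1"
    unfolding layer_image[OF L] by auto
  then obtain e where "e \<in> elems P" "L e = int (card (elems P)) - int (card B) - 1"
    unfolding layer_image[OF L, symmetric] by force
  then show ?thesis using le valid_top[OF P, of e] layer_mono[OF L] by force
qed

lemma sum_gaps_layer:
  assumes P: "valid P" and L: "L \<in> layer P B" and g: "gaps P L = (s1, s2, s3)"
  shows "s1 + s2 + s3 = int (card (elems P)) - int (card B) - 1"
  using g layer_bot[OF P L] layer_top[OF P L] unfolding gaps_def by auto

subsection \<open>Contraction\<close>

lemma contract_simps [simp]:
  "elems (contract P k) = elems P - {snd k}"
  "rels (contract P k) = map_prod (glue k) (glue k) ` rels P - Id"
  "mark (contract P k) i = glue k (mark P i)"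
  by (simp_all add: contract_def)

lemma glue_simps [simp]:
  "glue k (glue k e) = glue k e" "glue (u, v) u = u" "glue (u, v) v = u"
  "e \<noteq> snd k \<Longrightarrow> glue k e = e"
  by (auto simp: glue_def)

lemma gaps_glue: "gaps P (\<lambda>e. f (glue k e)) = gaps (contract P k) f"
  by (simp add: gaps_def)

text \<open>Maps on the contraction pull back along \<open>glue k\<close>. Injectivity keeps the
  pairs in \<open>B\<close> from merging, so the contraction loses one element and one pair and the
  ranges agree.\<close>

lemma bij_betw_layer_contract:
  assumes P: "valid P" and k: "k \<in> rels P"
    and fB: "finite B" and B: "B \<subseteq> elems P \<times> elems P" and kB: "k \<notin> B"
    and inj: "inj_on (map_prod (glue k) (glue k)) B"
  shows "bij_betw (\<lambda>L. restrict (\<lambda>e. L (glue k e)) (elems P))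
     (layer (contract P k) (map_prod (glue k) (glue k) ` B)) (layer P (insert k B))"
    (is "bij_betw ?f ?X ?Y")
proof -
  obtain u v where kd: "k = (u, v)" by fastforce
  have uv: "u \<in> elems P" "v \<in> elems P" "u \<noteq> v" using valid_rels[OF P] k kd by auto
  have fin: "finite (elems P)" using valid_finite[OF P] .
  have me: "glue k e \<in> elems P - {v}" if "e \<in> elems P" for e using that uv by (auto simp: glue_def kd)
  have im: "glue k ` elems P = elems P - {v}"
  proof (intro equalityI subsetI)
    fix e assume "e \<in> elems P - {v}"
    then have "e = glue k e" "e \<in> elems P" by (auto simp: glue_def kd)
    then show "e \<in> glue k ` elems P" by blast
  qed (use me in auto)
  have cE: "int (card (elems P - {v})) = int (card (elems P)) - 1"
    using uv fin by (metis card_Suc_Diff1 diff_add_cancel of_nat_Suc add.commute add_diff_cancel_left')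
  have cards: "int (card (elems (contract P k))) - int (card (map_prod (glue k) (glue k) ` B))
      = int (card (elems P)) - int (card (insert k B))"
    using cE card_image[OF inj] fB kB by (simp add: kd)
  have gp: "gaps P (restrict f (elems P)) = gaps P f" for f :: "'a \<Rightarrow> int"
    using valid_mark[OF P] by (simp add: gaps_def)
  show ?thesis
  proof (rule bij_betw_byWitness[where f' = "\<lambda>L. restrict L (elems P - {v})"])
    show "\<forall>L\<in>?X. restrict (?f L) (elems P - {v}) = L"
    proof
      fix L assume L: "L \<in> ?X"
      show "restrict (?f L) (elems P - {v}) = L"
      proof (rule extensionalityI[where A = "elems P - {v}"])
        show "L \<in> extensional (elems P - {v})" using layer_ext[OF L] kd by simp
      qed (auto simp: glue_def kd)
    qed
    show "\<forall>L\<in>?Y. ?f (restrict L (elems P - {v})) = L"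
    proof
      fix L assume L: "L \<in> ?Y"
      have "L u = L v" using layer_eq[OF L, of u v] kd by simp
      then show "?f (restrict L (elems P - {v})) = L"
        by (intro extensionalityI[where A = "elems P"]) (use uv layer_ext[OF L] in \<open>auto simp: glue_def kd\<close>)
    qed
    show "?f ` ?X \<subseteq> ?Y"
    proof (rule image_subsetI)
      fix L assume L: "L \<in> ?X"
      show "?f L \<in> ?Y"
      proof (rule layerI)
        show "?f L ` elems P = {0..<int (card (elems P)) - int (card (insert k B))}"
        proof -
          have "?f L ` elems P = L ` (glue k ` elems P)" by (auto simp: image_image)
          also have "\<dots> = L ` elems (contract P k)" using im by (simp add: kd)
          finally show ?thesis using layer_image[OF L] cards by simp
        qed
        show "?f L p \<le> ?f L q" if pq: "(p, q) \<in> rels P" for p q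
        proof (cases "glue k p = glue k q")
          case False
          then have "(glue k p, glue k q) \<in> rels (contract P k)" using pq by force
          then show ?thesis using layer_mono[OF L] valid_rels[OF P pq] by simp
        qed (use valid_rels[OF P pq] in simp)
        show "?f L p = ?f L q" if "(p, q) \<in> insert k B" for p q
        proof -
          have pqE: "p \<in> elems P" "q \<in> elems P" using that B uv kd by auto
          have "L (glue k p) = L (glue k q)"
          proof (cases "(p, q) = k")
            case False
            then have "(p, q) \<in> B" using that by auto
            then have "(glue k p, glue k q) \<in> map_prod (glue k) (glue k) ` B" by force
            then show ?thesis by (rule layer_eq[OF L])
          qed (auto simp: kd)
          then show ?thesis using pqE by simp
        qed
        show "pos_gaps (gaps P (?f L))"
          using layer_positive[OF L] unfolding gp gaps_glue .
      qed simp
    qed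
    show "(\<lambda>L. restrict L (elems P - {v})) ` ?Y \<subseteq> ?X"
    proof (rule image_subsetI)
      fix L assume L: "L \<in> ?Y"
      have Luv: "L u = L v" using layer_eq[OF L, of u v] kd by simp
      have Lm: "restrict L (elems P - {v}) (glue k e) = L e" if "e \<in> elems P" for e
        using that Luv uv by (auto simp: glue_def kd)
      show "restrict L (elems P - {v}) \<in> ?X"
      proof (rule layerI)
        show "restrict L (elems P - {v}) \<in> extensional (elems (contract P k))" by (simp add: kd)
        have "restrict L (elems P - {v}) ` elems (contract P k) = L ` elems P"
        proof -
          have "restrict L (elems P - {v}) ` elems (contract P k) = restrict L (elems P - {v}) ` (glue k ` elems P)"
            using im by (simp add: kd)
          also have "\<dots> = L ` elems P" unfolding image_image using Lm by auto
          finally show ?thesis .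
        qed
        then show "restrict L (elems P - {v}) ` elems (contract P k) =
          {0..<int (card (elems (contract P k))) - int (card (map_prod (glue k) (glue k) ` B))}"
          unfolding cards using layer_image[OF L] by simp
        show "restrict L (elems P - {v}) p \<le> restrict L (elems P - {v}) q"
          if pq: "(p, q) \<in> rels (contract P k)" for p q
        proof -
          obtain x where "x \<in> rels P" "(p, q) = map_prod (glue k) (glue k) x" using pq by fastforce
          then have "(fst x, snd x) \<in> rels P" "p = glue k (fst x)" "q = glue k (snd x)"
            by (auto simp: map_prod_def split_beta)
          then obtain p' q' where "(p', q') \<in> rels P" "p = glue k p'" "q = glue k q'" by blast
          then show ?thesis using Lm valid_rels[OF P] layer_mono[OF L] by metis
        qed
        show "restrict L (elems P - {v}) p = restrict L (elems P - {v}) q"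
          if pqB: "(p, q) \<in> map_prod (glue k) (glue k) ` B" for p q
        proof -
          obtain x where "x \<in> B" "(p, q) = map_prod (glue k) (glue k) x" using pqB by fastforce
          then have "(fst x, snd x) \<in> B" "p = glue k (fst x)" "q = glue k (snd x)"
            by (auto simp: map_prod_def split_beta)
          then obtain p' q' where pq: "(p', q') \<in> B" "p = glue k p'" "q = glue k q'" by blast
          then have "p' \<in> elems P" "q' \<in> elems P" "L p' = L q'" using B layer_eq[OF L, of p' q'] by auto
          then show ?thesis using Lm pq by metis
        qed
        have "gaps P L = gaps (contract P k) (restrict L (elems P - {v}))"
          unfolding gaps_glue[symmetric] by (simp only: gaps_def Lm[OF valid_mark[OF P]])
        then show "pos_gaps (gaps (contract P k) (restrict L (elems P - {v})))"
          using layer_positive[OF L] by simp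
      qed
    qed
  qed
qed

lemma vol_contract:
  assumes P: "valid P" and k: "k \<in> rels P"
    and fB: "finite B" and B: "B \<subseteq> elems P \<times> elems P" and kB: "k \<notin> B"
    and inj: "inj_on (map_prod (glue k) (glue k)) B"
  shows "vol (contract P k) (map_prod (glue k) (glue k) ` B) \<omega> = vol P (insert k B) \<omega>"
proof -
  have gp: "gaps P (restrict f (elems P)) = gaps P f" for f :: "'a \<Rightarrow> int"
    using valid_mark[OF P] by (simp add: gaps_def)
  show ?thesis
    using sum.reindex_bij_betw[OF bij_betw_layer_contract[OF assms], of "\<lambda>L. \<omega> (gaps P L)"]
    unfolding vol_def gp gaps_glue .
qed

lemma layer_contract_empty_iff:
  assumes P: "valid P" and k: "k \<in> rels P"
    and fB: "finite B" and B: "B \<subseteq> elems P \<times> elems P" and kB: "k \<notin> B"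
    and inj: "inj_on (map_prod (glue k) (glue k)) B"
  shows "layer (contract P k) (map_prod (glue k) (glue k) ` B) = {} \<longleftrightarrow> layer P (insert k B) = {}"
  using bij_betw_imp_surj_on[OF bij_betw_layer_contract[OF assms]] by auto

text \<open>A map in the layer of \<open>k\<close> has positive gaps and is constant on the glued
  pair, hence marks 1, 2 and 3 stay apart.\<close>

lemma valid_contract:
  assumes P: "valid P" and k: "k \<in> facets P"
  shows "valid (contract P k)"
proof -
  obtain u v where kd: "k = (u, v)" by fastforce
  have kr: "k \<in> rels P" using k by (simp add: facets_def)
  have uv: "u \<in> elems P" "v \<in> elems P" "u \<noteq> v" using valid_rels[OF P] kr kd by auto
  have ne: "layer (contract P k) {} \<noteq> {}"
    using layer_contract_empty_iff[OF P kr, of "{}"] k by (simp add: facets_def)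
  then obtain L where L: "L \<in> layer (contract P k) {}" by auto
  obtain C where C: "C \<in> layer P {k}" using k by (auto simp: facets_def)
  have pC: "C (mark P 1) < C (mark P 2)" "C (mark P 2) < C (mark P 3)"
    using layer_positive[OF C] by (auto simp: pos_gaps_def gaps_def)
  have Cm: "C (glue k e) = C e" for e using layer_eq[OF C, of u v] by (auto simp: glue_def kd)
  have rm: "(glue k p, glue k q) \<in> rels (contract P k)" if "(p, q) \<in> rels P" "glue k p \<noteq> glue k q" for p q
    using that by force
  have me: "glue k e \<in> elems P - {v}" if "e \<in> elems P" for e using that uv by (auto simp: glue_def kd)
  show ?thesis unfolding valid_def
  proof (intro conjI allI ballI impI)
    show "finite (elems (contract P k))" using valid_finite[OF P] by simp
    show "rels (contract P k) \<subseteq> elems (contract P k) \<times> elems (contract P k)"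
      using valid_rels[OF P] me by (auto simp: kd)
    show "irrefl (rels (contract P k))" by (auto simp: irrefl_def)
    show "mark (contract P k) i \<in> elems (contract P k)" for i using me valid_mark[OF P] by (simp add: kd)
    show "(mark (contract P k) 0, e) \<in> rels (contract P k)"
      if "e \<in> elems (contract P k)" "e \<noteq> mark (contract P k) 0" for e
    proof -
      have "glue k e = e" "e \<in> elems P" "e \<noteq> mark P 0" using that by (auto simp: kd)
      then show ?thesis using rm[OF valid_bot[OF P, of e]] that by simp
    qed
    show "(e, mark (contract P k) 4) \<in> rels (contract P k)"
      if "e \<in> elems (contract P k)" "e \<noteq> mark (contract P k) 4" for e
    proof -
      have "glue k e = e" "e \<in> elems P" "e \<noteq> mark P 4" using that by (auto simp: kd)
      then show ?thesis using rm[OF valid_top[OF P, of e]] that by simp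
    qed
    show "(mark (contract P k) 1, mark (contract P k) 2) \<in> rels (contract P k)"
      using rm[OF valid_12[OF P]] pC Cm by (metis contract_simps(3) order_less_irrefl)
    show "(mark (contract P k) 2, mark (contract P k) 3) \<in> rels (contract P k)"
      using rm[OF valid_23[OF P]] pC Cm by (metis contract_simps(3) order_less_irrefl)
  qed (rule ne)
qed

lemma card_elems_contract:
  assumes "valid P" "k \<in> rels P" shows "card (elems P) = Suc (card (elems (contract P k)))"
  using assms valid_finite[OF assms(1)] valid_rels[OF assms(1), of "fst k" "snd k"]
  by (simp add: card_Suc_Diff1 del: card_Diff_insert)

section \<open>Closing one step of a linear extension\<close>

lemma sum_telescope_int:
  fixes h :: "int \<Rightarrow> real"
  assumes "m \<le> m'" shows "(\<Sum>i\<in>{m..<m'}. h (i + 1) - h i) = h m' - h m"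
  using assms
proof (induction m' rule: int_ge_induct)
  case (step i)
  have "{m..<i + 1} = insert i {m..<i}" using step by auto
  then show ?case using step by simp
qed simp

text \<open>Strict maps separate related marks, and validity keeps one of the two outer pairs of
  marks distinct.\<close>

lemma inj_pos_gaps:
  fixes L :: "'b \<Rightarrow> int"
  assumes P: "valid P" and m: "\<And>p q. (p, q) \<in> rels P \<Longrightarrow> L p < L q"
  shows "pos_gaps (gaps P L)"
proof -
  obtain C where C: "C \<in> layer P {}" using valid_nonempty[OF P] by auto
  have "pos_gaps (gaps P C) \<longleftrightarrow> C (mark P 1) < C (mark P 2) \<and> C (mark P 2) < C (mark P 3) \<and>
    (C (mark P 0) < C (mark P 1) \<or> C (mark P 3) < C (mark P 4))"
    using P layer_mono[OF C] by (rule pos_gaps_iff)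
  then have "mark P 0 \<noteq> mark P 1 \<or> mark P 3 \<noteq> mark P 4" using layer_positive[OF C] by auto
  then have "L (mark P 0) < L (mark P 1) \<or> L (mark P 3) < L (mark P 4)"
    using m valid_bot[OF P valid_mark[OF P, of 1]] valid_top[OF P valid_mark[OF P, of 3]] by metis
  moreover have "pos_gaps (gaps P L) \<longleftrightarrow> L (mark P 1) < L (mark P 2) \<and> L (mark P 2) < L (mark P 3) \<and>
    (L (mark P 0) < L (mark P 1) \<or> L (mark P 3) < L (mark P 4))"
    using P less_imp_le[OF m] by (rule pos_gaps_iff)
  ultimately show ?thesis using m[OF valid_12[OF P]] m[OF valid_23[OF P]] by blast
qed

lemma fibre_pair:
  assumes P: "valid P" and k: "(u, v) \<in> rels P" and C: "C \<in> layer P {(u, v)}"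
    and e: "e \<in> elems P" "C e = C u"
  shows "e = u \<or> e = v"
proof (rule ccontr)
  assume ne: "\<not> (e = u \<or> e = v)"
  have "u \<noteq> v" using valid_rels[OF P k] by simp
  then have "card {u, v, e} = 3" using ne by (auto simp: card_insert_if)
  moreover have "card {u, v, e} \<le> card {(u, v)} + 1"
    using e valid_rels[OF P k] layer_eq[OF C, of u v]
    by (intro card_fibre_le[OF P C, where j = "C u"]) auto
  ultimately show False by simp
qed

text \<open>A linear extension is a simplex in the triangulation of the order polytope, and closing
  the step above level \<open>i\<close> passes to one of its facets; \<open>expand\<close> recovers
  the simplex.\<close>

definition collapse :: "'b marked \<Rightarrow> int \<Rightarrow> ('b \<Rightarrow> int) \<Rightarrow> 'b \<Rightarrow> int" where
  "collapse P i L = restrict (\<lambda>e. if L e \<le> i then L e else L e - 1) (elems P)"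

definition expand :: "'b marked \<Rightarrow> 'b \<times> 'b \<Rightarrow> ('b \<Rightarrow> int) \<Rightarrow> 'b \<Rightarrow> int" where
  "expand P k C = restrict (\<lambda>e. if e = snd k \<or> C (fst k) < C e then C e + 1 else C e) (elems P)"

definition adjacent :: "'b marked \<Rightarrow> 'b \<times> 'b \<Rightarrow> ('b \<Rightarrow> int) set" where
  "adjacent P k = {L \<in> layer P {}. L (snd k) = L (fst k) + 1}"

lemma layer_empty_range:
  assumes "L \<in> layer P {}" "e \<in> elems P" shows "0 \<le> L e" "L e < int (card (elems P))"
  using layer_image[OF assms(1)] assms(2) by (auto simp: set_eq_iff image_iff)

text \<open>The facet \<open>k\<close> is tiled by the simplex facets lying on it, which come from
  the extensions with \<open>v\<close> directly above \<open>u\<close>. The condition on the left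
  removes those where closing the step closes a whole gap.\<close>

lemma bij_betw_collapse:
  assumes P: "valid P" and k: "(u, v) \<in> rels P"
  shows "bij_betw (\<lambda>L. collapse P (L u) L)
    {L \<in> adjacent P (u, v). pos_gaps (gaps P (collapse P (L u) L))} (layer P {(u, v)})"
proof (rule bij_betw_byWitness[where f' = "expand P (u, v)"])
  have uv: "u \<in> elems P" "v \<in> elems P" "u \<noteq> v" using valid_rels[OF P k] by auto
  let ?n = "int (card (elems P))"
  show "\<forall>L\<in>{L \<in> adjacent P (u, v). pos_gaps (gaps P (collapse P (L u) L))}.
      expand P (u, v) (collapse P (L u) L) = L"
  proof
    fix L assume "L \<in> {L \<in> adjacent P (u, v). pos_gaps (gaps P (collapse P (L u) L))}"
    then have L: "L \<in> layer P {}" and a: "L v = L u + 1" by (auto simp: adjacent_def)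
    have v: "e = v" if "e \<in> elems P" "L e = L u + 1" for e
      using inj_onD[OF layer_empty_inj[OF P L], of e v] that uv a by simp
    show "expand P (u, v) (collapse P (L u) L) = L"
    proof (rule extensionalityI[where A = "elems P"])
      fix e assume e: "e \<in> elems P"
      consider "L e \<le> L u" | "L e = L u + 1" | "L u + 1 < L e" by linarith
      then show "expand P (u, v) (collapse P (L u) L) e = L e"
        by cases (use e v[OF e] uv a in \<open>auto simp: expand_def collapse_def\<close>)
    qed (use layer_ext[OF L] in \<open>auto simp: expand_def\<close>)
  qed
  show "\<forall>C\<in>layer P {(u, v)}. collapse P (expand P (u, v) C u) (expand P (u, v) C) = C"
  proof
    fix C assume C: "C \<in> layer P {(u, v)}"
    have "C u = C v" using layer_eq[OF C, of u v] by simp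
    then show "collapse P (expand P (u, v) C u) (expand P (u, v) C) = C"
      by (intro extensionalityI[where A = "elems P"])
        (use uv layer_ext[OF C] in \<open>auto simp: expand_def collapse_def\<close>)
  qed
  show "(\<lambda>L. collapse P (L u) L) `
      {L \<in> adjacent P (u, v). pos_gaps (gaps P (collapse P (L u) L))} \<subseteq> layer P {(u, v)}"
  proof (rule image_subsetI)
    fix L assume LL: "L \<in> {L \<in> adjacent P (u, v). pos_gaps (gaps P (collapse P (L u) L))}"
    then have L: "L \<in> layer P {}" and a: "L v = L u + 1" and
      g: "pos_gaps (gaps P (collapse P (L u) L))" by (auto simp: adjacent_def)
    have r: "0 \<le> L u" "L u + 1 < ?n" using layer_empty_range[OF L uv(1)] layer_empty_range[OF L uv(2)] a by auto
    show "collapse P (L u) L \<in> layer P {(u, v)}"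
    proof (rule layerI)
      have "collapse P (L u) L ` elems P = (\<lambda>j. if j \<le> L u then j else j - 1) ` (L ` elems P)"
        by (auto simp: collapse_def image_image)
      also have "L ` elems P = {0..<?n}" using layer_image[OF L] by simp
      also have "(\<lambda>j. if j \<le> L u then j else j - 1) ` {0..<?n} = {0..<?n - 1}"
      proof (intro equalityI subsetI)
        fix j assume "j \<in> {0..<?n - 1}"
        then have "j = (\<lambda>j. if j \<le> L u then j else j - 1) (if j \<le> L u then j else j + 1)"
          "(if j \<le> L u then j else j + 1) \<in> {0..<?n}" by auto
        then show "j \<in> (\<lambda>j. if j \<le> L u then j else j - 1) ` {0..<?n}" by blast
      qed (use r in auto)
      finally show "collapse P (L u) L ` elems P = {0..<int (card (elems P)) - int (card {(u, v)})}" by simp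
      show "collapse P (L u) L p \<le> collapse P (L u) L q" if "(p, q) \<in> rels P" for p q
        using valid_rels[OF P that] layer_mono[OF L that] by (auto simp: collapse_def)
      show "collapse P (L u) L p = collapse P (L u) L q" if "(p, q) \<in> {(u, v)}" for p q
        using that a uv by (auto simp: collapse_def)
    qed (use g in \<open>auto simp: collapse_def\<close>)
  qed
  show "expand P (u, v) ` layer P {(u, v)} \<subseteq>
      {L \<in> adjacent P (u, v). pos_gaps (gaps P (collapse P (L u) L))}"
  proof (rule image_subsetI)
    fix C assume C: "C \<in> layer P {(u, v)}"
    have Cuv: "C u = C v" using layer_eq[OF C, of u v] by simp
    define L where "L = expand P (u, v) C"
    have Le: "L e = (if e = v \<or> C u < C e then C e + 1 else C e)" if "e \<in> elems P" for e
      using that by (simp add: L_def expand_def)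
    have im: "C ` elems P = {0..<?n - 1}" using layer_image[OF C] by simp
    have Cr: "0 \<le> C e" "C e < ?n - 1" if "e \<in> elems P" for e using im that by auto
    have fib: "e = u \<or> e = v" if "e \<in> elems P" "C e = C u" for e
      using fibre_pair[OF P k C that] .
    have mono: "L p \<le> L q" if pq: "(p, q) \<in> rels P" for p q
    proof -
      have E: "p \<in> elems P" "q \<in> elems P" "p \<noteq> q" using valid_rels[OF P pq] by auto
      have 1: "C p \<le> C q" using layer_mono[OF C pq] .
      \<comment> \<open>\<open>v\<close> is lifted, so everything above \<open>v\<close> must
        already be strictly higher. Only \<open>u\<close> and \<open>v\<close> share the level of
        \<open>u\<close>, and \<open>q = u\<close> contradicts asymmetry.\<close>
      have "C u < C q" if "p = v"
      proof (rule ccontr)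
        assume "\<not> C u < C q"
        then have "C q = C u" using 1 that Cuv by simp
        then have "q = u" using fib E that by auto
        then show False using valid_asym[OF P k] pq that by simp
      qed
      then show ?thesis using 1 E by (auto simp: Le)
    qed
    have "L \<in> layer P {}"
    proof (rule layerI)
      show "L ` elems P = {0..<int (card (elems P)) - int (card {})}"
      proof (intro equalityI subsetI)
        fix j assume "j \<in> L ` elems P"
        then obtain e where "e \<in> elems P" "j = L e" by auto
        then show "j \<in> {0..<int (card (elems P)) - int (card {})}" using Cr[of e] by (auto simp: Le)
      next
        fix j assume "j \<in> {0..<int (card (elems P)) - int (card {})}"
        then have j: "0 \<le> j" "j < ?n" by auto
        consider "j \<le> C u" | "j = C u + 1" | "C u + 1 < j" by linarith
        then show "j \<in> L ` elems P"
        proof cases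
          case 1
          then have "j \<in> C ` elems P" using j Cr[OF uv(1)] im by auto
          then obtain e where e: "e \<in> elems P" "C e = j" by auto
          \<comment> \<open>\<open>v\<close> has left its level, which \<open>u\<close> still
            occupies.\<close>
          define e' where "e' = (if e = v then u else e)"
          have "e' \<in> elems P" "L e' = j" using e 1 uv Cuv by (auto simp: e'_def Le split: if_splits)
          then show ?thesis by blast
        next
          case 2
          then have "L v = j" using uv Cuv by (simp add: Le)
          then show ?thesis using uv by blast
        next
          case 3
          then have "j - 1 \<in> C ` elems P" using j Cr[OF uv(1)] im by auto
          then obtain e where e: "e \<in> elems P" "C e = j - 1" by auto
          then have "L e = j" using 3 by (simp add: Le)
          then show ?thesis using e by blast
        qed
      qed
      show "pos_gaps (gaps P L)"
      proof (rule pos_gaps_transfer[OF P layer_positive[OF C] layer_mono[OF C] mono])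
        show "L (mark P i) < L (mark P j)" if "C (mark P i) < C (mark P j)" for i j
          using that Cuv valid_mark[OF P] by (auto simp: Le)
      qed
    qed (use mono in \<open>auto simp: L_def expand_def\<close>)
    moreover have "L v = L u + 1" using uv Cuv by (simp add: Le)
    moreover have "collapse P (L u) L = C"
      by (intro extensionalityI[where A = "elems P"])
        (use uv Cuv layer_ext[OF C] in \<open>auto simp: Le collapse_def\<close>)
    ultimately show "expand P (u, v) C \<in> {L \<in> adjacent P (u, v). pos_gaps (gaps P (collapse P (L u) L))}"
      using layer_positive[OF C] by (simp add: adjacent_def L_def)
  qed
qed

lemma finite_adjacent: "valid P \<Longrightarrow> finite (adjacent P k)"
  unfolding adjacent_def by (simp add: finite_layer)

text \<open>Extensions whose collapse loses a gap have weight zero because \<open>\<omega>\<close>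
  is supported on positive gaps; the others are counted by the bijection.\<close>

lemma sum_adjacent_rel:
  assumes P: "valid P" and s: "supported \<omega>" and k: "(u, v) \<in> rels P"
  shows "(\<Sum>L\<in>adjacent P (u, v). \<omega> (gaps P (collapse P (L u) L))) = vol P {(u, v)} \<omega>"
proof -
  have "(\<Sum>L\<in>adjacent P (u, v). \<omega> (gaps P (collapse P (L u) L))) =
    (\<Sum>L\<in>{L \<in> adjacent P (u, v). pos_gaps (gaps P (collapse P (L u) L))}. \<omega> (gaps P (collapse P (L u) L)))"
    by (intro sum.mono_neutral_right) (use s[unfolded supported_def] finite_adjacent[OF P] in blast)+
  also have "\<dots> = vol P {(u, v)} \<omega>"
    unfolding vol_def by (rule sum.reindex_bij_betw[OF bij_betw_collapse[OF P k]])
  finally show ?thesis .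
qed

text \<open>This is an interior wall of the triangulation: two unrelated neighbours may stand in
  either order, and closing the step between them forgets the order.\<close>

lemma swap_adjacent:
  assumes P: "valid P" and E: "u \<in> elems P" "v \<in> elems P" and uv: "(u, v) \<notin> rels P"
    and L: "L \<in> adjacent P (u, v)"
  shows "L(u := L v, v := L u) \<in> adjacent P (v, u)"
    and "collapse P (L u) (L(u := L v, v := L u)) = collapse P (L u) L"
proof -
  have L0: "L \<in> layer P {}" and a: "L v = L u + 1" using L by (auto simp: adjacent_def)
  have ne: "u \<noteq> v" using a by auto
  let ?L = "L(u := L v, v := L u)"
  have lt: "?L p < ?L q" if pq: "(p, q) \<in> rels P" for p q
  proof -
    have 1: "L p < L q" using layer_empty_less[OF P L0 pq] .
    have 2: "L e \<noteq> L u" if "e \<in> elems P" "e \<noteq> u" for e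
      using layer_empty_inj[OF P L0] that E by (metis inj_onD)
    have 3: "L e \<noteq> L v" if "e \<in> elems P" "e \<noteq> v" for e
      using layer_empty_inj[OF P L0] that E by (metis inj_onD)
    show ?thesis using 1 a pq uv ne 2[of p] 2[of q] 3[of p] 3[of q] valid_rels[OF P pq]
      by (auto split: if_splits)
  qed
  have "?L \<in> layer P {}"
  proof (rule layerI)
    have "?L ` elems P = L ` elems P"
    proof (intro equalityI subsetI)
      fix j assume "j \<in> L ` elems P"
      then obtain e where e: "e \<in> elems P" "j = L e" by auto
      show "j \<in> ?L ` elems P"
      proof (cases "e = u \<or> e = v")
        case True
        then show ?thesis using e E ne by (intro image_eqI[where x = "if e = u then v else u"]) auto
      next
        case False
        then show ?thesis using e by (intro image_eqI[where x = e]) auto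
      qed
    qed (use E in auto)
    then show "?L ` elems P = {0..<int (card (elems P)) - int (card {})}" using layer_image[OF L0] by simp
    show "pos_gaps (gaps P ?L)" by (rule inj_pos_gaps[OF P lt])
  qed (use lt E layer_ext[OF L0] in \<open>auto simp: extensional_def less_imp_le\<close>)
  then show "?L \<in> adjacent P (v, u)" using a ne by (simp add: adjacent_def)
  show "collapse P (L u) ?L = collapse P (L u) L"
    unfolding collapse_def using a ne by (auto simp: fun_eq_iff restrict_def)
qed

lemma sum_adjacent_swap:
  assumes P: "valid P" and E: "u \<in> elems P" "v \<in> elems P" and uv: "(u, v) \<notin> rels P" "(v, u) \<notin> rels P"
  shows "(\<Sum>L\<in>adjacent P (v, u). \<omega> (gaps P (collapse P (L v) L))) =
    (\<Sum>L\<in>adjacent P (u, v). \<omega> (gaps P (collapse P (L u) L)))"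
proof (rule sum.reindex_bij_witness[where i = "\<lambda>L. L(u := L v, v := L u)" and j = "\<lambda>L. L(v := L u, u := L v)"])
  fix L assume L: "L \<in> adjacent P (v, u)"
  then have ne: "u \<noteq> v" by (auto simp: adjacent_def)
  show "(L(v := L u, u := L v))(u := (L(v := L u, u := L v)) v, v := (L(v := L u, u := L v)) u) = L"
    using ne by (auto simp: fun_eq_iff)
  show "L(v := L u, u := L v) \<in> adjacent P (u, v)" using swap_adjacent(1)[OF P E(2,1) uv(2) L] .
  show "\<omega> (gaps P (collapse P ((L(v := L u, u := L v)) u) (L(v := L u, u := L v)))) = \<omega> (gaps P (collapse P (L v) L))"
    using swap_adjacent(2)[OF P E(2,1) uv(2) L] ne by simp
next
  fix L assume L: "L \<in> adjacent P (u, v)"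
  then have ne: "u \<noteq> v" by (auto simp: adjacent_def)
  show "(L(u := L v, v := L u))(v := (L(u := L v, v := L u)) u, u := (L(u := L v, v := L u)) v) = L"
    using ne by (auto simp: fun_eq_iff)
  show "L(u := L v, v := L u) \<in> adjacent P (v, u)" using swap_adjacent(1)[OF P E uv(1) L] .
qed

text \<open>Closing a step lowers by one the gap containing it. The weight is therefore constant
  along each gap, and the increments of \<open>a\<close> telescope there to the gap of
  \<open>a\<close>. Steps below mark 1 and above mark 3 both lower the third gap.\<close>

lemma sum_steps:
  assumes P: "valid P" and L: "L \<in> layer P {}"
  shows "(\<Sum>k\<in>{k \<in> elems P \<times> elems P. L (snd k) = L (fst k) + 1}.
      df a k * \<omega> (gaps P (collapse P (L (fst k)) L))) = shift (gaps P a) \<omega> (gaps P L)"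
proof -
  let ?n = "int (card (elems P))"
  define inv where "inv = inv_into (elems P) L"
  define h where "h i = a (inv i)" for i
  have inj: "inj_on L (elems P)" using layer_empty_inj[OF P L] .
  have im: "L ` elems P = {0..<?n}" using layer_image[OF L] by simp
  have hL: "h (L e) = a e" if "e \<in> elems P" for e
    unfolding h_def inv_def using inv_into_f_f[OF inj that] by simp
  have inv: "inv i \<in> elems P" "L (inv i) = i" if "i \<in> {0..<?n}" for i
    using that im unfolding inv_def by (metis inv_into_into, metis f_inv_into_f)
  define w where "w i = \<omega> (gaps P (collapse P i L))" for i
  have rng: "0 \<le> L e" "L e < ?n" if "e \<in> elems P" for e using layer_empty_range[OF L that] by auto
  have "(\<Sum>k\<in>{k \<in> elems P \<times> elems P. L (snd k) = L (fst k) + 1}.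
      df a k * \<omega> (gaps P (collapse P (L (fst k)) L))) = (\<Sum>i\<in>{0..<?n - 1}. (h (i + 1) - h i) * w i)"
  proof (rule sum.reindex_bij_witness[where i = "\<lambda>i. (inv i, inv (i + 1))" and j = "\<lambda>k. L (fst k)"])
    fix k assume k: "k \<in> {k \<in> elems P \<times> elems P. L (snd k) = L (fst k) + 1}"
    then have kE: "fst k \<in> elems P" "snd k \<in> elems P" "L (snd k) = L (fst k) + 1" by auto
    have "inv (L (fst k)) = fst k" "inv (L (snd k)) = snd k"
      unfolding inv_def using inv_into_f_f[OF inj kE(1)] inv_into_f_f[OF inj kE(2)] by simp_all
    then show "(inv (L (fst k)), inv (L (fst k) + 1)) = k" using kE by (simp add: prod_eq_iff)
    show "L (fst k) \<in> {0..<?n - 1}" using rng(1)[OF kE(1)] rng(2)[OF kE(2)] kE(3) by auto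
    show "(h (L (fst k) + 1) - h (L (fst k))) * w (L (fst k)) = df a k * \<omega> (gaps P (collapse P (L (fst k)) L))"
      using hL[OF kE(1)] hL[OF kE(2)] kE(3) by (simp add: df_def w_def)
  next
    fix i assume "i \<in> {0..<?n - 1}"
    then have i: "i \<in> {0..<?n}" "i + 1 \<in> {0..<?n}" by auto
    show "L (fst (inv i, inv (i + 1))) = i" using inv(2)[OF i(1)] by simp
    show "(inv i, inv (i + 1)) \<in> {k \<in> elems P \<times> elems P. L (snd k) = L (fst k) + 1}"
      using inv[OF i(1)] inv[OF i(2)] by simp
  qed
  also have "\<dots> = shift (gaps P a) \<omega> (gaps P L)"
  proof -
    define c where "c i = L (mark P i)" for i
    have c0: "c 0 = 0" and c4: "c 4 = ?n - 1" using layer_bot[OF P L] layer_top[OF P L] by (auto simp: c_def)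
    have "pos_gaps (gaps P L) \<longleftrightarrow> L (mark P 1) < L (mark P 2) \<and> L (mark P 2) < L (mark P 3) \<and>
      (L (mark P 0) < L (mark P 1) \<or> L (mark P 3) < L (mark P 4))"
      using P layer_mono[OF L] by (rule pos_gaps_iff)
    then have c12: "c 1 < c 2" and c23: "c 2 < c 3" using layer_positive[OF L] by (auto simp: c_def)
    have c01: "0 \<le> c 1" and c34: "c 3 \<le> ?n - 1"
      using rng[OF valid_mark[OF P]] by (auto simp: c_def zle_diff1_eq)
    have hc: "h (c i) = a (mark P i)" for i using hL[OF valid_mark[OF P]] by (simp add: c_def)
    obtain s1 s2 s3 where g: "gaps P L = (s1, s2, s3)" by (metis prod_cases3)
    have s: "s1 = c 2 - c 1" "s2 = c 3 - c 2" "s3 = c 1 - c 0 + (c 4 - c 3)"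
      using g by (auto simp: gaps_def c_def)
    have col: "gaps P (collapse P i L) = (let f = (\<lambda>j. if c j \<le> i then c j else c j - 1) in
        (f 2 - f 1, f 3 - f 2, f 1 - f 0 + (f 4 - f 3)))" for i
      using valid_mark[OF P] by (simp add: gaps_def collapse_def c_def Let_def)
    have w0: "w i = \<omega> (s1, s2, s3 - 1)" if "i \<in> {0..<c 1}" for i
    proof -
      have "gaps P (collapse P i L) = (s1, s2, s3 - 1)"
        using that c0 c4 c12 c23 c34 unfolding col Let_def s by auto
      then show ?thesis by (simp add: w_def)
    qed
    have w1: "w i = \<omega> (s1 - 1, s2, s3)" if "i \<in> {c 1..<c 2}" for i
    proof -
      have "gaps P (collapse P i L) = (s1 - 1, s2, s3)"
        using that c0 c4 c01 c12 c23 c34 unfolding col Let_def s by auto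
      then show ?thesis by (simp add: w_def)
    qed
    have w2: "w i = \<omega> (s1, s2 - 1, s3)" if "i \<in> {c 2..<c 3}" for i
    proof -
      have "gaps P (collapse P i L) = (s1, s2 - 1, s3)"
        using that c0 c4 c01 c12 c23 c34 unfolding col Let_def s by auto
      then show ?thesis by (simp add: w_def)
    qed
    have w3: "w i = \<omega> (s1, s2, s3 - 1)" if "i \<in> {c 3..<?n - 1}" for i
    proof -
      have "gaps P (collapse P i L) = (s1, s2, s3 - 1)"
        using that c0 c4 c01 c12 c23 c34 unfolding col Let_def s by auto
      then show ?thesis by (simp add: w_def)
    qed
    have spl: "sum f {m..<m''} = sum f {m..<m'} + sum f {m'..<m''}" if "m \<le> m'" "m' \<le> m''"
      for m m' m'' :: int and f :: "int \<Rightarrow> real"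
      using that by (subst sum.union_disjoint[symmetric]) (auto simp: ivl_disj_un_two(3))
    have tel: "(\<Sum>i\<in>{m..<m'}. (h (i + 1) - h i) * w i) = (h m' - h m) * q"
      if "m \<le> m'" "\<And>i. i \<in> {m..<m'} \<Longrightarrow> w i = q" for m m' q
    proof -
      have "(\<Sum>i\<in>{m..<m'}. (h (i + 1) - h i) * w i) = (\<Sum>i\<in>{m..<m'}. (h (i + 1) - h i) * q)"
        using that(2) by (intro sum.cong) auto
      also have "\<dots> = (h m' - h m) * q"
        using sum_telescope_int[OF that(1), of h] by (simp add: sum_distrib_right[symmetric])
      finally show ?thesis .
    qed
    have "(\<Sum>i\<in>{0..<?n - 1}. (h (i + 1) - h i) * w i) =
      (h (c 1) - h (c 0)) * \<omega> (s1, s2, s3 - 1) + ((h (c 2) - h (c 1)) * \<omega> (s1 - 1, s2, s3) +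
      ((h (c 3) - h (c 2)) * \<omega> (s1, s2 - 1, s3) + (h (c 4) - h (c 3)) * \<omega> (s1, s2, s3 - 1)))"
      using tel[OF c01 w0] tel[OF less_imp_le[OF c12] w1] tel[OF less_imp_le[OF c23] w2] tel[OF c34 w3]
        spl[of 0 "c 1" "?n - 1"] spl[of "c 1" "c 2" "?n - 1"] spl[of "c 2" "c 3" "?n - 1"]
        c0 c4 c01 c12 c23 c34 by simp
    also have "\<dots> = shift (gaps P a) \<omega> (gaps P L)"
    proof -
      have "shift (gaps P a) \<omega> (gaps P L) = shift (gaps P a) \<omega> (s1, s2, s3)" by (simp only: g)
      also have "\<dots> = (h (c 2) - h (c 1)) * \<omega> (s1 - 1, s2, s3) + (h (c 3) - h (c 2)) * \<omega> (s1, s2 - 1, s3)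
        + (h (c 1) - h (c 0) + (h (c 4) - h (c 3))) * \<omega> (s1, s2, s3 - 1)"
        unfolding shift_def hc by (simp add: gaps_def)
      finally show ?thesis by (simp add: distrib_right)
    qed
    finally show ?thesis .
  qed
  finally show ?thesis .
qed

text \<open>A translation field \<open>a\<close> sweeps out volume only through the gaps: over the pairs that are
  unrelated, adjacent positions can be swapped and the contributions cancel.\<close>

theorem vol_gauge:
  assumes P: "valid P" and s: "supported \<omega>"
  shows "(\<Sum>k\<in>rels P. df a k * vol P {k} \<omega>) = vol P {} (shift (gaps P a) \<omega>)"
proof -
  let ?E = "elems P \<times> elems P"
  define T where "T k = (\<Sum>L\<in>adjacent P k. \<omega> (gaps P (collapse P (L (fst k)) L)))" for k
  have fE: "finite ?E" using valid_finite[OF P] by simp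
  have sub: "rels P \<subseteq> ?E" using valid_rels[OF P] by auto
  have "vol P {} (shift (gaps P a) \<omega>) = (\<Sum>L\<in>layer P {}. \<Sum>k\<in>{k \<in> ?E. L (snd k) = L (fst k) + 1}.
      df a k * \<omega> (gaps P (collapse P (L (fst k)) L)))"
    unfolding vol_def using sum_steps[OF P] by (intro sum.cong) auto
  also have "\<dots> = (\<Sum>k\<in>?E. \<Sum>L\<in>{L \<in> layer P {}. L (snd k) = L (fst k) + 1}.
      df a k * \<omega> (gaps P (collapse P (L (fst k)) L)))"
    by (rule sum.swap_restrict[OF finite_layer[OF P] fE])
  also have "\<dots> = (\<Sum>k\<in>?E. df a k * T k)"
    unfolding T_def adjacent_def by (simp add: sum_distrib_left)
  also have "\<dots> = (\<Sum>k\<in>rels P. df a k * T k) + (\<Sum>k\<in>?E - rels P. df a k * T k)"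
    using sum.subset_diff[OF sub fE] by (simp add: add.commute)
  also have "(\<Sum>k\<in>?E - rels P. df a k * T k) = 0"
  proof -
    let ?N = "?E - rels P - prod.swap ` rels P"
    have "(\<Sum>k\<in>?E - rels P. df a k * T k) = (\<Sum>k\<in>?N. df a k * T k)"
    proof (rule sum.mono_neutral_right)
      show "\<forall>k\<in>?E - rels P - ?N. df a k * T k = 0"
      proof
        fix k assume "k \<in> ?E - rels P - ?N"
        then obtain u v where k: "k = (u, v)" "(v, u) \<in> rels P" by auto
        have "L \<notin> adjacent P k" for L
          using layer_empty_less[OF P _ k(2), of L] by (auto simp: adjacent_def k(1))
        then have "adjacent P k = {}" by blast
        then show "df a k * T k = 0" by (simp add: T_def)
      qed
    qed (use fE in auto)
    also have "\<dots> = 0"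
    proof -
      have "(\<Sum>k\<in>?N. df a k * T k) = (\<Sum>k\<in>?N. df a (prod.swap k) * T (prod.swap k))"
        by (rule sum.reindex_bij_witness[where i = prod.swap and j = prod.swap]) force+
      also have "\<dots> = (\<Sum>k\<in>?N. - (df a k * T k))"
      proof (rule sum.cong[OF refl])
        fix k assume k: "k \<in> ?N"
        obtain u v where kd: "k = (u, v)" by fastforce
        have "u \<in> elems P" "v \<in> elems P" "(u, v) \<notin> rels P" "(v, u) \<notin> rels P" using k kd by force+
        then have "T (prod.swap k) = T k" unfolding T_def kd using sum_adjacent_swap[OF P, of u v] by simp
        then show "df a (prod.swap k) * T (prod.swap k) = - (df a k * T k)"
          by (simp add: df_def algebra_simps)
      qed
      finally show ?thesis by (simp add: sum_negf)
    qed
    finally show ?thesis .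
  qed
  also have "(\<Sum>k\<in>rels P. df a k * T k) = (\<Sum>k\<in>rels P. df a k * vol P {k} \<omega>)"
  proof (rule sum.cong[OF refl])
    fix k assume "k \<in> rels P"
    then show "df a k * T k = df a k * vol P {k} \<omega>"
      using sum_adjacent_rel[OF P s, of "fst k" "snd k"] by (simp add: T_def)
  qed
  finally show ?thesis by simp
qed

subsection \<open>Facets and their restrictions\<close>

text \<open>Acyclicity in the form in which it is used: cycles among finitely many named relations
  are refuted by comparing values of \<open>r\<close>.\<close>

lemma valid_rank:
  fixes P :: "'b marked"
  assumes P: "valid P"
  shows "\<exists>r :: 'b \<Rightarrow> int. \<forall>p q. (p, q) \<in> rels P \<longrightarrow> r p < r q"
proof -
  obtain L where L: "L \<in> layer P {}" using valid_nonempty[OF P] by auto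
  show ?thesis by (rule exI[of _ L]) (simp add: layer_empty_less[OF P L])
qed

lemma fibre_eq:
  assumes P: "valid P" and L: "L \<in> layer P B" and T: "T \<subseteq> elems P" "\<And>e. e \<in> T \<Longrightarrow> L e = j"
    and c: "card T = card B + 1"
  shows "{e \<in> elems P. L e = j} = T"
proof -
  have fin: "finite {e \<in> elems P. L e = j}" using valid_finite[OF P] by simp
  have "card {e \<in> elems P. L e = j} \<le> card T"
    unfolding c by (rule card_fibre_le[OF P L, where j = j]) auto
  moreover have "T \<subseteq> {e \<in> elems P. L e = j}" using T by auto
  ultimately show ?thesis using fin card_seteq by metis
qed

text \<open>Deleting \<open>D\<close> loses no value, and the number of values is known. Unlike the
  bound for one fibre, this controls several fibres at once.\<close>

lemma card_redundant_le:
  assumes P: "valid P" and L: "L \<in> layer P B" and D: "D \<subseteq> elems P"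
    and r: "\<And>d. d \<in> D \<Longrightarrow> \<exists>e\<in>elems P - D. L e = L d"
  shows "card D \<le> card B"
proof -
  have fin: "finite (elems P)" using valid_finite[OF P] .
  have "L ` elems P \<subseteq> L ` (elems P - D)"
  proof
    fix i assume "i \<in> L ` elems P"
    then obtain e where e: "e \<in> elems P" "i = L e" by auto
    show "i \<in> L ` (elems P - D)"
    proof (cases "e \<in> D")
      case True
      then obtain e' where "e' \<in> elems P - D" "L e' = L e" using r by blast
      then show ?thesis using e by (metis imageI)
    qed (use e in blast)
  qed
  then have "card (L ` elems P) \<le> card (L ` (elems P - D))" using fin by (intro card_mono) auto
  also have "\<dots> \<le> card (elems P - D)" using card_image_le[of "elems P - D" L] fin by simp
  also have "card (elems P - D) = card (elems P) - card D"
    using D fin by (simp add: card_Diff_subset finite_subset)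
  finally have 1: "card (L ` elems P) \<le> card (elems P) - card D" .
  have "card (L ` elems P) = nat (int (card (elems P)) - int (card B))"
    unfolding layer_image[OF L] by simp
  moreover have "L ` elems P \<noteq> {}" using valid_mark[OF P] by auto
  then have "int (card B) < int (card (elems P))" unfolding layer_image[OF L] by auto
  moreover have "card D \<le> card (elems P)" using D fin card_mono by blast
  ultimately show ?thesis using 1 by simp
qed

text \<open>Only the number of pairs and the equalities they force on monotone maps matter.
  Different sets of relations may force the same equalities, which is how four facets come to share
  a codimension-three face.\<close>

lemma layer_cong:
  assumes "card B = card B'"
    and "\<And>L :: 'b \<Rightarrow> int. (\<And>p q. (p, q) \<in> rels P \<Longrightarrow> L p \<le> L q) \<Longrightarrow>
      (\<forall>(p, q)\<in>B. L p = L q) \<longleftrightarrow> (\<forall>(p, q)\<in>B'. L p = L q)"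
  shows "layer P B = layer P B'"
proof -
  have "L \<in> layer P B \<longleftrightarrow> L \<in> layer P B'" for L
  proof (cases "\<forall>(p, q)\<in>rels P. L p \<le> L q")
    case True
    then have "(\<forall>(p, q)\<in>B. L p = L q) \<longleftrightarrow> (\<forall>(p, q)\<in>B'. L p = L q)" by (intro assms(2)) auto
    then show ?thesis unfolding layer_def using assms(1) by simp
  next
    case False
    then show ?thesis unfolding layer_def by blast
  qed
  then show ?thesis by blast
qed

text \<open>Passing to a larger face undoes one identification: if no relation puts an element of
  \<open>C2\<close> below one of \<open>C1\<close>, then \<open>C2\<close> and everything above the
  level can be raised by one.\<close>

lemma split_layer:
  assumes P: "valid P" and L: "L \<in> layer P B'" and c: "card B' = Suc (card B)"
    and C: "C1 \<union> C2 = {e \<in> elems P. L e = j}" "C1 \<inter> C2 = {}" "C1 \<noteq> {}" "C2 \<noteq> {}"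
    and no: "\<And>p q. p \<in> C2 \<Longrightarrow> q \<in> C1 \<Longrightarrow> (p, q) \<notin> rels P"
    and B: "\<And>p q. (p, q) \<in> B \<Longrightarrow> p \<in> elems P \<and> q \<in> elems P \<and> L p = L q \<and> (p \<in> C1 \<longleftrightarrow> q \<in> C1)"
  shows "layer P B \<noteq> {}"
proof -
  define L' where "L' = restrict (\<lambda>e. if L e < j \<or> e \<in> C1 then L e else L e + 1) (elems P)"
  have L'e: "L' e = (if L e < j \<or> e \<in> C1 then L e else L e + 1)" if "e \<in> elems P" for e
    using that by (simp add: L'_def)
  have C1: "e \<in> elems P \<and> L e = j" if "e \<in> C1" for e using C that by blast
  have C2: "e \<in> elems P \<and> L e = j \<and> e \<notin> C1" if "e \<in> C2" for e using C that by blast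
  have j: "e \<in> C1 \<or> e \<in> C2" if "e \<in> elems P" "L e = j" for e using C that by blast
  let ?m = "int (card (elems P)) - int (card B')"
  have im: "L ` elems P = {0..<?m}" using layer_image[OF L] .
  have rng: "0 \<le> L e" "L e < ?m" if "e \<in> elems P" for e using im that by auto
  obtain e1 e2 where e12: "e1 \<in> C1" "e2 \<in> C2" using C by blast
  have mono: "L' p \<le> L' q" if pq: "(p, q) \<in> rels P" for p q
  proof -
    have E: "p \<in> elems P" "q \<in> elems P" using valid_rels[OF P pq] by auto
    have 1: "L p \<le> L q" using layer_mono[OF L pq] .
    show ?thesis
    proof (cases "L p = j \<and> L q = j")
      case True
      then have "p \<in> C1 \<or> q \<in> C2" using j E no pq by blast
      then show ?thesis using True C1 C2 E by (auto simp: L'e)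
    qed (use 1 E C1 in \<open>auto simp: L'e\<close>)
  qed
  have "L' \<in> layer P B"
  proof (rule layerI)
    show "L' ` elems P = {0..<int (card (elems P)) - int (card B)}"
    proof (intro equalityI subsetI)
      fix i assume "i \<in> L' ` elems P"
      then obtain e where e: "e \<in> elems P" "i = L' e" by auto
      then show "i \<in> {0..<int (card (elems P)) - int (card B)}" using rng[OF e(1)] c by (auto simp: L'e)
    next
      fix i assume i: "i \<in> {0..<int (card (elems P)) - int (card B)}"
      have jr: "0 \<le> j" "j < ?m" using rng[of e1] C1[OF e12(1)] by auto
      consider "i < j" | "i = j" | "i = j + 1" | "j + 1 < i" by linarith
      then show "i \<in> L' ` elems P"
      proof cases
        case 1
        then have "i \<in> L ` elems P" unfolding im using i jr by auto
        then obtain e where "e \<in> elems P" "L e = i" by auto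
        then show ?thesis using 1 by (intro image_eqI[where x = e]) (auto simp: L'e)
      next
        case 2
        then show ?thesis using C1[OF e12(1)] e12 by (intro image_eqI[where x = e1]) (auto simp: L'e)
      next
        case 3
        then show ?thesis using C2[OF e12(2)] by (intro image_eqI[where x = e2]) (auto simp: L'e)
      next
        case 4
        then have "i - 1 \<in> L ` elems P" unfolding im using i jr c by auto
        then obtain e where "e \<in> elems P" "L e = i - 1" by auto
        then show ?thesis using 4 C1[of e] by (intro image_eqI[where x = e]) (auto simp: L'e)
      qed
    qed
    show "L' p = L' q" if "(p, q) \<in> B" for p q using B[OF that] by (auto simp: L'e)
    show "pos_gaps (gaps P L')"
    proof (rule pos_gaps_transfer[OF P layer_positive[OF L] layer_mono[OF L] mono])
      show "L' (mark P i) < L' (mark P i')" if "L (mark P i) < L (mark P i')" for i i'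
        using that valid_mark[OF P] C1 by (auto simp: L'e)
    qed
  qed (use mono in \<open>auto simp: L'_def\<close>)
  then show ?thesis by blast
qed

lemma facets_rels: "k \<in> facets P \<Longrightarrow> k \<in> rels P"
  by (simp add: facets_def)

lemma finite_facets: "valid P \<Longrightarrow> finite (facets P)"
  unfolding facets_def by (simp add: valid_finite_rels)

text \<open>Contracting a relation swallows whatever lies between its ends, while the fibre has only
  two elements.\<close>

lemma facet_no_between:
  assumes P: "valid P" and k: "(p, q) \<in> facets P" and t: "(p, t) \<in> rels P" "(t, q) \<in> rels P"
  shows False
proof -
  have kr: "(p, q) \<in> rels P" using k by (rule facets_rels)
  obtain C where C: "C \<in> layer P {(p, q)}" using k by (auto simp: facets_def)
  have "C p = C q" using layer_eq[OF C, of p q] by simp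
  then have "C t = C p" using layer_mono[OF C t(1)] layer_mono[OF C t(2)] by simp
  then show False using fibre_pair[OF P kr C, of t] valid_rels[OF P t(1)] valid_rels[OF P t(2)] by auto
qed

abbreviation glue2 :: "'b \<times> 'b \<Rightarrow> 'b \<times> 'b \<Rightarrow> 'b \<times> 'b" where
  "glue2 k \<equiv> map_prod (glue k) (glue k)"

text \<open>These relations name the facets of the facet \<open>k\<close>, each by the second facet
  that passes through it.\<close>

definition meeting :: "'b marked \<Rightarrow> 'b \<times> 'b \<Rightarrow> ('b \<times> 'b) set" where
  "meeting P k = {m \<in> facets P. m \<noteq> k \<and> layer P {k, m} \<noteq> {}}"

lemma glue_eq_iff: "glue k a = glue k b \<longleftrightarrow> a = b \<or> {a, b} \<subseteq> {fst k, snd k}"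
  by (auto simp: glue_def)

text \<open>Two facets with the same image would differ by exchanging the ends of \<open>k\<close>
  in one entry, and then the longer one has an end of \<open>k\<close> between its own ends.\<close>

lemma glue2_inj:
  fixes P :: "'b marked"
  assumes P: "valid P" and k: "k \<in> facets P"
  shows "inj_on (glue2 k) (facets P - {k})"
proof (rule inj_onI)
  fix m m' assume m: "m \<in> facets P - {k}" "m' \<in> facets P - {k}" and eq: "glue2 k m = glue2 k m'"
  obtain u v where kd: "k = (u, v)" by fastforce
  obtain p q where md: "m = (p, q)" by fastforce
  obtain p' q' where md': "m' = (p', q')" by fastforce
  obtain r :: "'b \<Rightarrow> int" where r: "\<And>p q. (p, q) \<in> rels P \<Longrightarrow> r p < r q"
    using valid_rank[OF P] by blast
  have R: "(u, v) \<in> rels P" "(p, q) \<in> rels P" "(p', q') \<in> rels P" using facets_rels k m kd md md' by auto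
  note rr = r[OF R(1)] r[OF R(2)] r[OF R(3)]
  have F: "(p, q) \<in> facets P" "(p', q') \<in> facets P" "(p, q) \<noteq> (u, v)" "(p', q') \<noteq> (u, v)"
    using m md md' kd by auto
  have e: "p = p' \<or> {p, p'} \<subseteq> {u, v}" "q = q' \<or> {q, q'} \<subseteq> {u, v}"
    using eq unfolding md md' by (simp_all add: glue_eq_iff kd)
  show "m = m'"
  proof (rule ccontr)
    assume ne: "m \<noteq> m'"
    have "False" if "p = p'"
    proof -
      have "(q = u \<and> q' = v) \<or> (q = v \<and> q' = u)" using e ne that md md' by auto
      then show False using facet_no_between[OF P F(1), of u] facet_no_between[OF P F(2), of u] R that by auto
    qed
    moreover have "False" if "q = q'"
    proof -
      have "(p = u \<and> p' = v) \<or> (p = v \<and> p' = u)" using e ne that md md' by auto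
      then show False using facet_no_between[OF P F(1), of v] facet_no_between[OF P F(2), of v] R that by auto
    qed
    ultimately have "{p, p'} \<subseteq> {u, v}" "{q, q'} \<subseteq> {u, v}" using e by auto
    then show False using F rr by auto
  qed
qed

lemma glue2_rels:
  fixes P :: "'b marked"
  assumes P: "valid P" and k: "k \<in> rels P" and m: "m \<in> rels P" "m \<noteq> k"
  shows "glue2 k m \<in> rels (contract P k)"
proof -
  obtain u v where kd: "k = (u, v)" by fastforce
  obtain p q where md: "m = (p, q)" by fastforce
  obtain r :: "'b \<Rightarrow> int" where r: "\<And>p q. (p, q) \<in> rels P \<Longrightarrow> r p < r q"
    using valid_rank[OF P] by blast
  have "r u < r v" "r p < r q" using r k m kd md by auto
  then have "glue k p \<noteq> glue k q" using m by (auto simp: glue_eq_iff kd md)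
  then show ?thesis using m by (auto simp: md)
qed

lemma vol_contract_single:
  assumes P: "valid P" and k: "k \<in> rels P" and m: "m \<in> rels P" "m \<noteq> k"
  shows "vol (contract P k) {glue2 k m} \<omega> = vol P {k, m} \<omega>"
  using vol_contract[OF P k, of "{m}" \<omega>] m valid_rels[OF P] by (cases m) auto

lemma layer_contract_single:
  assumes P: "valid P" and k: "k \<in> rels P" and m: "m \<in> rels P" "m \<noteq> k"
  shows "layer (contract P k) {glue2 k m} = {} \<longleftrightarrow> layer P {k, m} = {}"
  using layer_contract_empty_iff[OF P k, of "{m}"] m valid_rels[OF P] by (cases m) auto

lemma vol_contract_none:
  assumes P: "valid P" and k: "k \<in> rels P"
  shows "vol (contract P k) {} \<omega> = vol P {k} \<omega>"
  using vol_contract[OF P k, of "{}" \<omega>] by simp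

text \<open>The fibres over a codimension-two face can be split without separating \<open>p\<close>
  and \<open>q\<close>, except when \<open>(p, q)\<close> is the longer of two relations that become
  equal on contracting \<open>(u, v)\<close>: \<open>(u, q)\<close> with \<open>v\<close> below
  \<open>q\<close>, or \<open>(p, v)\<close> with \<open>p\<close> below \<open>u\<close>.\<close>

lemma layer2_split:
  fixes P :: "'b marked"
  assumes P: "valid P" and k: "(u, v) \<in> rels P" and m: "(p, q) \<in> rels P" "(p, q) \<noteq> (u, v)"
    and ne: "layer P {(u, v), (p, q)} \<noteq> {}"
  shows "p \<notin> {u, v} \<Longrightarrow> q \<notin> {u, v} \<Longrightarrow> (p, q) \<in> facets P"
    and "p = u \<Longrightarrow> (v, q) \<notin> rels P \<Longrightarrow> (p, q) \<in> facets P"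
    and "p = v \<Longrightarrow> (p, q) \<in> facets P"
    and "q = v \<Longrightarrow> (p, u) \<notin> rels P \<Longrightarrow> (p, q) \<in> facets P"
    and "q = u \<Longrightarrow> (p, q) \<in> facets P"
proof -
  obtain L where L: "L \<in> layer P {(u, v), (p, q)}" using ne by auto
  obtain r :: "'b \<Rightarrow> int" where r: "\<And>p q. (p, q) \<in> rels P \<Longrightarrow> r p < r q"
    using valid_rank[OF P] by blast
  note rr = r[OF k] r[OF m(1)]
  have uv: "u \<in> elems P" "v \<in> elems P" "u \<noteq> v" using valid_rels[OF P k] by auto
  have pq: "p \<in> elems P" "q \<in> elems P" "p \<noteq> q" using valid_rels[OF P m(1)] by auto
  have Luv: "L u = L v" and Lpq: "L p = L q" using layer_eq[OF L] by auto
  have cB: "card {(u, v), (p, q)} = 2" using m(2) by auto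
  have main: "(p, q) \<in> facets P" if "C1 \<union> C2 = {e \<in> elems P. L e = L u}" "C1 \<inter> C2 = {}" "C1 \<noteq> {}" "C2 \<noteq> {}"
    "\<And>p q. p \<in> C2 \<Longrightarrow> q \<in> C1 \<Longrightarrow> (p, q) \<notin> rels P" "p \<in> C1 \<longleftrightarrow> q \<in> C1" for C1 C2
    using split_layer[OF P L _ that(1-5), of "{(p, q)}"] that(6) cB pq m Lpq by (auto simp: facets_def)
  { assume d: "p \<notin> {u, v}" "q \<notin> {u, v}"
    have fib: "{e \<in> elems P. L e = L u} = {u, v}"
    proof -
      have "t = u \<or> t = v" if t: "t \<in> elems P" "L t = L u" for t
      proof (rule ccontr)
        assume nt: "\<not> (t = u \<or> t = v)"
        show False
        proof (cases "L p = L u")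
          case True
          have "card {v, p, q} \<le> card {(u, v), (p, q)}"
          proof (rule card_redundant_le[OF P L])
            show "\<exists>e\<in>elems P - {v, p, q}. L e = L t" if "t \<in> {v, p, q}" for t
              by (rule bexI[of _ u]) (use that d uv Luv Lpq True in auto)
          qed (use uv pq in auto)
          then show False using cB d uv pq by (auto simp: card_insert_if split: if_splits)
        next
          case False
          then have "t \<noteq> p" "t \<noteq> q" using t Lpq by auto
          then have "card {v, t, q} \<le> card {(u, v), (p, q)}"
            using d uv pq t nt Luv Lpq by (intro card_redundant_le[OF P L]) auto
          then show False using cB d uv pq nt \<open>t \<noteq> q\<close> by (auto simp: card_insert_if split: if_splits)
        qed
      qed
      then show ?thesis using uv Luv by auto
    qed
    show "(p, q) \<in> facets P"
      using d uv rr r[of v u] by (intro main[of "{u}" "{v}"]) (auto simp: fib) }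
  have fib: "{e \<in> elems P. L e = L u} = {u, v, t}" if "t \<in> {p, q}" "t \<notin> {u, v}" "L p = L u" for t
    using that uv pq Luv Lpq cB by (intro fibre_eq[OF P L]) auto
  { assume d: "p = u" "(v, q) \<notin> rels P"
    have n: "q \<notin> {u, v}" "L p = L u" using d rr m(2) pq Luv Lpq by auto
    have f: "{e \<in> elems P. L e = L u} = {u, v, q}" using fib[of q] n by simp
    have no: "(a, b) \<notin> rels P" if "a \<in> {v}" "b \<in> {u, q}" for a b
      using that d rr r[of a b] by auto
    show "(p, q) \<in> facets P"
      by (rule main[of "{u, q}" "{v}"]) (use f n d uv no in \<open>auto simp del: Collect_conj_eq\<close>) }
  { assume d: "p = v"
    have n: "q \<notin> {u, v}" "L p = L u" using d rr m(2) pq Luv Lpq by auto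
    have f: "{e \<in> elems P. L e = L u} = {u, v, q}" using fib[of q] n by simp
    have no: "(a, b) \<notin> rels P" if "a \<in> {v, q}" "b \<in> {u}" for a b
      using that d rr r[of a b] by auto
    show "(p, q) \<in> facets P"
      by (rule main[of "{u}" "{v, q}"]) (use f n d uv no in \<open>auto simp del: Collect_conj_eq\<close>) }
  { assume d: "q = v" "(p, u) \<notin> rels P"
    have n: "p \<notin> {u, v}" "L p = L u" using d rr m(2) pq Luv Lpq by auto
    have f: "{e \<in> elems P. L e = L u} = {u, v, p}" using fib[of p] n by simp
    have no: "(a, b) \<notin> rels P" if "a \<in> {p, v}" "b \<in> {u}" for a b
      using that d rr r[of a b] by auto
    show "(p, q) \<in> facets P"
      by (rule main[of "{u}" "{p, v}"]) (use f n d uv no in \<open>auto simp del: Collect_conj_eq\<close>) }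
  { assume d: "q = u"
    have n: "p \<notin> {u, v}" "L p = L u" using d rr m(2) pq Luv Lpq by auto
    have f: "{e \<in> elems P. L e = L u} = {u, v, p}" using fib[of p] n by simp
    have no: "(a, b) \<notin> rels P" if "a \<in> {v}" "b \<in> {p, u}" for a b
      using that d rr r[of a b] by auto
    show "(p, q) \<in> facets P"
      by (rule main[of "{p, u}" "{v}"]) (use f n d uv no in \<open>auto simp del: Collect_conj_eq\<close>) }
qed


text \<open>\<open>offset P k\<close> translates along a normal of the facet \<open>k\<close>; it exists when \<open>P\<close> is valid and \<open>k\<close> is a facet.\<close>

definition offset :: "'b marked \<Rightarrow> 'b \<times> 'b \<Rightarrow> 'b \<Rightarrow> real" where
  "offset P k = (SOME \<sigma>. df \<sigma> k = 1 \<and> gaps P \<sigma> = (0, 0, 0))"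

text \<open>An unmarked end can be moved alone. If both ends are marks, the positive gaps at a point
  of the facet leave only bottom with mark 1 or mark 3 with top, and then the three middle marks
  move rigidly.\<close>

lemma offset:
  assumes P: "valid P" and k: "k \<in> facets P"
  shows "df (offset P k) k = 1 \<and> gaps P (offset P k) = (0, 0, 0)"
proof -
  obtain u v where kd: "k = (u, v)" by fastforce
  have uv: "u \<in> elems P" "v \<in> elems P" "u \<noteq> v" using valid_rels[OF P, of u v] facets_rels[OF k] kd by auto
  obtain C where C: "C \<in> layer P {(u, v)}" using k kd by (auto simp: facets_def)
  have Cuv: "C u = C v" using layer_eq[OF C, of u v] by simp
  define c where "c = mark P"
  have "pos_gaps (gaps P C) \<longleftrightarrow> C (c 1) < C (c 2) \<and> C (c 2) < C (c 3) \<and>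
    (C (c 0) < C (c 1) \<or> C (c 3) < C (c 4))"
    unfolding c_def using P layer_mono[OF C] by (rule pos_gaps_iff)
  then have c: "C (c 1) < C (c 2)" "C (c 2) < C (c 3)" "C (c 0) < C (c 1) \<or> C (c 3) < C (c 4)"
    using layer_positive[OF C] by auto
  have c01: "C (c 0) \<le> C (c 1)" "C (c 3) \<le> C (c 4)"
    using layer_mono[OF C] valid_bot[OF P valid_mark[OF P, of 1]] valid_top[OF P valid_mark[OF P, of 3]]
    unfolding c_def by force+
  let ?M = "{c 0, c 1, c 2, c 3, c 4}"
  let ?R = "\<lambda>e. if e \<in> {c 1, c 2, c 3} then 1 else (0 :: real)"
  have g: "gaps P f = (f (c 2) - f (c 1), f (c 3) - f (c 2), f (c 1) - f (c 0) + (f (c 4) - f (c 3)))"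
    for f :: "'a \<Rightarrow> real" by (simp add: gaps_def c_def)
  have "\<exists>\<sigma>. df \<sigma> k = 1 \<and> gaps P \<sigma> = (0, 0, 0)"
  proof -
    consider "v \<notin> ?M" | "u \<notin> ?M" | "u \<in> ?M" "v \<in> ?M" by blast
    then show ?thesis
    proof cases
      case 1
      then show ?thesis
        by (intro exI[of _ "\<lambda>e. if e = v then 1 else 0"]) (use uv in \<open>auto simp: g df_def kd\<close>)
    next
      case 2
      then show ?thesis
        by (intro exI[of _ "\<lambda>e. if e = u then -1 else 0"]) (use uv in \<open>auto simp: g df_def kd\<close>)
    next
      case 3
      have kr: "(u, v) \<in> rels P" using facets_rels[OF k] kd by simp
      have nb: "v \<noteq> c 0" using valid_bot[OF P uv(1)] valid_asym[OF P kr] uv by (auto simp: c_def)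
      have nt: "u \<noteq> c 4" using valid_top[OF P uv(2)] valid_asym[OF P kr] uv by (auto simp: c_def)
      have "u = c 0 \<and> v = c 1 \<or> u = c 3 \<and> v = c 4"
        using 3 nb nt uv(3) Cuv c c01 by auto
      then show ?thesis
      proof
        assume "u = c 0 \<and> v = c 1"
        then show ?thesis
          by (intro exI[of _ ?R]) (use uv Cuv c c01 in \<open>auto simp: g df_def kd\<close>)
      next
        assume "u = c 3 \<and> v = c 4"
        then show ?thesis
          by (intro exI[of _ "\<lambda>e. - ?R e"]) (use uv Cuv c c01 in \<open>auto simp: g df_def kd\<close>)
      qed
    qed
  qed
  then show ?thesis unfolding offset_def by (rule someI_ex)
qed

text \<open>A relation of the contraction may come from several relations of \<open>P\<close>. Where
  \<open>layer2_split\<close> does not make the given preimage a facet, the shorter preimage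
  starting or ending at the other end of \<open>k\<close> is one.\<close>

lemma bij_betw_meeting:
  assumes P: "valid P" and k: "k \<in> facets P"
  shows "bij_betw (glue2 k) (meeting P k) (facets (contract P k))"
  unfolding bij_betw_def
proof
  have kr: "k \<in> rels P" using facets_rels[OF k] .
  obtain u v where kd: "k = (u, v)" by fastforce
  show "inj_on (glue2 k) (meeting P k)"
    by (rule inj_on_subset[OF glue2_inj[OF P k]]) (auto simp: meeting_def)
  show "glue2 k ` meeting P k = facets (contract P k)"
  proof (intro equalityI subsetI)
    fix m' assume "m' \<in> glue2 k ` meeting P k"
    then obtain m where mM: "m \<in> meeting P k" and mm: "m' = glue2 k m" by (rule imageE)
    have m: "m \<in> rels P" "m \<noteq> k" "layer P {k, m} \<noteq> {}"
      using mM unfolding meeting_def facets_def by blast+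
    show "m' \<in> facets (contract P k)"
      unfolding facets_def mm using glue2_rels[OF P kr m(1,2)] layer_contract_single[OF P kr m(1,2)] m(3)
      by blast
  next
    fix m' assume m': "m' \<in> facets (contract P k)"
    then have im: "m' \<in> glue2 k ` rels P" and "m' \<notin> Id" using facets_rels[OF m'] by simp_all
    obtain m where mm: "m' = glue2 k m" and mr: "m \<in> rels P" using im by (rule imageE)
    have "fst m' \<noteq> snd m'" using \<open>m' \<notin> Id\<close> by (metis IdI prod.collapse)
    obtain p q where md: "m = (p, q)" by fastforce
    have mk: "(p, q) \<noteq> (u, v)" using \<open>fst m' \<noteq> snd m'\<close> mm md by (auto simp: glue_def kd split: if_splits)
    have vu: "(p, q) \<noteq> (v, u)" using \<open>fst m' \<noteq> snd m'\<close> mm md by (auto simp: glue_def kd split: if_splits)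
    have kr': "(u, v) \<in> rels P" using kr kd by simp
    have pq: "(p, q) \<in> rels P" "p \<noteq> q" using mr md valid_rels[OF P] by auto
    have ne: "layer P {(u, v), (p, q)} \<noteq> {}"
      using layer_contract_single[OF P kr mr] mk m' mm md kd by (simp add: facets_def)
    have fin: "m' \<in> glue2 k ` meeting P k"
      if "(a, b) \<in> facets P" "layer P {(u, v), (a, b)} \<noteq> {}" "(a, b) \<noteq> (u, v)" "m' = glue2 k (a, b)" for a b
      using that by (auto simp: meeting_def kd intro!: image_eqI[where x = "(a, b)"])
    note sp = layer2_split[OF P kr' pq(1) mk ne]
    obtain L where L: "L \<in> layer P {(u, v), (p, q)}" using ne by auto
    have Luv: "L u = L v" "L p = L q" using layer_eq[OF L] by auto
    consider "p \<notin> {u, v}" "q \<notin> {u, v}" | "p = u" "(v, q) \<notin> rels P" | "p = u" "(v, q) \<in> rels P"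
      | "p = v" | "q = v" "(p, u) \<notin> rels P" | "q = v" "(p, u) \<in> rels P" | "q = u" by auto
    then show "m' \<in> glue2 k ` meeting P k"
    proof cases
      case 1 then show ?thesis using fin[OF sp(1) ne mk] mm md by simp
    next
      case 2 then show ?thesis using fin[OF sp(2) ne mk] mm md by simp
    next
      case 3
      have l: "(v, q) \<noteq> (u, v)" using pq 3 valid_rels[OF P kr'] by auto
      have "layer P {(u, v), (p, q)} = layer P {(u, v), (v, q)}"
        using 3 l mk by (intro layer_cong) (auto simp: card_insert_if)
      then have ne': "layer P {(u, v), (v, q)} \<noteq> {}" using ne by simp
      have "(v, q) \<in> facets P" using layer2_split(3)[OF P kr' 3(2) l ne'] by simp
      moreover have "m' = glue2 k (v, q)" using mm md 3 by (simp add: glue_def kd)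
      ultimately show ?thesis using fin ne' l by blast
    next
      case 4 then show ?thesis using fin[OF sp(3) ne mk] mm md by simp
    next
      case 5 then show ?thesis using fin[OF sp(4) ne mk] mm md by simp
    next
      case 6
      have l: "(p, u) \<noteq> (u, v)" using pq 6 valid_rels[OF P kr'] by auto
      have "layer P {(u, v), (p, q)} = layer P {(u, v), (p, u)}"
        using 6 l mk by (intro layer_cong) (auto simp: card_insert_if)
      then have ne': "layer P {(u, v), (p, u)} \<noteq> {}" using ne by simp
      have "(p, u) \<in> facets P" using layer2_split(5)[OF P kr' 6(2) l ne'] by simp
      moreover have "m' = glue2 k (p, u)" using mm md 6 by (simp add: glue_def kd)
      ultimately show ?thesis using fin ne' l by blast
    next
      case 7 then show ?thesis using fin[OF sp(5) ne mk] mm md by simp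
    qed
  qed
qed

subsection \<open>The mixed form on facets\<close>

text \<open>The diagonal is forced by the requirement that translations with zero gaps are null vectors.\<close>

definition form :: "'b marked \<Rightarrow> (int \<times> int \<times> int \<Rightarrow> real) \<Rightarrow> 'b \<times> 'b \<Rightarrow> 'b \<times> 'b \<Rightarrow> real" where
  "form P \<omega> k l = (if k = l then - (\<Sum>m\<in>facets P - {k}. vol P {k, m} \<omega> * df (offset P k) m)
     else vol P {k, l} \<omega>)"

definition frow :: "'b marked \<Rightarrow> (int \<times> int \<times> int \<Rightarrow> real) \<Rightarrow> ('b \<times> 'b \<Rightarrow> real) \<Rightarrow> 'b \<times> 'b \<Rightarrow> real" where
  "frow P \<omega> w k = (\<Sum>l\<in>facets P. form P \<omega> k l * w l)"

definition bilin :: "'b marked \<Rightarrow> (int \<times> int \<times> int \<Rightarrow> real) \<Rightarrow> ('b \<times> 'b \<Rightarrow> real) \<Rightarrow> ('b \<times> 'b \<Rightarrow> real) \<Rightarrow> real" where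
  "bilin P \<omega> w w' = (\<Sum>k\<in>facets P. w k * frow P \<omega> w' k)"

text \<open>These are the support numbers that \<open>w\<close> induces on the facet
  \<open>k\<close>: a multiple of the normal translation is subtracted so that \<open>k\<close>
  itself stays in place.\<close>

definition restr :: "'b marked \<Rightarrow> 'b \<times> 'b \<Rightarrow> ('b \<times> 'b \<Rightarrow> real) \<Rightarrow> 'b \<times> 'b \<Rightarrow> real" where
  "restr P k w m' = (let m = inv_into (meeting P k) (glue2 k) m' in w m - w k * df (offset P k) m)"

lemma form_sym: "form P \<omega> k l = form P \<omega> l k"
  by (simp add: form_def insert_commute)

lemma bilin_sym: "bilin P \<omega> w w' = bilin P \<omega> w' w"
  unfolding bilin_def frow_def sum_distrib_left
  by (subst sum.swap) (simp add: form_sym mult.left_commute mult.commute)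

lemma frow_cong: "(\<And>l. l \<in> facets P \<Longrightarrow> w l = w' l) \<Longrightarrow> frow P \<omega> w k = frow P \<omega> w' k"
  unfolding frow_def by (intro sum.cong) auto

lemma frow_add: "frow P \<omega> (\<lambda>l. w l + w' l) k = frow P \<omega> w k + frow P \<omega> w' k"
  by (simp add: frow_def distrib_left sum.distrib)

lemma frow_scale: "frow P \<omega> (\<lambda>l. c * w l) k = c * frow P \<omega> w k"
  by (simp add: frow_def sum_distrib_left mult.left_commute)

lemma restr_glue2:
  assumes P: "valid P" and k: "k \<in> facets P" and m: "m \<in> meeting P k"
  shows "restr P k w (glue2 k m) = w m - w k * df (offset P k) m"
  using inv_into_f_f[OF bij_betw_imp_inj_on[OF bij_betw_meeting[OF P k]] m] by (simp add: restr_def Let_def)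

lemma sum_facets_contract:
  assumes P: "valid P" and k: "k \<in> facets P"
  shows "(\<Sum>m'\<in>facets (contract P k). f m') = (\<Sum>m\<in>meeting P k. f (glue2 k m))"
  by (rule sum.reindex_bij_betw[OF bij_betw_meeting[OF P k], symmetric])

lemma vol_empty: "layer P B = {} \<Longrightarrow> vol P B \<omega> = 0"
  by (simp add: vol_def)

lemma sum_meeting:
  assumes P: "valid P"
  shows "(\<Sum>m\<in>facets P - {k}. vol P {k, m} \<omega> * f m) = (\<Sum>m\<in>meeting P k. vol P {k, m} \<omega> * f m)"
  by (rule sum.mono_neutral_right) (use finite_facets[OF P] vol_empty in \<open>auto simp: meeting_def\<close>)

text \<open>The diagonal is made for this: a row sees \<open>w\<close> only through its restriction
  to the facet, so it is the first variation of the volume of \<open>k\<close>.\<close>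

lemma frow_eq:
  assumes P: "valid P" and k: "k \<in> facets P"
  shows "frow P \<omega> w k = (\<Sum>m\<in>meeting P k. vol P {k, m} \<omega> * (w m - w k * df (offset P k) m))"
proof -
  have "frow P \<omega> w k = form P \<omega> k k * w k + (\<Sum>l\<in>facets P - {k}. form P \<omega> k l * w l)"
    unfolding frow_def using finite_facets[OF P] k by (simp add: sum.remove)
  also have "(\<Sum>l\<in>facets P - {k}. form P \<omega> k l * w l) = (\<Sum>l\<in>facets P - {k}. vol P {k, l} \<omega> * w l)"
    by (intro sum.cong) (auto simp: form_def)
  also have "form P \<omega> k k = - (\<Sum>m\<in>meeting P k. vol P {k, m} \<omega> * df (offset P k) m)"
    unfolding form_def using sum_meeting[OF P, of k \<omega> "df (offset P k)"] by simp
  finally show ?thesis unfolding sum_meeting[OF P]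
    by (simp add: right_diff_distrib sum_subtractf sum_distrib_left mult_ac)
qed

lemma frow_restr:
  assumes P: "valid P" and k: "k \<in> facets P"
  shows "frow P \<omega> w k = (\<Sum>m'\<in>facets (contract P k). restr P k w m' * vol (contract P k) {m'} \<omega>)"
proof -
  have "restr P k w (glue2 k m) * vol (contract P k) {glue2 k m} \<omega> =
      vol P {k, m} \<omega> * (w m - w k * df (offset P k) m)" if m: "m \<in> meeting P k" for m
  proof -
    have "m \<in> rels P" "m \<noteq> k" using m facets_rels[of m P] by (simp_all add: meeting_def)
    then show ?thesis
      using restr_glue2[OF P k m] vol_contract_single[OF P facets_rels[OF k], of m \<omega>] by simp
  qed
  then show ?thesis unfolding frow_eq[OF P k] sum_facets_contract[OF P k] by simp
qed

text \<open>Subtracting a multiple of the offset makes the field constant on the glued pair, so it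
  descends to the contraction; the offset has zero gaps, so the gaps survive.\<close>

lemma restr_df:
  assumes P: "valid P" and k: "k \<in> facets P"
  obtains b where "gaps (contract P k) b = gaps P a"
    and "\<And>m'. m' \<in> facets (contract P k) \<Longrightarrow> restr P k (df a) m' = df b m'"
proof
  let ?b = "\<lambda>e. a e - df a k * offset P k e"
  have o: "df (offset P k) k = 1" "gaps P (offset P k) = (0, 0, 0)" using offset[OF P k] by auto
  have "?b (fst k) = ?b (snd k)" using o by (auto simp: df_def algebra_simps)
  then have bg: "?b (glue k e) = ?b e" for e by (auto simp: glue_def)
  have "gaps (contract P k) ?b = gaps P ?b" unfolding gaps_glue[symmetric] by (simp only: bg)
  also have "\<dots> = gaps P a" using o by (auto simp: gaps_def algebra_simps)
  finally show "gaps (contract P k) ?b = gaps P a" .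
  fix m' assume "m' \<in> facets (contract P k)"
  then have "m' \<in> glue2 k ` meeting P k"
    unfolding bij_betw_imp_surj_on[OF bij_betw_meeting[OF P k]] .
  then obtain m where m: "m' = glue2 k m" "m \<in> meeting P k" by (rule imageE)
  have "df ?b (glue2 k m) = df ?b m" using bg[of "fst m"] bg[of "snd m"] by (simp add: df_def)
  moreover have "df a m - df a k * df (offset P k) m = df ?b m" by (simp add: df_def algebra_simps)
  ultimately show "restr P k (df a) m' = df ?b m'"
    unfolding m(1) restr_glue2[OF P k m(2)] by simp
qed

lemma vol_gauge_facets:
  assumes P: "valid P" and s: "supported \<omega>"
  shows "(\<Sum>k\<in>facets P. df a k * vol P {k} \<omega>) = vol P {} (shift (gaps P a) \<omega>)"
  unfolding vol_gauge[OF P s, symmetric]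
  by (rule sum.mono_neutral_left) (use valid_finite_rels[OF P] vol_empty in \<open>auto simp: facets_def\<close>)

text \<open>This is the gauge formula on the contraction. In particular, fields with zero gaps are
  null vectors of the form.\<close>

lemma frow_df:
  assumes P: "valid P" and k: "k \<in> facets P" and s: "supported \<omega>"
  shows "frow P \<omega> (df a) k = vol P {k} (shift (gaps P a) \<omega>)"
proof -
  obtain b where b: "gaps (contract P k) b = gaps P a"
    "\<And>m'. m' \<in> facets (contract P k) \<Longrightarrow> restr P k (df a) m' = df b m'"
    using restr_df[OF P k] by metis
  have "frow P \<omega> (df a) k = (\<Sum>m'\<in>facets (contract P k). df b m' * vol (contract P k) {m'} \<omega>)"
    unfolding frow_restr[OF P k] using b(2) by simp
  also have "\<dots> = vol P {k} (shift (gaps P a) \<omega>)"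
    unfolding vol_gauge_facets[OF valid_contract[OF P k] s] b(1)
    by (rule vol_contract_none[OF P facets_rels[OF k]])
  finally show ?thesis .
qed

lemma bilin_df:
  assumes P: "valid P" and s: "supported \<omega>"
  shows "bilin P \<omega> (df a) (df b) = vol P {} (shift (gaps P a) (shift (gaps P b) \<omega>))"
proof -
  have "bilin P \<omega> (df a) (df b) = (\<Sum>k\<in>facets P. df a k * vol P {k} (shift (gaps P b) \<omega>))"
    unfolding bilin_def using frow_df[OF P _ s] by simp
  then show ?thesis using vol_gauge_facets[OF P supported_shift[OF s]] by simp
qed

text \<open>The link between consecutive dimensions: pairing with a field on the facet
  \<open>k\<close> gives a row of the form of \<open>P\<close>, for the weight with one more
  direction.\<close>

lemma bilin_restr_df:
  assumes P: "valid P" and k: "k \<in> facets P" and s: "supported \<omega>"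
  shows "bilin (contract P k) \<omega> (restr P k w) (restr P k (df a)) = frow P (shift (gaps P a) \<omega>) w k"
proof -
  obtain b where b: "gaps (contract P k) b = gaps P a"
    "\<And>m'. m' \<in> facets (contract P k) \<Longrightarrow> restr P k (df a) m' = df b m'"
    using restr_df[OF P k] by metis
  have "frow (contract P k) \<omega> (restr P k (df a)) m' = vol (contract P k) {m'} (shift (gaps P a) \<omega>)"
    if "m' \<in> facets (contract P k)" for m'
    using frow_cong[of "contract P k" "restr P k (df a)" "df b" \<omega> m'] b
      frow_df[OF valid_contract[OF P k] that s, of b] by simp
  then show ?thesis unfolding bilin_def frow_restr[OF P k] by simp
qed

subsection \<open>Four-cycles of facets\<close>

text \<open>At this codimension-three face the polytope looks like a cone over a square with sides
  \<open>k, l, m, n\<close> in cyclic order. The equation between the \<open>df\<close> is the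
  linear dependence of the four facet normals, and any three of the facets cut out the same
  face.\<close>

definition opposite_pairs :: "'b marked \<Rightarrow> 'b \<times> 'b \<Rightarrow> 'b \<times> 'b \<Rightarrow> 'b \<times> 'b \<Rightarrow> 'b \<times> 'b \<Rightarrow> bool" where
  "opposite_pairs P k l m n \<longleftrightarrow> k \<in> facets P \<and> l \<in> facets P \<and> m \<in> facets P \<and> n \<in> facets P \<and>
     k \<noteq> l \<and> k \<noteq> m \<and> k \<noteq> n \<and> l \<noteq> m \<and> l \<noteq> n \<and> m \<noteq> n \<and>
     layer P {k, l} \<noteq> {} \<and> layer P {l, m} \<noteq> {} \<and> layer P {m, n} \<noteq> {} \<and> layer P {n, k} \<noteq> {} \<and>
     layer P {k, m} = {} \<and> layer P {l, n} = {} \<and>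
     (\<forall>a. df a k + df a m = df a l + df a n) \<and> layer P {k, l, m} \<noteq> {} \<and>
     layer P {k, l, n} = layer P {k, l, m} \<and> layer P {k, m, n} = layer P {k, l, m} \<and>
     layer P {l, m, n} = layer P {k, l, m}"

lemma opposite_pairs_sym:
  assumes "opposite_pairs P k l m n"
  shows "opposite_pairs P l k n m" "opposite_pairs P m l k n" "opposite_pairs P k n m l"
  using assms unfolding opposite_pairs_def by (auto simp: insert_commute add.commute)

text \<open>Four elements are tied at the codimension-three face; splitting them into two blocks
  that respect \<open>k\<close> and \<open>m\<close> reaches a face of codimension two.\<close>

lemma layer_drop_edge:
  assumes P: "valid P" and ne: "layer P (insert l {k, m}) \<noteq> {}" and c: "card (insert l {k, m}) = 3"
    and km: "k \<in> rels P" "m \<in> rels P"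
    and C: "C1 \<union> C2 = T" "C1 \<inter> C2 = {}" "C1 \<noteq> {}" "C2 \<noteq> {}"
    and T: "T \<subseteq> elems P" "card T = 4" "\<And>L e. L \<in> layer P (insert l {k, m}) \<Longrightarrow> e \<in> T \<Longrightarrow> L e = L t"
    and no: "\<And>p q. p \<in> C2 \<Longrightarrow> q \<in> C1 \<Longrightarrow> (p, q) \<notin> rels P"
    and B: "fst k \<in> C1 \<longleftrightarrow> snd k \<in> C1" "fst m \<in> C1 \<longleftrightarrow> snd m \<in> C1"
  shows "layer P {k, m} \<noteq> {}"
proof -
  obtain L where L: "L \<in> layer P (insert l {k, m})" using ne by auto
  have "{e \<in> elems P. L e = L t} = T"
    using T c L by (intro fibre_eq[OF P L]) auto
  then have CT: "C1 \<union> C2 = {e \<in> elems P. L e = L t}" using C(1) by simp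
  have "k \<noteq> m" using c by (auto simp: card_insert_if split: if_splits)
  show ?thesis
  proof (rule split_layer[OF P L _ CT C(2-4) no])
    show "card (insert l {k, m}) = Suc (card {k, m})" using c \<open>k \<noteq> m\<close> by simp
    fix p q assume pq: "(p, q) \<in> {k, m}"
    then have "(p, q) \<in> rels P" using km by auto
    then show "p \<in> elems P \<and> q \<in> elems P \<and> L p = L q \<and> (p \<in> C1 \<longleftrightarrow> q \<in> C1)"
      using valid_rels[OF P] layer_eq[OF L, of p q] pq B by auto
  qed
qed

text \<open>A layer with two pairs ties at most three elements on one level, so equations that force
  four to coincide leave nothing.\<close>

lemma layer_pair_empty:
  assumes P: "valid P" and T: "T \<subseteq> elems P" "card T = 4" and km: "k \<noteq> m"
    and e: "\<And>L e. L \<in> layer P {k, m} \<Longrightarrow> e \<in> T \<Longrightarrow> L e = L t"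
  shows "layer P {k, m} = {}"
proof (rule ccontr)
  assume "layer P {k, m} \<noteq> {}"
  then obtain L where L: "L \<in> layer P {k, m}" by auto
  have "card T \<le> card {k, m} + 1" using e[OF L] by (intro card_fibre_le[OF P L T(1), of "L t"]) auto
  then show False using T km by simp
qed

text \<open>Tying \<open>a, b\<close> and \<open>b, d\<close> squeezes \<open>c\<close> in as well,
  so these opposite sides do not meet in codimension two; both opposite pairs have \<open>df\<close>
  adding up to the height of \<open>d\<close> over \<open>a\<close>.\<close>

lemma diamond_opposite_pairs:
  fixes P :: "'b marked"
  assumes P: "valid P"
    and R: "(a, b) \<in> rels P" "(b, d) \<in> rels P" "(a, c) \<in> rels P" "(c, d) \<in> rels P"
    and bc: "b \<noteq> c" "(b, c) \<notin> rels P" "(c, b) \<notin> rels P"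
    and ne: "layer P {(a, b), (a, c), (b, d)} \<noteq> {}"
  shows "opposite_pairs P (a, b) (a, c) (b, d) (c, d)"
proof -
  obtain r :: "'b \<Rightarrow> int" where r: "\<And>p q. (p, q) \<in> rels P \<Longrightarrow> r p < r q"
    using valid_rank[OF P] by blast
  note rr = r[OF R(1)] r[OF R(2)] r[OF R(3)] r[OF R(4)]
  have di: "a \<noteq> b" "a \<noteq> c" "a \<noteq> d" "b \<noteq> d" "c \<noteq> d" using rr by auto
  have E: "{a, b, c, d} \<subseteq> elems P" using R valid_rels[OF P] by auto
  have c4: "card {a, b, c, d} = 4" using di bc by simp
  have no: "(d, b) \<notin> rels P" "(d, c) \<notin> rels P" "(d, a) \<notin> rels P" "(b, a) \<notin> rels P" "(c, a) \<notin> rels P"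
    using r[of d b] r[of d c] r[of d a] r[of b a] r[of c a] rr by auto
  have eqs: "layer P {(a, b), (a, c), (c, d)} = layer P {(a, b), (a, c), (b, d)}"
    "layer P {(a, b), (b, d), (c, d)} = layer P {(a, b), (a, c), (b, d)}"
    "layer P {(a, c), (b, d), (c, d)} = layer P {(a, b), (a, c), (b, d)}"
    using di bc by (auto intro!: layer_cong simp: card_insert_if)
  have const: "L e = L a" if L: "L \<in> layer P {(a, b), (a, c), (b, d)}" and e: "e \<in> {a, b, c, d}" for L e
    using layer_eq[OF L, of a b] layer_eq[OF L, of a c] layer_eq[OF L, of b d] e by auto
  have 1: "layer P {(a, b), (a, c)} \<noteq> {}"
  proof (rule layer_drop_edge[OF P, where l = "(b, d)" and T = "{a, b, c, d}" and ?C1.0 = "{a, b, c}" and ?C2.0 = "{d}" and t = a])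
    have "insert (b, d) {(a, b), (a, c)} = {(a, b), (a, c), (b, d)}" by auto
    then show "layer P (insert (b, d) {(a, b), (a, c)}) \<noteq> {}"
      "\<And>L e. L \<in> layer P (insert (b, d) {(a, b), (a, c)}) \<Longrightarrow> e \<in> {a, b, c, d} \<Longrightarrow> L e = L a"
      using ne const by auto
  qed (use R di bc E c4 no in auto)
  have 2: "layer P {(a, c), (b, d)} \<noteq> {}"
  proof (rule layer_drop_edge[OF P, where l = "(c, d)" and T = "{a, b, c, d}" and ?C1.0 = "{a, c}" and ?C2.0 = "{b, d}" and t = a])
    have "insert (c, d) {(a, c), (b, d)} = {(a, c), (b, d), (c, d)}" by auto
    then show "layer P (insert (c, d) {(a, c), (b, d)}) \<noteq> {}"
      "\<And>L e. L \<in> layer P (insert (c, d) {(a, c), (b, d)}) \<Longrightarrow> e \<in> {a, b, c, d} \<Longrightarrow> L e = L a"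
      using ne const eqs by auto
  qed (use R di bc E c4 no in auto)
  have 3: "layer P {(b, d), (c, d)} \<noteq> {}"
  proof (rule layer_drop_edge[OF P, where l = "(a, b)" and T = "{a, b, c, d}" and ?C1.0 = "{a}" and ?C2.0 = "{b, c, d}" and t = a])
    show "layer P (insert (a, b) {(b, d), (c, d)}) \<noteq> {}"
      "\<And>L e. L \<in> layer P (insert (a, b) {(b, d), (c, d)}) \<Longrightarrow> e \<in> {a, b, c, d} \<Longrightarrow> L e = L a"
      using ne const eqs by auto
  qed (use R di bc E c4 no in auto)
  have 4: "layer P {(c, d), (a, b)} \<noteq> {}"
  proof (rule layer_drop_edge[OF P, where l = "(b, d)" and T = "{a, b, c, d}" and ?C1.0 = "{a, b}" and ?C2.0 = "{c, d}" and t = a])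
    have "insert (b, d) {(c, d), (a, b)} = {(a, b), (b, d), (c, d)}" by auto
    then show "layer P (insert (b, d) {(c, d), (a, b)}) \<noteq> {}"
      "\<And>L e. L \<in> layer P (insert (b, d) {(c, d), (a, b)}) \<Longrightarrow> e \<in> {a, b, c, d} \<Longrightarrow> L e = L a"
      using ne const eqs by auto
  qed (use R di bc E c4 no in auto)
  have 5: "layer P {(a, b), (b, d)} = {}"
  proof (rule layer_pair_empty[OF P E c4, where t = a])
    show "L e = L a" if L: "L \<in> layer P {(a, b), (b, d)}" and e: "e \<in> {a, b, c, d}" for L e
      using layer_eq[OF L, of a b] layer_eq[OF L, of b d] layer_mono[OF L R(3)] layer_mono[OF L R(4)] e by auto
  qed (use di in auto)
  have 6: "layer P {(a, c), (c, d)} = {}"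
  proof (rule layer_pair_empty[OF P E c4, where t = a])
    show "L e = L a" if L: "L \<in> layer P {(a, c), (c, d)}" and e: "e \<in> {a, b, c, d}" for L e
      using layer_eq[OF L, of a c] layer_eq[OF L, of c d] layer_mono[OF L R(1)] layer_mono[OF L R(2)] e by auto
  qed (use di in auto)
  have n1: "layer P {(a, c), (a, b)} \<noteq> {}" and n3: "layer P {(c, d), (b, d)} \<noteq> {}"
    using 1 3 by (simp_all add: insert_commute)
  have "(a, b) \<in> facets P" using layer2_split(2)[OF P R(3,1) _ n1] bc by auto
  moreover have "(a, c) \<in> facets P" using layer2_split(2)[OF P R(1,3) _ 1] bc by auto
  moreover have "(b, d) \<in> facets P" using layer2_split(4)[OF P R(4,2) _ n3] bc by auto
  moreover have "(c, d) \<in> facets P" using layer2_split(4)[OF P R(2,4) _ 3] bc by auto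
  ultimately show ?thesis
    unfolding opposite_pairs_def using 1 2 3 4 5 6 ne eqs di bc by (simp add: df_def)
qed

text \<open>Tying \<open>a, c\<close> and \<open>b, d\<close> gives
  \<open>b \<le> c = a \<le> d = b\<close>, so opposite sides tie all four elements.\<close>

lemma bowtie_opposite_pairs:
  fixes P :: "'b marked"
  assumes P: "valid P"
    and R: "(a, c) \<in> rels P" "(a, d) \<in> rels P" "(b, c) \<in> rels P" "(b, d) \<in> rels P"
    and ab: "a \<noteq> b" "(a, b) \<notin> rels P" "(b, a) \<notin> rels P"
    and cd: "c \<noteq> d" "(c, d) \<notin> rels P" "(d, c) \<notin> rels P"
    and ne: "layer P {(a, c), (a, d), (b, d)} \<noteq> {}"
  shows "opposite_pairs P (a, c) (a, d) (b, d) (b, c)"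
proof -
  obtain r :: "'b \<Rightarrow> int" where r: "\<And>p q. (p, q) \<in> rels P \<Longrightarrow> r p < r q"
    using valid_rank[OF P] by blast
  note rr = r[OF R(1)] r[OF R(2)] r[OF R(3)] r[OF R(4)]
  have di: "a \<noteq> c" "a \<noteq> d" "b \<noteq> c" "b \<noteq> d" using rr by auto
  have E: "{a, b, c, d} \<subseteq> elems P" using R valid_rels[OF P] by auto
  have c4: "card {a, b, c, d} = 4" using di ab cd by simp
  have no: "(c, a) \<notin> rels P" "(d, a) \<notin> rels P" "(c, b) \<notin> rels P" "(d, b) \<notin> rels P"
    using r[of c a] r[of d a] r[of c b] r[of d b] rr by auto
  have eqs: "layer P {(a, c), (a, d), (b, c)} = layer P {(a, c), (a, d), (b, d)}"
    "layer P {(a, c), (b, d), (b, c)} = layer P {(a, c), (a, d), (b, d)}"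
    "layer P {(a, d), (b, d), (b, c)} = layer P {(a, c), (a, d), (b, d)}"
    using di ab cd by (auto intro!: layer_cong simp: card_insert_if)
  have const: "L e = L a" if L: "L \<in> layer P {(a, c), (a, d), (b, d)}" and e: "e \<in> {a, b, c, d}" for L e
    using layer_eq[OF L, of a c] layer_eq[OF L, of a d] layer_eq[OF L, of b d] e by auto
  have 1: "layer P {(a, c), (a, d)} \<noteq> {}"
  proof (rule layer_drop_edge[OF P, where l = "(b, d)" and T = "{a, b, c, d}" and ?C1.0 = "{b}" and ?C2.0 = "{a, c, d}" and t = a])
    have "insert (b, d) {(a, c), (a, d)} = {(a, c), (a, d), (b, d)}" by auto
    then show "layer P (insert (b, d) {(a, c), (a, d)}) \<noteq> {}"
      "\<And>L e. L \<in> layer P (insert (b, d) {(a, c), (a, d)}) \<Longrightarrow> e \<in> {a, b, c, d} \<Longrightarrow> L e = L a"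
      using ne const by auto
  qed (use R di ab cd E c4 no in auto)
  have 2: "layer P {(a, d), (b, d)} \<noteq> {}"
  proof (rule layer_drop_edge[OF P, where l = "(a, c)" and T = "{a, b, c, d}" and ?C1.0 = "{a, b, d}" and ?C2.0 = "{c}" and t = a])
    show "layer P (insert (a, c) {(a, d), (b, d)}) \<noteq> {}"
      "\<And>L e. L \<in> layer P (insert (a, c) {(a, d), (b, d)}) \<Longrightarrow> e \<in> {a, b, c, d} \<Longrightarrow> L e = L a"
      using ne const by auto
  qed (use R di ab cd E c4 no in auto)
  have 3: "layer P {(b, d), (b, c)} \<noteq> {}"
  proof (rule layer_drop_edge[OF P, where l = "(a, d)" and T = "{a, b, c, d}" and ?C1.0 = "{a}" and ?C2.0 = "{b, c, d}" and t = a])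
    show "layer P (insert (a, d) {(b, d), (b, c)}) \<noteq> {}"
      "\<And>L e. L \<in> layer P (insert (a, d) {(b, d), (b, c)}) \<Longrightarrow> e \<in> {a, b, c, d} \<Longrightarrow> L e = L a"
      using ne const eqs by auto
  qed (use R di ab cd E c4 no in auto)
  have 4: "layer P {(b, c), (a, c)} \<noteq> {}"
  proof (rule layer_drop_edge[OF P, where l = "(b, d)" and T = "{a, b, c, d}" and ?C1.0 = "{a, b, c}" and ?C2.0 = "{d}" and t = a])
    have "insert (b, d) {(b, c), (a, c)} = {(a, c), (b, d), (b, c)}" by auto
    then show "layer P (insert (b, d) {(b, c), (a, c)}) \<noteq> {}"
      "\<And>L e. L \<in> layer P (insert (b, d) {(b, c), (a, c)}) \<Longrightarrow> e \<in> {a, b, c, d} \<Longrightarrow> L e = L a"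
      using ne const eqs by auto
  qed (use R di ab cd E c4 no in auto)
  have 5: "layer P {(a, c), (b, d)} = {}"
  proof (rule layer_pair_empty[OF P E c4, where t = a])
    show "L e = L a" if L: "L \<in> layer P {(a, c), (b, d)}" and e: "e \<in> {a, b, c, d}" for L e
      using layer_eq[OF L, of a c] layer_eq[OF L, of b d] layer_mono[OF L R(2)] layer_mono[OF L R(3)] e by auto
  qed (use ab in auto)
  have 6: "layer P {(a, d), (b, c)} = {}"
  proof (rule layer_pair_empty[OF P E c4, where t = a])
    show "L e = L a" if L: "L \<in> layer P {(a, d), (b, c)}" and e: "e \<in> {a, b, c, d}" for L e
      using layer_eq[OF L, of a d] layer_eq[OF L, of b c] layer_mono[OF L R(1)] layer_mono[OF L R(4)] e by auto
  qed (use ab in auto)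
  have n1: "layer P {(a, d), (a, c)} \<noteq> {}" and n3: "layer P {(b, c), (b, d)} \<noteq> {}"
    using 1 3 by (simp_all add: insert_commute)
  have "(a, c) \<in> facets P" using layer2_split(2)[OF P R(2,1) _ n1] cd by auto
  moreover have "(a, d) \<in> facets P" using layer2_split(2)[OF P R(1,2) _ 1] cd by auto
  moreover have "(b, d) \<in> facets P" using layer2_split(2)[OF P R(3,4) _ n3] cd by auto
  moreover have "(b, c) \<in> facets P" using layer2_split(2)[OF P R(4,3) _ 3] cd by auto
  ultimately show ?thesis
    unfolding opposite_pairs_def using 1 2 3 4 5 6 ne eqs di ab cd by (simp add: df_def)
qed

text \<open>As with a single element in between; two elements need their own argument because
  \<open>p\<close> and \<open>t\<close> may be unrelated in \<open>rels\<close>.\<close>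

lemma facet_no_chain:
  assumes P: "valid P" and k: "(p, q) \<in> facets P" and t: "(p, s) \<in> rels P" "(s, t) \<in> rels P" "(t, q) \<in> rels P"
  shows False
proof -
  have kr: "(p, q) \<in> rels P" using k by (rule facets_rels)
  obtain C where C: "C \<in> layer P {(p, q)}" using k by (auto simp: facets_def)
  have "C p = C q" using layer_eq[OF C, of p q] by simp
  then have "C s = C p" "C t = C p"
    using layer_mono[OF C t(1)] layer_mono[OF C t(2)] layer_mono[OF C t(3)] by auto
  then have "s = p \<or> s = q" "t = p \<or> t = q"
    using fibre_pair[OF P kr C] valid_rels[OF P t(2)] by auto
  then show False using valid_rels[OF P t(1)] valid_rels[OF P t(2)] valid_rels[OF P t(3)] t valid_asym[OF P] by metis
qed

text \<open>In the contraction by \<open>k\<close>, the image of \<open>m\<close> is tied together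
  with that of \<open>l\<close> but bounds no facet. So the two images share an end, and a relation
  of the contraction joins their other ends. Each lifting of this relation to \<open>P\<close> that
  is compatible with the facets completes a diamond or a bowtie and supplies the fourth
  side.\<close>

lemma opposite_pairs_exists:
  fixes P :: "'b marked"
  assumes P: "valid P" and k: "k \<in> facets P" and l: "l \<in> facets P" and m: "m \<in> facets P"
    and ne: "k \<noteq> l" "k \<noteq> m" "l \<noteq> m"
    and e: "layer P {k, m} = {}" and klm: "layer P {k, l, m} \<noteq> {}"
  shows "\<exists>n. opposite_pairs P k l m n"
proof -
  obtain u v where kd: "k = (u, v)" by fastforce
  obtain p q where ld: "l = (p, q)" by fastforce
  obtain m1 m2 where md: "m = (m1, m2)" by fastforce
  obtain r :: "'b \<Rightarrow> int" where r: "\<And>p q. (p, q) \<in> rels P \<Longrightarrow> r p < r q"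
    using valid_rank[OF P] by blast
  have F: "(u, v) \<in> facets P" "(p, q) \<in> facets P" "(m1, m2) \<in> facets P" using k l m kd ld md by auto
  note R = F[THEN facets_rels]
  have kr: "k \<in> rels P" and lr: "l \<in> rels P" and mr: "m \<in> rels P" using k l m by (simp_all add: facets_rels)
  note rr = r[OF R(1)] r[OF R(2)] r[OF R(3)]
  have ne': "(u, v) \<noteq> (p, q)" "(u, v) \<noteq> (m1, m2)" "(p, q) \<noteq> (m1, m2)" using ne kd ld md by auto
  let ?Q = "contract P k"
  have Q: "valid ?Q" by (rule valid_contract[OF P k])
  have inj: "inj_on (glue2 k) {l, m}" by (rule inj_on_subset[OF glue2_inj[OF P k]]) (use l m ne in auto)
  have "layer ?Q (glue2 k ` {l, m}) \<noteq> {}"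
    using layer_contract_empty_iff[OF P kr, of "{l, m}"] inj klm ne lr mr valid_rels[OF P]
    by (auto simp: ld md)
  then have neQ: "layer ?Q {glue2 k l, glue2 k m} \<noteq> {}" by simp
  have nf: "glue2 k m \<notin> facets ?Q"
    using layer_contract_single[OF P kr mr] ne e by (auto simp: facets_def)
  have dQ: "glue2 k m \<noteq> glue2 k l" using inj ne by (auto dest: inj_onD)
  have rQ: "glue2 k l \<in> rels ?Q" "glue2 k m \<in> rels ?Q"
    using glue2_rels[OF P kr lr] glue2_rels[OF P kr mr] ne by auto
  have split: "(glue k m1 = glue k p \<and> (glue k q, glue k m2) \<in> rels ?Q) \<or>
        (glue k m2 = glue k q \<and> (glue k m1, glue k p) \<in> rels ?Q)"
  proof -
    have 1: "(glue k p, glue k q) \<in> rels ?Q" "(glue k m1, glue k m2) \<in> rels ?Q"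
      using rQ unfolding ld md map_prod_simp by blast+
    have 2: "(glue k m1, glue k m2) \<noteq> (glue k p, glue k q)" using dQ unfolding ld md map_prod_simp .
    have 3: "layer ?Q {(glue k p, glue k q), (glue k m1, glue k m2)} \<noteq> {}"
      using neQ unfolding ld md map_prod_simp .
    have 4: "(glue k m1, glue k m2) \<notin> facets ?Q" using nf unfolding md map_prod_simp .
    show ?thesis using layer2_split[OF Q 1(1) 1(2) 2 3] 4 by blast
  qed
  from split show ?thesis
  proof (elim disjE conjE)
    assume g: "glue k m1 = glue k p" and "(glue k q, glue k m2) \<in> rels ?Q"
    then have im: "(glue k q, glue k m2) \<in> glue2 k ` rels P" by simp
    obtain x where x: "(glue k q, glue k m2) = glue2 k x" "x \<in> rels P" using im by (rule imageE)
    obtain s t where xd: "x = (s, t)" by fastforce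
    have st: "(s, t) \<in> rels P" and gs: "glue k s = glue k q" "glue k t = glue k m2" using x xd by auto
    have g': "m1 = p \<or> {m1, p} = {u, v}" using g by (auto simp: glue_eq_iff kd)
    have s': "s = q \<or> {s, q} = {u, v}" using gs(1) by (auto simp: glue_eq_iff kd)
    have t': "t = m2 \<or> {t, m2} = {u, v}" using gs(2) by (auto simp: glue_eq_iff kd)
    note rs = r[OF st]
    \<comment> \<open>All other liftings would put an element, or a chain of two, between the ends
      of a facet, or contradict the rank.\<close>
    consider (1) "m1 = p" "s = u" "q = v" "t = m2" | (2) "m1 = p" "s = q" "t = v" "m2 = u"
      | (3) "p = u" "m1 = v" "s = q" "t = m2"
    proof -
      have False if "m1 = p" "s = q" "t = m2" using facet_no_between[OF P F(3), of q] that R st by auto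
      moreover have False if "m1 = p" "s = v" "q = u" "t = m2" using facet_no_chain[OF P F(3), of q v] that R st by auto
      moreover have False if "m1 = p" "s = q" "t = u" "m2 = v" using facet_no_chain[OF P F(3), of q u] that R st by auto
      moreover have False if "m1 = p" "q = u" "m2 = v" using facet_no_between[OF P F(3), of q] that R by auto
      moreover have False if "m1 = p" "q = v" "m2 = u" using facet_no_between[OF P F(2), of u] that R by auto
      moreover have False if "p = v" "m1 = u" "s = q" "t = m2" using facet_no_chain[OF P F(3), of v q] that R st by auto
      ultimately show ?thesis using that g' s' t' ne' rr rs by (auto simp: doubleton_eq_iff)
    qed
    then show ?thesis
    proof cases
      case 1
      have "opposite_pairs P (p, q) (p, m2) (u, m2) (u, q)"
      proof (rule bowtie_opposite_pairs[OF P])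
        have "layer P {(p, q), (p, m2), (u, m2)} = layer P {k, l, m}"
          unfolding kd ld md by (rule layer_cong) (use 1 ne' rr in \<open>auto simp: card_insert_if\<close>)
        then show "layer P {(p, q), (p, m2), (u, m2)} \<noteq> {}" using klm by simp
        show "p \<noteq> u" "q \<noteq> m2" using ne' 1 by auto
        show "(p, u) \<notin> rels P" using facet_no_between[OF P F(2), of u] R 1 by auto
        show "(u, p) \<notin> rels P" using facet_no_between[OF P F(1), of p] R 1 by auto
        show "(q, m2) \<notin> rels P" using facet_no_between[OF P F(3), of q] R 1 by auto
        show "(m2, q) \<notin> rels P" using facet_no_between[OF P F(2), of m2] R 1 by auto
      qed (use R st 1 in auto)
      then have "opposite_pairs P (u, q) (p, q) (p, m2) (u, m2)"
        by (rule opposite_pairs_sym(2)[OF opposite_pairs_sym(1)])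
      then show ?thesis using 1 kd ld md by blast
    next
      case 2
      have "opposite_pairs P (p, m2) (p, q) (m2, v) (q, v)"
      proof (rule diamond_opposite_pairs[OF P])
        show "layer P {(p, m2), (p, q), (m2, v)} \<noteq> {}"
          using klm 2 kd ld md by (simp add: insert_commute)
        show "m2 \<noteq> q" using ne' 2 by auto
        show "(m2, q) \<notin> rels P" using facet_no_between[OF P F(2), of m2] R 2 by auto
        show "(q, m2) \<notin> rels P" using facet_no_between[OF P F(3), of q] R 2 by auto
      qed (use R st 2 in auto)
      then show ?thesis using opposite_pairs_sym(2) 2 kd ld md by blast
    next
      case 3
      have "opposite_pairs P (u, v) (u, q) (v, m2) (q, m2)"
      proof (rule diamond_opposite_pairs[OF P])
        show "layer P {(u, v), (u, q), (v, m2)} \<noteq> {}" using klm 3 kd ld md by simp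
        show "v \<noteq> q" using ne' 3 by auto
        show "(v, q) \<notin> rels P" using facet_no_between[OF P F(2), of v] R 3 by auto
        show "(q, v) \<notin> rels P" using facet_no_between[OF P F(1), of q] R 3 by auto
      qed (use R st 3 in auto)
      then show ?thesis using 3 kd ld md by blast
    qed
  next
    assume g: "glue k m2 = glue k q" and "(glue k m1, glue k p) \<in> rels ?Q"
    then have im: "(glue k m1, glue k p) \<in> glue2 k ` rels P" by simp
    obtain x where x: "(glue k m1, glue k p) = glue2 k x" "x \<in> rels P" using im by (rule imageE)
    obtain s t where xd: "x = (s, t)" by fastforce
    have st: "(s, t) \<in> rels P" and gs: "glue k s = glue k m1" "glue k t = glue k p" using x xd by auto
    have g': "m2 = q \<or> {m2, q} = {u, v}" using g by (auto simp: glue_eq_iff kd)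
    have s': "s = m1 \<or> {s, m1} = {u, v}" using gs(1) by (auto simp: glue_eq_iff kd)
    have t': "t = p \<or> {t, p} = {u, v}" using gs(2) by (auto simp: glue_eq_iff kd)
    note rs = r[OF st]
    consider (1) "m2 = q" "s = u" "m1 = v" "t = p" | (2) "m2 = q" "s = m1" "t = v" "p = u"
      | (3) "q = v" "m2 = u" "s = m1" "t = p"
    proof -
      have False if "m2 = q" "s = m1" "t = p" using facet_no_between[OF P F(3), of p] that R st by auto
      moreover have False if "m2 = q" "s = v" "m1 = u" "t = p" using facet_no_chain[OF P F(3), of v p] that R st by auto
      moreover have False if "m2 = q" "s = m1" "t = u" "p = v" using facet_no_chain[OF P F(3), of u p] that R st by auto
      moreover have False if "m2 = q" "m1 = u" "p = v" using facet_no_between[OF P F(3), of p] that R by auto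
      moreover have False if "m2 = q" "m1 = v" "p = u" using facet_no_between[OF P F(2), of v] that R by auto
      moreover have False if "q = u" "m2 = v" "s = m1" "t = p" using facet_no_chain[OF P F(3), of p u] that R st by auto
      ultimately show ?thesis using that g' s' t' ne' rr rs by (auto simp: doubleton_eq_iff)
    qed
    then show ?thesis
    proof cases
      case 1
      have "opposite_pairs P (u, v) (u, p) (v, q) (p, q)"
      proof (rule diamond_opposite_pairs[OF P])
        have "layer P {(u, v), (u, p), (v, q)} = layer P {k, l, m}"
          unfolding kd ld md by (rule layer_cong) (use 1 ne' rr in \<open>auto simp: card_insert_if\<close>)
        then show "layer P {(u, v), (u, p), (v, q)} \<noteq> {}" using klm by simp
        show "v \<noteq> p" using ne' 1 by auto
        show "(v, p) \<notin> rels P" using facet_no_between[OF P F(3), of p] R 1 by auto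
        show "(p, v) \<notin> rels P" using facet_no_between[OF P F(2), of v] R 1 by auto
      qed (use R st 1 in auto)
      then show ?thesis using opposite_pairs_sym(3) 1 kd ld md by blast
    next
      case 2
      have "opposite_pairs P (p, v) (p, q) (m1, q) (m1, v)"
      proof (rule bowtie_opposite_pairs[OF P])
        show "layer P {(p, v), (p, q), (m1, q)} \<noteq> {}" using klm 2 kd ld md by simp
        show "p \<noteq> m1" "v \<noteq> q" using ne' 2 by auto
        show "(p, m1) \<notin> rels P" using facet_no_between[OF P F(2), of m1] R 2 by auto
        show "(m1, p) \<notin> rels P" using facet_no_between[OF P F(3), of p] R 2 by auto
        show "(v, q) \<notin> rels P" using facet_no_between[OF P F(2), of v] R 2 by auto
        show "(q, v) \<notin> rels P" using facet_no_between[OF P F(1), of q] R 2 by auto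
      qed (use R st 2 in auto)
      then show ?thesis using 2 kd ld md by blast
    next
      case 3
      have "opposite_pairs P (m1, u) (m1, p) (u, v) (p, v)"
      proof (rule diamond_opposite_pairs[OF P])
        have "layer P {(m1, u), (m1, p), (u, v)} = layer P {k, l, m}"
          unfolding kd ld md by (rule layer_cong) (use 3 ne' rr in \<open>auto simp: card_insert_if\<close>)
        then show "layer P {(m1, u), (m1, p), (u, v)} \<noteq> {}" using klm by simp
        show "u \<noteq> p" using ne' 3 by auto
        show "(u, p) \<notin> rels P" using facet_no_between[OF P F(1), of p] R 3 by auto
        show "(p, u) \<notin> rels P" using facet_no_between[OF P F(3), of p] R st 3 by auto
      qed (use R st 3 in auto)
      then show ?thesis using opposite_pairs_sym 3 kd ld md by blast
    qed
  qed
qed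

text \<open>It makes the fourth side of a four-cycle unique, since the linear dependence determines
  the \<open>df\<close> of that side.\<close>

lemma df_inj:
  assumes "\<And>a. df a n = df a n'" and "fst n \<noteq> snd n"
  shows "n = n'"
proof -
  obtain p q where n: "n = (p, q)" by fastforce
  obtain p' q' where n': "n' = (p', q')" by fastforce
  have "df (\<lambda>e. if e = p then 1 else 0) n = df (\<lambda>e. if e = p then 1 else 0) n'"
    "df (\<lambda>e. if e = q then 1 else 0) n = df (\<lambda>e. if e = q then 1 else 0) n'"
    using assms(1) by blast+
  then show ?thesis using assms(2) by (auto simp: df_def n n' split: if_splits)
qed

text \<open>Distinct relations are not reverses of each other, so one of them has an end that the
  other lacks, and the value of the field there is free.\<close>

lemma vanishing_field:
  assumes P: "valid P" and k: "k \<in> rels P" and l: "l \<in> rels P" and ne: "k \<noteq> l"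
  shows "\<exists>b. df b k = w k \<and> df b l = w l"
proof -
  obtain u v where kd: "k = (u, v)" by fastforce
  obtain p q where ld: "l = (p, q)" by fastforce
  have d: "u \<noteq> v" "p \<noteq> q" using k l kd ld valid_rels[OF P] by auto
  have "(p, q) \<noteq> (v, u)" using valid_asym[OF P, of u v] k l kd ld by auto
  then consider "p \<notin> {u, v}" | "q \<notin> {u, v}" using ne d kd ld by auto
  then show ?thesis
  proof cases
    case 1
    define b where "b e = (if e = v then w k else 0)" for e
    show ?thesis
      by (rule exI[of _ "\<lambda>e. if e = p then b q - w l else b e"]) (use 1 d in \<open>auto simp: df_def kd ld b_def\<close>)
  next
    case 2
    define b where "b e = (if e = v then w k else 0)" for e
    show ?thesis
      by (rule exI[of _ "\<lambda>e. if e = q then b p + w l else b e"]) (use 2 d in \<open>auto simp: df_def kd ld b_def\<close>)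
  qed
qed

text \<open>Subtracting a field that agrees with \<open>w\<close> at \<open>k\<close> and
  \<open>l\<close> removes the diagonal entry of the row, which involves an offset of the
  contraction. The field itself contributes a mixed volume, and the rest only off-diagonal
  entries.\<close>

lemma frow_restr_meeting:
  assumes P: "valid P" and k: "k \<in> facets P" and s: "supported \<omega>" and l: "l \<in> meeting P k"
    and b: "df b k = w k" "df b l = w l"
  shows "frow (contract P k) \<omega> (restr P k w) (glue2 k l) = vol P {k, l} (shift (gaps P b) \<omega>) +
    (\<Sum>m\<in>meeting P k - {l}. vol P {k, l, m} \<omega> * (w m - df b m))"
proof -
  let ?Q = "contract P k"
  have Q: "valid ?Q" by (rule valid_contract[OF P k])
  have kr: "k \<in> rels P" using facets_rels[OF k] .
  have lr: "l \<in> rels P" "l \<noteq> k" using l facets_rels[of l P] by (auto simp: meeting_def)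
  have inj: "inj_on (glue2 k) (meeting P k)" using bij_betw_imp_inj_on[OF bij_betw_meeting[OF P k]] .
  have lQ: "glue2 k l \<in> facets ?Q" using bij_betw_imp_surj_on[OF bij_betw_meeting[OF P k]] l by blast
  obtain c where c: "gaps ?Q c = gaps P b"
    "\<And>m'. m' \<in> facets ?Q \<Longrightarrow> restr P k (df b) m' = df c m'"
    using restr_df[OF P k] by metis
  let ?y = "\<lambda>m. w m - df b m"
  have fin: "finite (meeting P k)" using finite_facets[OF P] by (simp add: meeting_def)
  have "frow ?Q \<omega> (restr P k w) (glue2 k l) = frow ?Q \<omega> (\<lambda>m'. restr P k (df b) m' + restr P k ?y m') (glue2 k l)"
    by (rule frow_cong) (simp add: restr_def Let_def algebra_simps)
  also have "\<dots> = frow ?Q \<omega> (restr P k (df b)) (glue2 k l) + frow ?Q \<omega> (restr P k ?y) (glue2 k l)"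
    by (rule frow_add)
  also have "frow ?Q \<omega> (restr P k (df b)) (glue2 k l) = frow ?Q \<omega> (df c) (glue2 k l)"
    by (rule frow_cong) (rule c(2))
  also have "\<dots> = vol P {k, l} (shift (gaps P b) \<omega>)"
    using frow_df[OF Q lQ s, of c] vol_contract_single[OF P kr lr] c(1) by simp
  also have "frow ?Q \<omega> (restr P k ?y) (glue2 k l) =
      (\<Sum>m\<in>meeting P k. form ?Q \<omega> (glue2 k l) (glue2 k m) * ?y m)"
    unfolding frow_def sum_facets_contract[OF P k]
    by (intro sum.cong refl) (simp add: restr_glue2[OF P k] b)
  also have "\<dots> = (\<Sum>m\<in>meeting P k - {l}. form ?Q \<omega> (glue2 k l) (glue2 k m) * ?y m)"
    using fin l b by (simp add: sum.remove)
  also have "\<dots> = (\<Sum>m\<in>meeting P k - {l}. vol P {k, l, m} \<omega> * ?y m)"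
  proof (rule sum.cong[OF refl])
    fix m assume m: "m \<in> meeting P k - {l}"
    have mr: "m \<in> rels P" "m \<noteq> k" using m facets_rels[of m P] by (auto simp: meeting_def)
    have "glue2 k l \<noteq> glue2 k m" using inj_onD[OF inj, of l m] l m by auto
    moreover have "vol ?Q (glue2 k ` {l, m}) \<omega> = vol P (insert k {l, m}) \<omega>"
    proof (rule vol_contract[OF P kr])
      show "inj_on (glue2 k) {l, m}" by (rule inj_on_subset[OF inj]) (use l m in auto)
      show "{l, m} \<subseteq> elems P \<times> elems P" using lr mr valid_rels[OF P] by (cases l, cases m) auto
    qed (use lr mr in auto)
    ultimately show "form ?Q \<omega> (glue2 k l) (glue2 k m) * ?y m = vol P {k, l, m} \<omega> * ?y m"
      by (simp add: form_def)
  qed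
  finally show ?thesis .
qed

lemma vol_nonneg: "\<forall>s. 0 \<le> \<omega> s \<Longrightarrow> 0 \<le> vol P B \<omega>"
  unfolding vol_def by (intro sum_nonneg) blast

text \<open>Symmetrising over the symmetries of the square replaces the defect
  \<open>w m - df (b k l) m\<close> by the defect of \<open>w\<close> in the linear dependence of
  the four facets. The antisymmetric factor in front becomes a nonnegative multiple of the same
  defect, so squares appear.\<close>

lemma sum_four_cycles:
  assumes P: "valid P" and pos: "\<forall>s. 0 \<le> \<omega> s" and v: "\<And>k. k \<in> facets P \<Longrightarrow> 0 \<le> df a k"
    and b: "\<And>k l. k \<in> facets P \<Longrightarrow> l \<in> facets P \<Longrightarrow> k \<noteq> l \<Longrightarrow> df (b k l) k = w k \<and> df (b k l) l = w l"
    and bs: "\<And>k l. b k l = b l k"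
  defines "Z \<equiv> {(k, l, m, n). opposite_pairs P k l m n}"
  shows "(\<Sum>(k, l, m, n)\<in>Z. (df a k * w l - w k * df a l) * (vol P {k, l, m} \<omega> * (w m - df (b k l) m))) \<le> 0"
proof -
  let ?v = "df a" and ?V = "\<lambda>k l m. vol P {k, l, m} \<omega>"
  let ?\<delta> = "\<lambda>k l m n. w l + w n - w k - w m"
  define S where "S = (\<Sum>(k, l, m, n)\<in>Z. (?v k * w l - w k * ?v l) * (?V k l m * (w m - df (b k l) m)))"
  define D1 where "D1 = (\<Sum>(k, l, m, n)\<in>Z. (?v k * w l - w k * ?v l) * ?V k l m * ?\<delta> k l m n)"
  define D2 where "D2 = (\<Sum>(k, l, m, n)\<in>Z. ((?v k + ?v m) * w l - (w k + w m) * ?v l) * ?V k l m * ?\<delta> k l m n)"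
  define D3 where "D3 = (\<Sum>(k, l, m, n)\<in>Z. ((?v k + ?v m) * (w l + w n) - (w k + w m) * (?v l + ?v n)) * ?V k l m * ?\<delta> k l m n)"
  have V1: "?V l k n = ?V k l m" "?V m l k = ?V k l m" "?V k n m = ?V k l m" if "(k, l, m, n) \<in> Z" for k l m n
    using that unfolding Z_def opposite_pairs_def vol_def by (auto simp: insert_commute)
  have re: "(\<Sum>(k, l, m, n)\<in>Z. f k l m n) = (\<Sum>(k, l, m, n)\<in>Z. f l k n m)"
    "(\<Sum>(k, l, m, n)\<in>Z. f k l m n) = (\<Sum>(k, l, m, n)\<in>Z. f m l k n)"
    "(\<Sum>(k, l, m, n)\<in>Z. f k l m n) = (\<Sum>(k, l, m, n)\<in>Z. f k n m l)"
    for f :: "'a \<times> 'a \<Rightarrow> 'a \<times> 'a \<Rightarrow> 'a \<times> 'a \<Rightarrow> 'a \<times> 'a \<Rightarrow> real"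
    subgoal
      by (rule sum.reindex_bij_witness[where i = "\<lambda>(k, l, m, n). (l, k, n, m)" and j = "\<lambda>(k, l, m, n). (l, k, n, m)"])
        (auto simp: Z_def intro: opposite_pairs_sym)
    subgoal
      by (rule sum.reindex_bij_witness[where i = "\<lambda>(k, l, m, n). (m, l, k, n)" and j = "\<lambda>(k, l, m, n). (m, l, k, n)"])
        (auto simp: Z_def intro: opposite_pairs_sym)
    subgoal
      by (rule sum.reindex_bij_witness[where i = "\<lambda>(k, l, m, n). (k, n, m, l)" and j = "\<lambda>(k, l, m, n). (k, n, m, l)"])
        (auto simp: Z_def intro: opposite_pairs_sym)
    done
  \<comment> \<open>Exchanging \<open>k\<close> with \<open>l\<close> and \<open>m\<close> with
    \<open>n\<close> flips the first factor and keeps the field, which satisfies the linear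
    dependence exactly and so drops out.\<close>
  have "S + S = - D1"
  proof -
    have "S + S = S + (\<Sum>(k, l, m, n)\<in>Z. (?v l * w k - w l * ?v k) * (?V l k n * (w n - df (b l k) n)))"
      unfolding S_def by (subst re(1)) simp
    also have "\<dots> = (\<Sum>(k, l, m, n)\<in>Z. - ((?v k * w l - w k * ?v l) * ?V k l m * ?\<delta> k l m n))"
      unfolding S_def sum.distrib[symmetric]
    proof (rule sum.cong[OF refl], clarify)
      fix k1 k2 l1 l2 m1 m2 n1 n2 assume z: "((k1, k2), (l1, l2), (m1, m2), (n1, n2)) \<in> Z"
      define k where "k = (k1, k2)"
      define l where "l = (l1, l2)"
      define m where "m = (m1, m2)"
      define n where "n = (n1, n2)"
      have z: "(k, l, m, n) \<in> Z" using z by (simp add: k_def l_def m_def n_def)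
      have zz: "k \<in> facets P" "l \<in> facets P" "k \<noteq> l" and "\<forall>a. df a k + df a m = df a l + df a n"
        using z unfolding Z_def opposite_pairs_def by simp_all
      then have 2: "df (b k l) k + df (b k l) m = df (b k l) l + df (b k l) n" by blast
      have 1: "df (b k l) k = w k" "df (b k l) l = w l" using b[OF zz] by auto
      have n: "df (b k l) n = w k + df (b k l) m - w l" using 1 2 by simp
      have "(?v k * w l - w k * ?v l) * (?V k l m * (w m - df (b k l) m)) +
          (?v l * w k - w l * ?v k) * (?V l k n * (w n - df (b l k) n)) =
          - ((?v k * w l - w k * ?v l) * ?V k l m * ?\<delta> k l m n)"
        unfolding V1[OF z] bs[of l k] n by (simp add: algebra_simps)
      then show "(?v (k1, k2) * w (l1, l2) - w (k1, k2) * ?v (l1, l2)) *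
          (?V (k1, k2) (l1, l2) (m1, m2) * (w (m1, m2) - df (b (k1, k2) (l1, l2)) (m1, m2))) +
          (?v (l1, l2) * w (k1, k2) - w (l1, l2) * ?v (k1, k2)) *
          (?V (l1, l2) (k1, k2) (n1, n2) * (w (n1, n2) - df (b (l1, l2) (k1, k2)) (n1, n2))) =
          - ((?v (k1, k2) * w (l1, l2) - w (k1, k2) * ?v (l1, l2)) * ?V (k1, k2) (l1, l2) (m1, m2) *
            ?\<delta> (k1, k2) (l1, l2) (m1, m2) (n1, n2))"
        by (simp only: k_def l_def m_def n_def)
    qed
    finally show ?thesis by (simp add: D1_def sum_negf split_def)
  qed
  moreover have "D1 + D1 = D2"
  proof -
    have "D1 + D1 = D1 + (\<Sum>(k, l, m, n)\<in>Z. (?v m * w l - w m * ?v l) * ?V m l k * ?\<delta> m l k n)"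
      unfolding D1_def by (subst re(2)) simp
    also have "\<dots> = D2"
      unfolding D1_def D2_def sum.distrib[symmetric]
    proof (rule sum.cong[OF refl])
      fix z assume z: "z \<in> Z"
      obtain k l m n where zd: "z = (k, l, m, n)" by (metis prod_cases4)
      show "(case z of (k, l, m, n) \<Rightarrow> (?v k * w l - w k * ?v l) * ?V k l m * ?\<delta> k l m n) +
          (case z of (k, l, m, n) \<Rightarrow> (?v m * w l - w m * ?v l) * ?V m l k * ?\<delta> m l k n) =
          (case z of (k, l, m, n) \<Rightarrow> ((?v k + ?v m) * w l - (w k + w m) * ?v l) * ?V k l m * ?\<delta> k l m n)"
        unfolding zd prod.case V1[OF z[unfolded zd]] by (simp add: algebra_simps)
    qed
    finally show ?thesis .
  qed
  moreover have "D2 + D2 = D3"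
  proof -
    have "D2 + D2 = D2 + (\<Sum>(k, l, m, n)\<in>Z. ((?v k + ?v m) * w n - (w k + w m) * ?v n) * ?V k n m * ?\<delta> k n m l)"
      unfolding D2_def by (subst re(3)) simp
    also have "\<dots> = D3"
      unfolding D2_def D3_def sum.distrib[symmetric]
    proof (rule sum.cong[OF refl])
      fix z assume z: "z \<in> Z"
      obtain k l m n where zd: "z = (k, l, m, n)" by (metis prod_cases4)
      show "(case z of (k, l, m, n) \<Rightarrow> ((?v k + ?v m) * w l - (w k + w m) * ?v l) * ?V k l m * ?\<delta> k l m n) +
          (case z of (k, l, m, n) \<Rightarrow> ((?v k + ?v m) * w n - (w k + w m) * ?v n) * ?V k n m * ?\<delta> k n m l) =
          (case z of (k, l, m, n) \<Rightarrow> ((?v k + ?v m) * (w l + w n) - (w k + w m) * (?v l + ?v n)) * ?V k l m * ?\<delta> k l m n)"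
        unfolding zd prod.case V1[OF z[unfolded zd]] by (simp add: algebra_simps)
    qed
    finally show ?thesis .
  qed
  moreover have "0 \<le> D3"
    unfolding D3_def
  proof (rule sum_nonneg)
    fix z assume z: "z \<in> Z"
    obtain k l m n where zd: "z = (k, l, m, n)" by (metis prod_cases4)
    have F: "k \<in> facets P" "m \<in> facets P" and c: "?v k + ?v m = ?v l + ?v n"
      using z unfolding zd Z_def opposite_pairs_def by auto
    have "((?v k + ?v m) * (w l + w n) - (w k + w m) * (?v l + ?v n)) * ?V k l m * ?\<delta> k l m n =
        (?v k + ?v m) * ?V k l m * (?\<delta> k l m n)\<^sup>2"
      unfolding c[symmetric] by (simp add: power2_eq_square algebra_simps)
    also have "\<dots> \<ge> 0" using F by (intro mult_nonneg_nonneg add_nonneg_nonneg v vol_nonneg pos zero_le_power2)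
    finally show "0 \<le> (case z of (k, l, m, n) \<Rightarrow>
        ((?v k + ?v m) * (w l + w n) - (w k + w m) * (?v l + ?v n)) * ?V k l m * ?\<delta> k l m n)"
      unfolding zd prod.case .
  qed
  ultimately show ?thesis unfolding S_def[symmetric] by linarith
qed

text \<open>The difference is a sum over ordered pairs of meeting facets of an antisymmetric factor
  \<open>W\<close> times a row entry \<open>R\<close>. A symmetric entry would cancel. The symmetric
  completion \<open>T\<close> of \<open>R\<close> adds the facets \<open>m\<close> that pass through
  a codimension-three face of \<open>k\<close> and \<open>l\<close> but do not meet \<open>k\<close>
  in codimension two, and these triples are exactly the beginnings of four-cycles.\<close>

theorem bilin_le_sum_facets:
  assumes P: "valid P" and s: "supported \<omega>" and pos: "\<forall>s. 0 \<le> \<omega> s"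
    and v: "\<And>k. k \<in> facets P \<Longrightarrow> 0 \<le> df a k"
  shows "bilin P (shift (gaps P a) \<omega>) w w \<le>
    (\<Sum>k\<in>facets P. df a k * bilin (contract P k) \<omega> (restr P k w) (restr P k w))"
proof -
  \<comment> \<open>Choosing the field from the set \<open>{k, l}\<close> makes it symmetric in
    \<open>k\<close> and \<open>l\<close>.\<close>
  define b where "b k l = (SOME c. \<forall>f\<in>{k, l}. df c f = w f)" for k l
  have b: "df (b k l) k = w k \<and> df (b k l) l = w l" if "k \<in> facets P" "l \<in> facets P" "k \<noteq> l" for k l
  proof -
    have "\<exists>c. \<forall>f\<in>{k, l}. df c f = w f"
      using vanishing_field[OF P facets_rels[OF that(1)] facets_rels[OF that(2)] that(3), of w] by auto
    then have "\<forall>f\<in>{k, l}. df (b k l) f = w f" unfolding b_def by (rule someI_ex)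
    then show ?thesis by simp
  qed
  have bs: "b k l = b l k" for k l by (simp add: b_def insert_commute)
  define R where "R k l = frow (contract P k) \<omega> (restr P k w) (glue2 k l)" for k l
  define t where "t k l m = vol P {k, l, m} \<omega> * (w m - df (b k l) m)" for k l m
  define T where "T k l = vol P {k, l} (shift (gaps P (b k l)) \<omega>) + (\<Sum>m\<in>facets P - {k, l}. t k l m)" for k l
  define M where "M k l = {m \<in> facets P - {k, l}. layer P {k, m} = {} \<and> layer P {k, l, m} \<noteq> {}}" for k l
  define W where "W k l = df a k * w l - w k * df a l" for k l
  define A where "A = Sigma (facets P) (meeting P)"
  define Z where "Z = {(k, l, m, n). opposite_pairs P k l m n}"
  have fin: "finite (facets P)" using finite_facets[OF P] .
  have finm: "finite (meeting P k)" for k using fin by (simp add: meeting_def)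
  have finM: "finite (M k l)" for k l using fin by (simp add: M_def)
  have AD: "k \<in> facets P" "l \<in> facets P" "k \<noteq> l" "layer P {k, l} \<noteq> {}" if "(k, l) \<in> A" for k l
    using that by (auto simp: A_def meeting_def)
  have swA: "(l, k) \<in> A" if "(k, l) \<in> A" for k l
    using that by (auto simp: A_def meeting_def insert_commute)
  have RT: "R k l = T k l - (\<Sum>m\<in>M k l. t k l m)" if kl: "(k, l) \<in> A" for k l
  proof -
    have km: "k \<in> facets P" "l \<in> meeting P k" using kl by (auto simp: A_def)
    have "(\<Sum>m\<in>facets P - {k, l}. t k l m) =
        (\<Sum>m\<in>(facets P - {k, l}) \<inter> meeting P k. t k l m) + (\<Sum>m\<in>(facets P - {k, l}) - meeting P k. t k l m)"
      using fin by (intro sum.Int_Diff) auto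
    also have "(facets P - {k, l}) \<inter> meeting P k = meeting P k - {l}" by (auto simp: meeting_def)
    also have "(\<Sum>m\<in>(facets P - {k, l}) - meeting P k. t k l m) = (\<Sum>m\<in>M k l. t k l m)"
      by (rule sum.mono_neutral_right) (use fin vol_empty in \<open>auto simp: M_def meeting_def t_def\<close>)
    finally show ?thesis
      unfolding R_def T_def using frow_restr_meeting[OF P km(1) s km(2)] b[OF AD(1-3)[OF kl]]
      by (simp add: t_def)
  qed
  have bilin_k: "bilin (contract P k) \<omega> (restr P k w) h = (\<Sum>l\<in>meeting P k. h (glue2 k l) * R k l)"
    if "k \<in> facets P" for k h
    unfolding bilin_sym[of _ _ _ h] unfolding bilin_def sum_facets_contract[OF P that] R_def ..
  have "(\<Sum>k\<in>facets P. df a k * bilin (contract P k) \<omega> (restr P k w) (restr P k w)) -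
      bilin P (shift (gaps P a) \<omega>) w w =
      (\<Sum>k\<in>facets P. df a k * bilin (contract P k) \<omega> (restr P k w) (restr P k w) -
        w k * bilin (contract P k) \<omega> (restr P k w) (restr P k (df a)))"
    unfolding bilin_def[of P] sum_subtractf[symmetric]
    by (intro sum.cong refl) (simp add: bilin_restr_df[OF P _ s])
  also have "\<dots> = (\<Sum>k\<in>facets P. \<Sum>l\<in>meeting P k. W k l * R k l)"
  proof (rule sum.cong[OF refl])
    fix k assume k: "k \<in> facets P"
    show "df a k * bilin (contract P k) \<omega> (restr P k w) (restr P k w) -
        w k * bilin (contract P k) \<omega> (restr P k w) (restr P k (df a)) = (\<Sum>l\<in>meeting P k. W k l * R k l)"
      unfolding bilin_k[OF k] sum_distrib_left sum_subtractf[symmetric]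
      by (intro sum.cong refl) (simp add: restr_glue2[OF P k] W_def algebra_simps)
  qed
  also have "\<dots> = (\<Sum>(k, l)\<in>A. W k l * R k l)"
    unfolding A_def by (rule sum.Sigma) (use fin finm in auto)
  also have "\<dots> = (\<Sum>(k, l)\<in>A. W k l * T k l) - (\<Sum>(k, l)\<in>A. W k l * (\<Sum>m\<in>M k l. t k l m))"
    unfolding sum_subtractf[symmetric] by (intro sum.cong refl) (auto simp: RT right_diff_distrib)
  also have "(\<Sum>(k, l)\<in>A. W k l * T k l) = 0"
  proof -
    have "(\<Sum>(k, l)\<in>A. W k l * T k l) = (\<Sum>(k, l)\<in>A. W l k * T l k)"
      by (rule sum.reindex_bij_witness[where i = prod.swap and j = prod.swap]) (auto intro: swA)
    also have "\<dots> = (\<Sum>(k, l)\<in>A. - (W k l * T k l))"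
    proof (intro sum.cong refl, clarify)
      fix k1 k2 l1 l2
      have "T (l1, l2) (k1, k2) = T (k1, k2) (l1, l2)"
        unfolding T_def t_def bs[of "(l1, l2)"] by (simp add: insert_commute)
      then show "W (l1, l2) (k1, k2) * T (l1, l2) (k1, k2) = - (W (k1, k2) (l1, l2) * T (k1, k2) (l1, l2))"
        by (simp add: W_def algebra_simps)
    qed
    finally show ?thesis by (simp add: sum_negf split_def)
  qed
  also have "(\<Sum>(k, l)\<in>A. W k l * (\<Sum>m\<in>M k l. t k l m)) = (\<Sum>x\<in>A. \<Sum>m\<in>M (fst x) (snd x). W (fst x) (snd x) * t (fst x) (snd x) m)"
    by (simp add: split_def sum_distrib_left)
  also have "\<dots> = (\<Sum>(x, m)\<in>(SIGMA x:A. M (fst x) (snd x)). W (fst x) (snd x) * t (fst x) (snd x) m)"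
    by (rule sum.Sigma) (use fin finm finM in \<open>auto simp: A_def\<close>)
  also have "\<dots> = (\<Sum>z\<in>Z. case (case z of (k, l, m, n) \<Rightarrow> ((k, l), m)) of
      (x, m) \<Rightarrow> W (fst x) (snd x) * t (fst x) (snd x) m)"
  proof (rule sum.reindex_bij_betw[symmetric], unfold bij_betw_def, intro conjI)
    show "inj_on (\<lambda>(k, l, m, n). ((k, l), m)) Z"
    proof (rule inj_onI)
      fix z z' assume z: "z \<in> Z" "z' \<in> Z" and eq: "(case z of (k, l, m, n) \<Rightarrow> ((k, l), m)) = (case z' of (k, l, m, n) \<Rightarrow> ((k, l), m))"
      obtain k l m n where zd: "z = (k, l, m, n)" by (metis prod_cases4)
      obtain n' where zd': "z' = (k, l, m, n')" using eq unfolding zd by (cases z') auto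
      have o: "opposite_pairs P k l m n" "opposite_pairs P k l m n'" using z unfolding zd zd' Z_def by auto
      have "df c n = df c n'" for c
      proof -
        have "df c k + df c m = df c l + df c n" "df c k + df c m = df c l + df c n'"
          using o unfolding opposite_pairs_def by blast+
        then show ?thesis by simp
      qed
      moreover have "fst n \<noteq> snd n"
        using o(1) facets_rels[of n P] valid_rels[OF P, of "fst n" "snd n"] unfolding opposite_pairs_def by auto
      ultimately have "n = n'" by (rule df_inj)
      then show "z = z'" by (simp add: zd zd')
    qed
    show "(\<lambda>(k, l, m, n). ((k, l), m)) ` Z = (SIGMA x:A. M (fst x) (snd x))"
    proof (intro equalityI subsetI)
      fix y assume "y \<in> (\<lambda>(k, l, m, n). ((k, l), m)) ` Z"
      then obtain z where yz: "y = (case z of (k, l, m, n) \<Rightarrow> ((k, l), m))" and zZ: "z \<in> Z" by (rule imageE)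
      obtain k l m n where zd: "z = (k, l, m, n)" by (metis prod_cases4)
      have o: "opposite_pairs P k l m n" using zZ unfolding zd Z_def by simp
      show "y \<in> (SIGMA x:A. M (fst x) (snd x))"
        using o unfolding yz zd opposite_pairs_def by (auto simp: A_def M_def meeting_def)
    next
      fix y assume y: "y \<in> (SIGMA x:A. M (fst x) (snd x))"
      obtain k l m where yd: "y = ((k, l), m)" by (metis surj_pair)
      have kl: "(k, l) \<in> A" and m: "m \<in> facets P" "k \<noteq> m" "l \<noteq> m" "layer P {k, m} = {}" "layer P {k, l, m} \<noteq> {}"
        using y unfolding yd M_def by auto
      obtain n where "opposite_pairs P k l m n"
        using opposite_pairs_exists[OF P AD(1,2)[OF kl] m(1) AD(3)[OF kl] m(2-5)] by blast
      then show "y \<in> (\<lambda>(k, l, m, n). ((k, l), m)) ` Z"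
        unfolding yd Z_def by (intro image_eqI[where x = "(k, l, m, n)"]) auto
    qed
  qed
  also have "\<dots> = (\<Sum>(k, l, m, n)\<in>Z. W k l * t k l m)"
    by (rule sum.cong[OF refl]) (simp add: split_def)
  finally show ?thesis
    using sum_four_cycles[OF P pos v b bs] unfolding Z_def W_def t_def by simp
qed

subsection \<open>One positive eigenvalue\<close>

text \<open>Vectors are functions on the whole index type, so the maximum is sought in the product
  topology, where a product of intervals supplies compactness.\<close>

lemma compact_box:
  fixes r :: "'i \<Rightarrow> real"
  shows "compact (PiE UNIV (\<lambda>i. {- r i..r i}))"
proof -
  have "compactin (product_topology (\<lambda>i. euclidean) UNIV) (PiE UNIV (\<lambda>i. {- r i..r i}))"
    unfolding compactin_PiE by simp
  then show ?thesis by (simp add: euclidean_product_topology)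
qed

text \<open>The first-order condition at an extremum: near \<open>t = 0\<close> the linear term
  decides the sign.\<close>

lemma nonneg_quadratic_imp_zero:
  fixes p q :: real
  assumes "\<And>t. 0 \<le> p * t + q * t\<^sup>2" shows "p = 0"
proof (rule ccontr)
  assume p: "p \<noteq> 0"
  \<comment> \<open>\<open>a\<close> is positive and at least \<open>q\<close>; the point
    \<open>t\<close> below minimises the parabola with \<open>q\<close> replaced by
    \<open>a\<close>.\<close>
  define a where "a = \<bar>q\<bar> + 1"
  define t where "t = - p / (2 * a)"
  have a: "0 < a" by (simp add: a_def)
  have "q * t\<^sup>2 \<le> a * t\<^sup>2" by (intro mult_right_mono) (auto simp: a_def)
  also have "\<dots> = p\<^sup>2 / (4 * a)"
    using a by (simp add: t_def power2_eq_square field_simps)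
  finally have "p * t + q * t\<^sup>2 \<le> p * t + p\<^sup>2 / (4 * a)" by simp
  also have "\<dots> = - (p\<^sup>2 / (4 * a))"
    using a by (simp add: t_def power2_eq_square field_simps)
  also have "\<dots> < 0" using p a by simp
  finally show False using assms[of t] by simp
qed

text \<open>With \<open>d k = b k / v k\<close> and \<open>N w = (\<Sum>k. d k * (w k)\<^sup>2)\<close>, the eigenvalues of the form relative to \<open>N\<close>
  are at most 1, the eigenvalue 1 is simple by connectedness, and the last assumption says
  \<open>\<mu> \<le> \<mu>\<^sup>2\<close> for every eigenvalue \<open>\<mu>\<close>.\<close>

theorem nonpos_on_complement:
  fixes M :: "'i \<Rightarrow> 'i \<Rightarrow> real"
  assumes fin: "finite K" and sym: "\<And>k l. M k l = M l k"
    and off: "\<And>k l. k \<in> K \<Longrightarrow> l \<in> K \<Longrightarrow> k \<noteq> l \<Longrightarrow> 0 \<le> M k l"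
    and v: "\<And>k. k \<in> K \<Longrightarrow> 0 < v k"
    and b: "\<And>k. k \<in> K \<Longrightarrow> (\<Sum>l\<in>K. M k l * v l) = b k" "\<And>k. k \<in> K \<Longrightarrow> 0 < b k"
    and conn: "\<And>(c :: 'i \<Rightarrow> real) k l. (\<And>k l. k \<in> K \<Longrightarrow> l \<in> K \<Longrightarrow> k \<noteq> l \<Longrightarrow> M k l \<noteq> 0 \<Longrightarrow> c k = c l)
      \<Longrightarrow> k \<in> K \<Longrightarrow> l \<in> K \<Longrightarrow> c k = c l"
    and H: "\<And>w. (\<Sum>k\<in>K. w k * (\<Sum>l\<in>K. M k l * w l)) \<le> (\<Sum>k\<in>K. v k * (\<Sum>l\<in>K. M k l * w l)\<^sup>2 / b k)"
    and w: "(\<Sum>k\<in>K. b k * w k) = 0"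
  shows "(\<Sum>k\<in>K. w k * (\<Sum>l\<in>K. M k l * w l)) \<le> 0"
proof -
  define A where "A w k = (\<Sum>l\<in>K. M k l * w l)" for w k
  define B where "B w u = (\<Sum>k\<in>K. w k * A u k)" for w u
  define d where "d k = b k / v k" for k
  define N where "N w u = (\<Sum>k\<in>K. d k * w k * u k)" for w u
  have d: "0 < d k" if "k \<in> K" for k using v[OF that] b(2)[OF that] by (simp add: d_def)
  have Bsym: "B w u = B u w" for w u
    unfolding B_def A_def sum_distrib_left
    by (subst sum.swap) (simp add: sym mult_ac)
  have Badd: "B (\<lambda>k. x k + t * y k) (\<lambda>k. x k + t * y k) = B x x + 2 * t * B x y + t\<^sup>2 * B y y" for x y t
  proof -
    have A: "A (\<lambda>k. x k + t * y k) k = A x k + t * A y k" for k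
      by (simp add: A_def sum_distrib_left distrib_left sum.distrib mult_ac)
    have "B (\<lambda>k. x k + t * y k) (\<lambda>k. x k + t * y k) = B x x + t * B x y + t * B y x + t\<^sup>2 * B y y"
      unfolding B_def A sum_distrib_left sum.distrib[symmetric]
      by (intro sum.cong refl) (simp add: algebra_simps power2_eq_square)
    then show ?thesis by (simp add: Bsym[of y x])
  qed
  have Nadd: "N (\<lambda>k. x k + t * y k) (\<lambda>k. x k + t * y k) = N x x + 2 * t * N x y + t\<^sup>2 * N y y" for x y t
    unfolding N_def sum_distrib_left sum.distrib[symmetric]
    by (intro sum.cong refl) (simp add: algebra_simps power2_eq_square)
  have Nnonneg: "0 \<le> N x x" for x
    unfolding N_def using d by (intro sum_nonneg) (simp add: mult.assoc less_imp_le)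
  have Nzero: "x k = 0" if "N x x = 0" "k \<in> K" for x k
  proof -
    have "\<forall>k\<in>K. d k * x k * x k = 0"
      using that(1) d unfolding N_def
      by (subst (asm) sum_nonneg_eq_0_iff[OF fin]) (auto simp: mult.assoc less_imp_le)
    then show ?thesis using d[OF that(2)] that(2) by auto
  qed
  have B0: "B x x = 0" if "\<And>k. k \<in> K \<Longrightarrow> x k = 0" for x
    unfolding B_def using that by simp
  have Av: "B x v = (\<Sum>k\<in>K. b k * x k)" for x
    unfolding B_def A_def by (intro sum.cong refl) (simp add: b(1))
  \<comment> \<open>In the coordinates \<open>x k / v k\<close> the row sums \<open>b\<close> turn
    \<open>N - B\<close> into a Dirichlet sum. The diagonal of the matrix, whose sign is unknown,
    drops out.\<close>
  have PF: "N x x - B x x = (\<Sum>k\<in>K. \<Sum>l\<in>K. M k l * v k * v l * (x k / v k - x l / v l)\<^sup>2) / 2" for x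
  proof -
    define c where "c k = x k / v k" for k
    have xc: "x k = c k * v k" if "k \<in> K" for k using v[OF that] by (simp add: c_def)
    have N1: "N x x = (\<Sum>k\<in>K. \<Sum>l\<in>K. M k l * v k * v l * (c k)\<^sup>2)"
      unfolding N_def
    proof (rule sum.cong[OF refl])
      fix k assume k: "k \<in> K"
      have "d k * x k * x k = b k * v k * (c k)\<^sup>2"
        using v[OF k] by (simp add: xc[OF k] d_def power2_eq_square)
      also have "\<dots> = (\<Sum>l\<in>K. M k l * v k * v l * (c k)\<^sup>2)"
        by (simp add: b(1)[OF k, symmetric] sum_distrib_left mult_ac)
      finally show "d k * x k * x k = (\<Sum>l\<in>K. M k l * v k * v l * (c k)\<^sup>2)" .
    qed
    have N2: "N x x = (\<Sum>k\<in>K. \<Sum>l\<in>K. M k l * v k * v l * (c l)\<^sup>2)"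
      unfolding N1 by (subst sum.swap) (simp add: sym mult_ac)
    have "B x x = (\<Sum>k\<in>K. \<Sum>l\<in>K. M k l * v k * v l * (c k * c l))"
      unfolding B_def A_def sum_distrib_left by (intro sum.cong refl) (simp add: xc mult_ac)
    then have "2 * (N x x - B x x) = (\<Sum>k\<in>K. \<Sum>l\<in>K. M k l * v k * v l * (c k)\<^sup>2) +
        (\<Sum>k\<in>K. \<Sum>l\<in>K. M k l * v k * v l * (c l)\<^sup>2) - 2 * (\<Sum>k\<in>K. \<Sum>l\<in>K. M k l * v k * v l * (c k * c l))"
      using N1 N2 by simp
    also have "\<dots> = (\<Sum>k\<in>K. \<Sum>l\<in>K. M k l * v k * v l * (c k - c l)\<^sup>2)"
      unfolding sum_distrib_left sum.distrib[symmetric] sum_subtractf[symmetric]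
      by (intro sum.cong refl) (simp add: algebra_simps power2_eq_square)
    finally show ?thesis by (simp add: c_def)
  qed
  have PFterm: "0 \<le> M k l * v k * v l * (x k / v k - x l / v l)\<^sup>2" if "k \<in> K" "l \<in> K" for x k l
    using off[OF that] v[OF that(1)] v[OF that(2)] by (cases "k = l") auto
  have le1: "B x x \<le> N x x" for x
  proof -
    have "0 \<le> N x x - B x x" unfolding PF using PFterm by (simp add: sum_nonneg)
    then show ?thesis by simp
  qed
  \<comment> \<open>The unit sphere of \<open>N\<close> inside the complement. Coordinates outside
    \<open>K\<close> are invisible to \<open>N\<close>, so the box bounds every coordinate; on
    \<open>K\<close> its radius exceeds what \<open>N x x = 1\<close> permits.\<close>
  define S where "S = PiE UNIV (\<lambda>i. {- (1 + 1 / \<bar>d i\<bar>)..1 + 1 / \<bar>d i\<bar>}) \<inter> ({x. N x x = 1} \<inter> {x. (\<Sum>k\<in>K. b k * x k) = 0})"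
  have S: "compact S"
    unfolding S_def
  proof (intro compact_Int_closed compact_box closed_Int closed_Collect_eq)
    show "continuous_on UNIV (\<lambda>x :: 'i \<Rightarrow> real. N x x)"
      unfolding N_def by (intro continuous_intros continuous_on_product_coordinates)
    show "continuous_on UNIV (\<lambda>x :: 'i \<Rightarrow> real. \<Sum>k\<in>K. b k * x k)"
      by (intro continuous_intros continuous_on_product_coordinates)
  qed simp_all
  define N0 where "N0 x k = (if k \<in> K then x k else 0)" for x :: "'i \<Rightarrow> real" and k
  have inS: "N0 x \<in> S" if "N x x = 1" "(\<Sum>k\<in>K. b k * x k) = 0" for x
  proof -
    have "\<bar>x k\<bar> \<le> 1 + 1 / \<bar>d k\<bar>" if k: "k \<in> K" for k
    proof -
      have "d k * x k * x k \<le> N x x"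
        unfolding N_def using d k by (intro member_le_sum[OF k _ fin]) (simp add: mult.assoc less_imp_le)
      then have "(x k)\<^sup>2 \<le> 1 / d k" using \<open>N x x = 1\<close> d[OF k] by (simp add: field_simps power2_eq_square)
      also have "\<dots> \<le> (1 + 1 / d k)\<^sup>2"
      proof -
        have "e \<le> (1 + e)\<^sup>2" if "0 \<le> e" for e :: real
          using that zero_le_square[of e] by (simp add: power2_eq_square algebra_simps)
        then show ?thesis using d[OF k] by simp
      qed
      finally have "\<bar>x k\<bar> \<le> \<bar>1 + 1 / d k\<bar>" by (simp add: abs_le_square_iff)
      then show ?thesis using d[OF k] by simp
    qed
    then have bd: "\<bar>N0 x k\<bar> \<le> 1 + 1 / \<bar>d k\<bar>" for k by (simp add: N0_def)
    have "N0 x k \<in> {- (1 + 1 / \<bar>d k\<bar>)..1 + 1 / \<bar>d k\<bar>}" for k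
      unfolding atLeastAtMost_iff
      by (intro conjI; use abs_le_D1[OF bd[of k]] abs_le_D2[OF bd[of k]] in linarith)
    then have "N0 x \<in> PiE UNIV (\<lambda>i. {- (1 + 1 / \<bar>d i\<bar>)..1 + 1 / \<bar>d i\<bar>})"
      unfolding PiE_UNIV_domain by (rule Pi_I)
    moreover have "N (N0 x) (N0 x) = N x x" "(\<Sum>k\<in>K. b k * N0 x k) = (\<Sum>k\<in>K. b k * x k)"
      by (simp_all add: N_def N0_def)
    ultimately show ?thesis using that by (simp add: S_def)
  qed
  have BN0: "B (N0 x) (N0 x) = B x x" for x
    unfolding B_def A_def by (simp add: N0_def)
  show ?thesis
  proof (cases "S = {}")
    case True
    have "N w w = 0"
    proof (rule ccontr)
      assume "N w w \<noteq> 0"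
      then have n: "0 < N w w" using Nnonneg[of w] by simp
      define x where "x k = w k / sqrt (N w w)" for k
      have "N x x = N w w / (sqrt (N w w) * sqrt (N w w))"
        unfolding N_def x_def by (simp add: sum_divide_distrib)
      then have "N x x = 1" using n by simp
      moreover have "(\<Sum>k\<in>K. b k * x k) = 0"
        using w by (simp add: x_def sum_divide_distrib[symmetric])
      ultimately show False using inS True by blast
    qed
    then have "B w w = 0" using Nzero B0 by blast
    then show ?thesis by (simp add: B_def A_def)
  next
    case False
    have "continuous_on S (\<lambda>x. B x x)"
      unfolding B_def A_def
      by (intro continuous_intros continuous_on_subset[OF continuous_on_product_coordinates] subset_UNIV)
    then obtain x where x: "x \<in> S" and max: "\<And>y. y \<in> S \<Longrightarrow> B y y \<le> B x x"
      using continuous_attains_sup[OF S False] by blast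
    define \<mu> where "\<mu> = B x x"
    have x1: "N x x = 1" "(\<Sum>k\<in>K. b k * x k) = 0" using x by (auto simp: S_def)
    have ray: "B y y \<le> \<mu> * N y y" if y: "(\<Sum>k\<in>K. b k * y k) = 0" for y
    proof (cases "N y y = 0")
      case True
      then show ?thesis using B0[of y] Nzero[of y] by simp
    next
      case False
      then have n: "0 < N y y" using Nnonneg[of y] by simp
      define z where "z k = y k / sqrt (N y y)" for k
      have "N z z = N y y / (sqrt (N y y) * sqrt (N y y))"
        unfolding N_def z_def by (simp add: sum_divide_distrib)
      then have "N z z = 1" using n by simp
      moreover have "(\<Sum>k\<in>K. b k * z k) = 0"
        using y by (simp add: z_def sum_divide_distrib[symmetric])
      ultimately have "B z z \<le> \<mu>" using max[OF inS] BN0 by (simp add: \<mu>_def)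
      moreover have "B z z = B y y / (sqrt (N y y) * sqrt (N y y))"
        unfolding B_def A_def z_def by (simp add: sum_divide_distrib sum_distrib_left)
      ultimately have "B y y / N y y \<le> \<mu>" using n by simp
      then show ?thesis using n by (simp add: pos_divide_le_eq)
    qed
    have crit: "B x u = \<mu> * N x u" if u: "(\<Sum>k\<in>K. b k * u k) = 0" for u
    proof -
      have "2 * (\<mu> * N x u - B x u) = 0"
      proof (rule nonneg_quadratic_imp_zero[where q = "\<mu> * N u u - B u u"])
        fix t
        have "(\<Sum>k\<in>K. b k * (x k + t * u k)) = 0"
          using x1 u by (simp add: distrib_left sum.distrib sum_distrib_left[symmetric] mult.left_commute[of _ t])
        from ray[OF this] show "0 \<le> 2 * (\<mu> * N x u - B x u) * t + (\<mu> * N u u - B u u) * t\<^sup>2"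
          unfolding Badd Nadd x1 by (simp add: algebra_simps \<mu>_def[symmetric])
      qed
      then show ?thesis by simp
    qed
    \<comment> \<open>The residual of the eigenvalue equation. Since \<open>v\<close> is an
      eigenvector relative to \<open>N\<close>, the residual is orthogonal to \<open>v\<close>.
      Hence \<open>v * g / b\<close> satisfies the constraint, and testing with it shows that no
      Lagrange multiplier survives.\<close>
    define g where "g k = A x k - \<mu> * d k * x k" for k
    have gu: "(\<Sum>k\<in>K. u k * g k) = B u x - \<mu> * N x u" for u
      unfolding g_def B_def N_def sum_distrib_left sum_subtractf[symmetric]
      by (intro sum.cong refl) (simp add: algebra_simps)
    have dv: "d k * v k = b k" if "k \<in> K" for k using v[OF that] by (simp add: d_def)
    have gv: "(\<Sum>k\<in>K. v k * g k) = 0"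
    proof -
      have "N x v = (\<Sum>k\<in>K. b k * x k)"
        unfolding N_def by (intro sum.cong refl) (simp add: dv[symmetric] mult_ac)
      then show ?thesis unfolding gu Bsym[of v x] Av using x1 by simp
    qed
    have g0: "g k = 0" if k: "k \<in> K" for k
    proof -
      let ?u = "\<lambda>k. v k * g k / b k"
      have "(\<Sum>k\<in>K. b k * ?u k) = (\<Sum>k\<in>K. v k * g k)"
        using b(2) by (intro sum.cong refl) (simp add: less_imp_neq[THEN not_sym])
      then have "(\<Sum>k\<in>K. b k * ?u k) = 0" using gv by simp
      then have "(\<Sum>k\<in>K. ?u k * g k) = 0" unfolding gu using crit[of ?u] Bsym[of ?u x] by simp
      moreover have "0 \<le> ?u k * g k" if "k \<in> K" for k
        using v[OF that] b(2)[OF that] by (simp add: mult.assoc)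
      ultimately have "?u k * g k = 0" using k fin by (simp add: sum_nonneg_eq_0_iff)
      then show ?thesis using v[OF k] b(2)[OF k] by auto
    qed
    have eig: "A x k = \<mu> * d k * x k" if "k \<in> K" for k using g0[OF that] by (simp add: g_def)
    have "\<mu> \<le> (\<Sum>k\<in>K. v k * (A x k)\<^sup>2 / b k)"
      unfolding \<mu>_def B_def A_def by (rule H)
    also have "\<dots> = (\<Sum>k\<in>K. \<mu>\<^sup>2 * (d k * x k * x k))"
    proof (rule sum.cong[OF refl])
      fix k assume k: "k \<in> K"
      show "v k * (A x k)\<^sup>2 / b k = \<mu>\<^sup>2 * (d k * x k * x k)"
        unfolding eig[OF k] dv[OF k, symmetric] using v[OF k] d[OF k] by (simp add: power2_eq_square)
    qed
    also have "\<dots> = \<mu>\<^sup>2" using x1 by (simp add: N_def sum_distrib_left[symmetric])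
    finally have mm: "\<mu> \<le> \<mu>\<^sup>2" .
    have "\<mu> \<le> 0"
    proof (rule ccontr)
      assume "\<not> \<mu> \<le> 0"
      then have "1 \<le> \<mu>" using mm by (simp add: power2_eq_square)
      moreover have "\<mu> \<le> 1" using le1[of x] x1 by (simp add: \<mu>_def)
      ultimately have "N x x - B x x = 0" using x1 by (simp add: \<mu>_def)
      then have "(\<Sum>k\<in>K. \<Sum>l\<in>K. M k l * v k * v l * (x k / v k - x l / v l)\<^sup>2) = 0" unfolding PF by simp
      then have z: "M k l * v k * v l * (x k / v k - x l / v l)\<^sup>2 = 0" if "k \<in> K" "l \<in> K" for k l
        using that fin PFterm by (simp add: sum_nonneg_eq_0_iff sum_nonneg)
      have const: "x k / v k = x l / v l" if "k \<in> K" "l \<in> K" for k l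
      proof (rule conn[OF _ that])
        fix k l assume kl: "k \<in> K" "l \<in> K" "k \<noteq> l" "M k l \<noteq> 0"
        then show "x k / v k = x l / v l" using z[OF kl(1,2)] v[OF kl(1)] v[OF kl(2)] by simp
      qed
      have "K \<noteq> {}" using x1 by (auto simp: N_def)
      then obtain k0 where k0: "k0 \<in> K" by auto
      define c where "c = x k0 / v k0"
      have xk: "x k = c * v k" if "k \<in> K" for k
        using const[OF that k0] v[OF that] by (simp add: c_def field_simps)
      have "(\<Sum>k\<in>K. b k * x k) = c * (\<Sum>k\<in>K. b k * v k)"
        unfolding sum_distrib_left by (intro sum.cong refl) (simp add: xk)
      moreover have "0 < (\<Sum>k\<in>K. b k * v k)"
        using k0 fin v b(2) by (intro sum_pos) auto
      ultimately have "c = 0" using x1 by simp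
      then have "N x x = 0" using xk by (simp add: N_def)
      then show False using x1 by simp
    qed
    then have "B w w \<le> 0" using ray[OF w] Nnonneg[of w] mult_nonpos_nonneg[of \<mu> "N w w"] by linarith
    then show ?thesis by (simp add: B_def A_def)
  qed
qed

subsection \<open>Positivity\<close>

text \<open>The triple \<open>(1, 1, 1)\<close> is the smallest one with positive gaps: the weight
  lists the coefficients of the monomial \<open>X1 X2 X3\<close> times a product of linear
  forms.\<close>

fun wt :: "(real \<times> real \<times> real) list \<Rightarrow> int \<times> int \<times> int \<Rightarrow> real" where
  "wt [] = (\<lambda>s. if s = (1, 1, 1) then 1 else 0)"
| "wt (\<tau> # \<tau>s) = shift \<tau> (wt \<tau>s)"

definition pos_dir :: "real \<times> real \<times> real \<Rightarrow> bool" where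
  "pos_dir \<tau> \<longleftrightarrow> 0 < fst \<tau> \<and> 0 < fst (snd \<tau>) \<and> 0 < snd (snd \<tau>)"

lemma supported_wt: "supported (wt \<tau>s)"
proof (induction \<tau>s)
  case Nil
  then show ?case by (auto simp: supported_def pos_gaps_def)
qed (simp add: supported_shift)

lemma wt_nonneg: "\<forall>\<tau>\<in>set \<tau>s. pos_dir \<tau> \<Longrightarrow> 0 \<le> wt \<tau>s s"
  by (induction \<tau>s arbitrary: s) (auto simp: shift_def pos_dir_def less_imp_le intro!: add_nonneg_nonneg mult_nonneg_nonneg)

text \<open>If the sum exceeds three, some entry is at least two and can be lowered within the
  positive triples.\<close>

lemma wt_pos:
  assumes "\<forall>\<tau>\<in>set \<tau>s. pos_dir \<tau>" "pos_gaps (s1, s2, s3)" "s1 + s2 + s3 = 3 + int (length \<tau>s)"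
  shows "0 < wt \<tau>s (s1, s2, s3)"
  using assms
proof (induction \<tau>s arbitrary: s1 s2 s3)
  case (Cons \<tau> \<tau>s)
  obtain t1 t2 t3 where \<tau>: "\<tau> = (t1, t2, t3)" by (metis prod_cases3)
  have t: "0 < t1" "0 < t2" "0 < t3" and ps: "\<forall>\<tau>\<in>set \<tau>s. pos_dir \<tau>"
    using Cons.prems(1) by (auto simp: \<tau> pos_dir_def)
  have n: "0 \<le> t1 * wt \<tau>s (s1 - 1, s2, s3)" "0 \<le> t2 * wt \<tau>s (s1, s2 - 1, s3)" "0 \<le> t3 * wt \<tau>s (s1, s2, s3 - 1)"
    using t wt_nonneg[OF ps] by auto
  have "2 \<le> s1 \<or> 2 \<le> s2 \<or> 2 \<le> s3" using Cons.prems(2,3) by (auto simp: pos_gaps_def)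
  then have "0 < t1 * wt \<tau>s (s1 - 1, s2, s3) \<or> 0 < t2 * wt \<tau>s (s1, s2 - 1, s3) \<or> 0 < t3 * wt \<tau>s (s1, s2, s3 - 1)"
    using Cons.IH[OF ps, of "s1 - 1" s2 s3] Cons.IH[OF ps, of s1 "s2 - 1" s3] Cons.IH[OF ps, of s1 s2 "s3 - 1"]
      Cons.prems(2,3) t by (auto simp: pos_gaps_def)
  then show ?case using n by (auto simp: shift_def \<tau>)
qed (auto simp: pos_gaps_def)

text \<open>The constant 4 matches degrees: gaps in the layer add up to
  \<open>card (elems P) - card B - 1\<close>, and the weight is positive on the positive triples
  with sum \<open>3 + length \<tau>s\<close>.\<close>

lemma vol_wt_pos:
  assumes P: "valid P" and \<tau>s: "\<forall>\<tau>\<in>set \<tau>s. pos_dir \<tau>" and ne: "layer P B \<noteq> {}"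
    and c: "card (elems P) = 4 + card B + length \<tau>s"
  shows "0 < vol P B (wt \<tau>s)"
  unfolding vol_def
proof (rule sum_pos)
  fix L assume L: "L \<in> layer P B"
  obtain s1 s2 s3 where g: "gaps P L = (s1, s2, s3)" by (metis prod_cases3)
  show "0 < wt \<tau>s (gaps P L)"
    using wt_pos[OF \<tau>s, of s1 s2 s3] layer_positive[OF L] sum_gaps_layer[OF P L g] c g by simp
qed (use finite_layer[OF P] ne in auto)

lemma sum_int_eq_const: "m \<le> m' \<Longrightarrow> (\<And>i. m \<le> i \<Longrightarrow> i < m' \<Longrightarrow> f i = (c :: real)) \<Longrightarrow> sum f {m..<m'} = of_int (m' - m) * c"
  for m m' :: int
  by simp

text \<open>One linear extension is stretched: each unit step inside a gap gets the prescribed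
  length of the gap divided by its number of steps. The steps below mark 1 and above mark 3 share
  one rate.\<close>

lemma exists_field:
  assumes P: "valid P"
  obtains a where "gaps P a = \<tau>" and "pos_dir \<tau> \<longrightarrow> (\<forall>k\<in>rels P. 0 < df a k)"
proof -
  obtain t1 t2 t3 where \<tau>: "\<tau> = (t1, t2, t3)" by (metis prod_cases3)
  obtain L where L: "L \<in> layer P {}" using valid_nonempty[OF P] by auto
  define c where "c i = L (mark P i)" for i
  have "pos_gaps (gaps P L) \<longleftrightarrow> L (mark P 1) < L (mark P 2) \<and> L (mark P 2) < L (mark P 3) \<and>
    (L (mark P 0) < L (mark P 1) \<or> L (mark P 3) < L (mark P 4))"
    using P layer_mono[OF L] by (rule pos_gaps_iff)
  then have c: "c 1 < c 2" "c 2 < c 3" "c 0 < c 1 \<or> c 3 < c 4"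
    using layer_positive[OF L] by (auto simp: c_def)
  have c': "c 0 \<le> c 1" "c 3 \<le> c 4"
    using layer_mono[OF L] valid_bot[OF P valid_mark[OF P, of 1]] valid_top[OF P valid_mark[OF P, of 3]]
    unfolding c_def by force+
  have c0: "c 0 = 0" using layer_bot[OF P L] by (simp add: c_def)
  define r1 where "r1 = t1 / of_int (c 2 - c 1)"
  define r2 where "r2 = t2 / of_int (c 3 - c 2)"
  define r3 where "r3 = t3 / of_int (c 1 - c 0 + (c 4 - c 3))"
  define rate where "rate i = (if c 1 \<le> i \<and> i < c 2 then r1 else if c 2 \<le> i \<and> i < c 3 then r2 else r3)" for i
  define a where "a e = sum rate {0..<L e}" for e
  have spl: "sum rate {0..<m'} - sum rate {0..<m} = sum rate {m..<m'}" if "0 \<le> m" "m \<le> m'" for m m' :: int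
  proof -
    have "{0..<m'} = {0..<m} \<union> {m..<m'}" using that by auto
    then have "sum rate {0..<m'} = sum rate {0..<m} + sum rate {m..<m'}"
      by (simp only:) (rule sum.union_disjoint, auto)
    then show ?thesis by simp
  qed
  have "a (mark P 2) - a (mark P 1) = t1"
  proof -
    have "a (mark P 2) - a (mark P 1) = sum rate {c 1..<c 2}"
      using spl[of "c 1" "c 2"] c c' c0 by (simp add: a_def c_def)
    also have "\<dots> = of_int (c 2 - c 1) * r1"
      by (rule sum_int_eq_const) (use c in \<open>auto simp: rate_def\<close>)
    finally show ?thesis using c by (simp add: r1_def)
  qed
  moreover have "a (mark P 3) - a (mark P 2) = t2"
  proof -
    have "a (mark P 3) - a (mark P 2) = sum rate {c 2..<c 3}"
      using spl[of "c 2" "c 3"] c c' c0 by (simp add: a_def c_def)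
    also have "\<dots> = of_int (c 3 - c 2) * r2"
      by (rule sum_int_eq_const) (use c in \<open>auto simp: rate_def\<close>)
    finally show ?thesis using c by (simp add: r2_def)
  qed
  moreover have "a (mark P 1) - a (mark P 0) + (a (mark P 4) - a (mark P 3)) = t3"
  proof -
    have "a (mark P 1) - a (mark P 0) = sum rate {c 0..<c 1}"
      using spl[of "c 0" "c 1"] c c' c0 by (simp add: a_def c_def)
    also have "\<dots> = of_int (c 1 - c 0) * r3"
      by (rule sum_int_eq_const) (use c c' in \<open>auto simp: rate_def\<close>)
    finally have 1: "a (mark P 1) - a (mark P 0) = of_int (c 1 - c 0) * r3" .
    have "a (mark P 4) - a (mark P 3) = sum rate {c 3..<c 4}"
      using spl[of "c 3" "c 4"] c c' c0 by (simp add: a_def c_def)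
    also have "\<dots> = of_int (c 4 - c 3) * r3"
      by (rule sum_int_eq_const) (use c c' in \<open>auto simp: rate_def\<close>)
    finally have "a (mark P 1) - a (mark P 0) + (a (mark P 4) - a (mark P 3)) =
        of_int (c 1 - c 0 + (c 4 - c 3)) * r3" using 1 by (simp add: algebra_simps)
    moreover have "c 1 - c 0 + (c 4 - c 3) \<noteq> 0" using c c' by auto
    ultimately show ?thesis by (simp add: r3_def del: of_int_add of_int_diff)
  qed
  ultimately have "gaps P a = \<tau>" by (simp add: gaps_def \<tau>)
  moreover have "0 < df a k" if "pos_dir \<tau>" "k \<in> rels P" for k
  proof -
    obtain p q where k: "k = (p, q)" by fastforce
    have rate: "0 < rate i" for i
      using that(1) c c' by (auto simp: rate_def r1_def r2_def r3_def pos_dir_def \<tau> simp del: of_int_add of_int_diff)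
    have "L p < L q" using layer_empty_less[OF P L] that k by simp
    moreover have "0 \<le> L p" using layer_empty_range(1)[OF L] valid_rels[OF P, of p q] that k by simp
    ultimately have "df a k = sum rate {L p..<L q}" using spl[of "L p" "L q"] by (simp add: df_def a_def k)
    also have "\<dots> > 0" using rate \<open>L p < L q\<close> by (intro sum_pos) auto
    finally show ?thesis .
  qed
  ultimately show ?thesis using that by blast
qed

subsection \<open>Connectedness of the facets\<close>

text \<open>The elements on level \<open>j\<close> form a block without marks, and no related
  element stands between it and level \<open>i\<close>. So it can travel there, and one more
  identification holds on arrival.\<close>

lemma move_block:
  assumes P: "valid P" and L: "L \<in> layer P B" and i: "i \<in> L ` elems P" and j: "j \<in> L ` elems P" and ij: "i \<noteq> j"
    and nm: "\<And>n. n \<le> 4 \<Longrightarrow> L (mark P n) \<noteq> j"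
    and lo: "\<And>p q. (p, q) \<in> rels P \<Longrightarrow> L q = j \<Longrightarrow> L p \<noteq> j \<Longrightarrow> L p \<le> i"
    and hi: "\<And>p q. (p, q) \<in> rels P \<Longrightarrow> L p = j \<Longrightarrow> L q \<noteq> j \<Longrightarrow> i \<le> L q"
    and c: "card B' = Suc (card B)"
    and B': "\<And>p q. (p, q) \<in> B' \<Longrightarrow> p \<in> elems P \<and> q \<in> elems P \<and> (L p = L q \<or> L p \<in> {i, j} \<and> L q \<in> {i, j})"
  shows "layer P B' \<noteq> {}"
proof -
  \<comment> \<open>Level \<open>j\<close> goes to \<open>i\<close>, and the level left empty is
    closed.\<close>
  define f where "f x = (let y = if x = j then i else x in if j < y then y - 1 else y)" for x
  define L' where "L' = restrict (\<lambda>e. f (L e)) (elems P)"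
  have L'e: "L' e = f (L e)" if "e \<in> elems P" for e using that by (simp add: L'_def)
  let ?m = "int (card (elems P)) - int (card B)"
  have im: "L ` elems P = {0..<?m}" using layer_image[OF L] .
  have ir: "0 \<le> i" "i < ?m" "0 \<le> j" "j < ?m" using i j unfolding im by auto
  have fmono: "f x < f y" if "x < y" "x \<noteq> j" "y \<noteq> j" for x y using that by (auto simp: f_def Let_def)
  have mono: "L' p \<le> L' q" if pq: "(p, q) \<in> rels P" for p q
  proof -
    have "L p \<le> L q" using layer_mono[OF L pq] .
    then have "f (L p) \<le> f (L q)" using lo[OF pq] hi[OF pq] ij by (auto simp: f_def Let_def)
    then show ?thesis using valid_rels[OF P pq] by (simp add: L'e)
  qed
  have "L' \<in> layer P B'"
  proof (rule layerI)
    have "L' ` elems P = f ` {0..<?m}" unfolding im[symmetric] image_image by (intro image_cong refl) (simp add: L'e)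
    also have "\<dots> = {0..<?m - 1}"
    proof (intro equalityI subsetI)
      fix x assume "x \<in> f ` {0..<?m}"
      then show "x \<in> {0..<?m - 1}" using ir ij by (auto simp: f_def Let_def split: if_splits)
    next
      fix x assume x: "x \<in> {0..<?m - 1}"
      then have "f (if x < j then x else x + 1) = x" "(if x < j then x else x + 1) \<in> {0..<?m}"
        by (auto simp: f_def Let_def)
      then show "x \<in> f ` {0..<?m}" by (metis imageI)
    qed
    finally show "L' ` elems P = {0..<int (card (elems P)) - int (card B')}" using c by (simp add: algebra_simps)
    show "L' p = L' q" if "(p, q) \<in> B'" for p q using B'[OF that] by (auto simp: L'e f_def)
    show "pos_gaps (gaps P L')"
    proof (rule pos_gaps_transfer[OF P layer_positive[OF L] layer_mono[OF L] mono])
      show "L' (mark P n) < L' (mark P n')" if "n \<le> 4" "n' \<le> 4" "L (mark P n) < L (mark P n')" for n n'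
        using fmono[OF that(3) nm nm] that valid_mark[OF P] by (simp add: L'e)
    qed
  qed (use mono in \<open>auto simp: L'_def\<close>)
  then show ?thesis by blast
qed

lemma fibre_singleton:
  assumes P: "valid P" and k: "k \<in> rels P" and L: "L \<in> layer P {k}" and w: "w \<in> elems P" "w \<notin> {fst k, snd k}"
    and t: "t \<in> elems P" "L t = L w"
  shows "t = w"
proof (rule ccontr)
  assume tw: "t \<noteq> w"
  obtain u v where kd: "k = (u, v)" by fastforce
  have uv: "u \<in> elems P" "v \<in> elems P" "u \<noteq> v" "L u = L v"
    using valid_rels[OF P] k kd layer_eq[OF L, of u v] by auto
  have wu: "L w \<noteq> L u" using fibre_pair[OF P _ _ w(1)] k L w kd by auto
  then have tu: "t \<noteq> u" "t \<noteq> v" using t uv by auto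
  have "card {v, t} \<le> card {k}"
  proof (rule card_redundant_le[OF P L])
    fix d assume "d \<in> {v, t}"
    then have "d = v \<or> d = t" by auto
    then show "\<exists>e\<in>elems P - {v, t}. L e = L d"
    proof
      assume "d = v" then show ?thesis using uv tu by (intro bexI[of _ u]) auto
    next
      assume "d = t" then show ?thesis using w t tw kd by (intro bexI[of _ w]) auto
    qed
  qed (use uv t in auto)
  then show False using tu by simp
qed

lemma mark_chain:
  assumes P: "valid P" and m: "\<And>p q. (p, q) \<in> rels P \<Longrightarrow> (L p :: int) \<le> L q" and "i \<le> j" "j \<le> 4"
  shows "L (mark P i) \<le> L (mark P j)"
proof -
  have "L (mark P 0) \<le> L (mark P 1)" "L (mark P 3) \<le> L (mark P 4)"
    using m valid_bot[OF P valid_mark[OF P, of 1]] valid_top[OF P valid_mark[OF P, of 3]] by force+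
  moreover have "L (mark P 1) \<le> L (mark P 2)" "L (mark P 2) \<le> L (mark P 3)"
    using m valid_12[OF P] valid_23[OF P] by auto
  moreover have "i \<in> {0, 1, 2, 3, 4}" "j \<in> {0, 1, 2, 3, 4}" using assms by auto
  ultimately show ?thesis using \<open>i \<le> j\<close> by auto
qed

text \<open>The hub is \<open>(z, w)\<close>, where \<open>w\<close> is lowest in rank among the
  unmarked elements and \<open>z\<close> is the highest mark below it: on a facet not involving
  \<open>w\<close>, the element \<open>w\<close> can slide down to \<open>z\<close>. A facet ending
  in \<open>w\<close> is the hub itself. For facets starting at \<open>w\<close> a detour is needed;
  there are at most five marks, so seven elements guarantee a second unmarked one for it.\<close>

theorem facets_connected:
  fixes P :: "'b marked" and c :: "'b \<times> 'b \<Rightarrow> real"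
  assumes P: "valid P" and card: "7 \<le> card (elems P)"
    and c: "\<And>k l. k \<in> facets P \<Longrightarrow> l \<in> facets P \<Longrightarrow> k \<noteq> l \<Longrightarrow> layer P {k, l} \<noteq> {} \<Longrightarrow> c k = c l"
    and kl: "k \<in> facets P" "l \<in> facets P"
  shows "c k = c l"
proof -
  define Mk where "Mk = mark P ` {..4}"
  have MkE: "Mk \<subseteq> elems P" using valid_mark[OF P] by (auto simp: Mk_def)
  have fin: "finite (elems P)" using valid_finite[OF P] .
  have "card Mk \<le> 5" unfolding Mk_def using card_image_le[of "{..4::nat}" "mark P"] by simp
  then have c2: "2 \<le> card (elems P - Mk)"
    using card MkE fin by (simp add: card_Diff_subset finite_subset)
  obtain r :: "'b \<Rightarrow> int" where r: "\<And>p q. (p, q) \<in> rels P \<Longrightarrow> r p < r q"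
    using valid_rank[OF P] by blast
  have ne: "elems P - Mk \<noteq> {}" using c2 by (metis card.empty not_numeral_le_zero)
  then obtain w where w: "w \<in> elems P - Mk" and wmin: "\<And>e. e \<in> elems P - Mk \<Longrightarrow> r w \<le> r e"
    using fin by (metis (no_types, lifting) arg_min_if_finite finite_Diff not_le)
  have wE: "w \<in> elems P" "\<And>n. n \<le> 4 \<Longrightarrow> mark P n \<noteq> w" using w by (auto simp: Mk_def)
  have pw: "p \<in> Mk" if "(p, w) \<in> rels P" for p
    using wmin[of p] r[OF that] valid_rels[OF P that] by fastforce
  obtain w' where w': "w' \<in> elems P - Mk" "w' \<noteq> w"
  proof -
    have "elems P - Mk \<noteq> {w}" using c2 by auto
    then show ?thesis using that w by blast
  qed
  define I where "I = {i. i \<le> 4 \<and> (mark P i, w) \<in> rels P}"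
  have I0: "0 \<in> I" using valid_bot[OF P wE(1)] wE(2)[of 0] by (auto simp: I_def)
  have finI: "finite I" by (simp add: I_def)
  define z where "z = mark P (Max I)"
  have MaxI: "Max I \<in> I" using I0 finI by (intro Max_in) auto
  have zw: "(z, w) \<in> rels P" using MaxI by (simp add: I_def z_def)
  have zE: "z \<in> elems P" "z \<noteq> w" using valid_rels[OF P zw] by auto
  have zmax: "L p \<le> L z" if pw': "(p, w) \<in> rels P" and m: "\<And>p q. (p, q) \<in> rels P \<Longrightarrow> (L p :: int) \<le> L q" for L p
  proof -
    obtain i where i: "i \<le> 4" "p = mark P i" using pw[OF pw'] by (auto simp: Mk_def)
    then have "i \<le> Max I" using pw' finI by (intro Max_ge) (auto simp: I_def)
    moreover have "Max I \<le> 4" using MaxI by (simp add: I_def)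
    ultimately have "L (mark P i) \<le> L (mark P (Max I))" by (intro mark_chain[OF P]) (use m in auto)
    then show ?thesis using i by (simp add: z_def)
  qed
  let ?z = "(z, w)"
  have to_z: "layer P B' \<noteq> {}"
    if L: "L \<in> layer P B" and sing: "\<And>t. t \<in> elems P \<Longrightarrow> L t = L w \<Longrightarrow> t = w"
      and c': "card B' = Suc (card B)"
      and B': "\<And>p q. (p, q) \<in> B' \<Longrightarrow> (p, q) = ?z \<or> (p, q) \<in> B \<and> p \<in> elems P \<and> q \<in> elems P" for L B B'
  proof (rule move_block[OF P L, where i = "L z" and j = "L w"])
    note m = layer_mono[OF L]
    show "L z \<noteq> L w" using sing[OF zE(1)] zE(2) by auto
    show "L (mark P n) \<noteq> L w" if "n \<le> 4" for n
      using sing[OF valid_mark[OF P], of n] wE(2)[OF that] by auto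
    show "L p \<le> L z" if "(p, q) \<in> rels P" "L q = L w" "L p \<noteq> L w" for p q
    proof -
      have "q = w" using sing that valid_rels[OF P that(1)] by auto
      then show ?thesis using zmax[OF _ m] that by simp
    qed
    show "L z \<le> L q" if "(p, q) \<in> rels P" "L p = L w" "L q \<noteq> L w" for p q
      using m[OF zw] m[OF that(1)] that by simp
    show "p \<in> elems P \<and> q \<in> elems P \<and> (L p = L q \<or> L p \<in> {L z, L w} \<and> L q \<in> {L z, L w})"
      if "(p, q) \<in> B'" for p q
      using B'[OF that] zE(1) wE(1) layer_eq[OF L, of p q] by auto
  qed (use zE wE c' in auto)
  have zF: "?z \<in> facets P"
  proof -
    obtain L where L: "L \<in> layer P {}" using valid_nonempty[OF P] by auto
    have "layer P {?z} \<noteq> {}"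
      using inj_onD[OF layer_empty_inj[OF P L]] wE(1) by (intro to_z[OF L]) auto
    then show ?thesis using zw by (simp add: facets_def)
  qed
  have off_w: "c k = c ?z" if k: "k \<in> facets P" and wk: "w \<notin> {fst k, snd k}" for k
  proof -
    have kz: "k \<noteq> ?z" using wk by auto
    obtain L where L: "L \<in> layer P {k}" using k by (auto simp: facets_def)
    have "layer P {k, ?z} \<noteq> {}"
      using fibre_singleton[OF P facets_rels[OF k] L wE(1) wk] kz facets_rels[OF k] valid_rels[OF P]
      by (intro to_z[OF L]) auto
    then show ?thesis using c[OF k zF kz] by simp
  qed
  have all: "c k = c ?z" if k: "k \<in> facets P" for k
  proof -
    obtain u v where kd: "k = (u, v)" by fastforce
    have kr: "(u, v) \<in> rels P" using facets_rels[OF k] kd by simp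
    have uvE: "u \<in> elems P" "v \<in> elems P" "u \<noteq> v" using valid_rels[OF P kr] by auto
    obtain L where L: "L \<in> layer P {(u, v)}" using k kd by (auto simp: facets_def)
    note m = layer_mono[OF L]
    have Luv: "L u = L v" using layer_eq[OF L, of u v] by simp
    have into_w: "u = z" if "v = w"
    proof -
      have "L u \<le> L z" using zmax[OF _ m] kr that by simp
      then have "L z = L u" using m[OF zw] Luv that by simp
      then show ?thesis using fibre_pair[OF P kr L zE(1)] zE(2) that by auto
    qed
    consider "w \<notin> {fst k, snd k}" | "v = w" | "u = w" "v \<notin> Mk" | "u = w" "v \<in> Mk" using kd by auto
    then show ?thesis
    proof cases
      case 1
      then show ?thesis using off_w[OF k] by simp
    next
      case 2
      then show ?thesis using into_w kd by simp
    next
      case 3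
      \<comment> \<open>The tied block \<open>{w, v}\<close> slides down to its highest predecessor
        \<open>s\<close>. The new relation either ends in \<open>v\<close> and avoids
        \<open>w\<close>, or it is the hub.\<close>
      define S where "S = {s \<in> elems P. (s, w) \<in> rels P \<or> (s, v) \<in> rels P \<and> s \<noteq> w}"
      have Sf: "finite S" using fin by (simp add: S_def)
      have zS: "z \<in> S" using zw zE by (simp add: S_def)
      have "Max (L ` S) \<in> L ` S" using Sf zS by (intro Max_in) auto
      then obtain s where s: "s \<in> S" "L s = Max (L ` S)" by auto
      have smax: "L t \<le> L s" if "t \<in> S" for t using that s Sf by (simp add: Max_ge)
      have fib: "t = w \<or> t = v" if "t \<in> elems P" "L t = L w" for t
        using fibre_pair[OF P kr L that(1)] that 3 by simp
      have sw: "s \<noteq> w" "s \<noteq> v" "s \<in> elems P"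
        using s(1) valid_rels[OF P] valid_asym[OF P kr] 3 by (auto simp: S_def)
      define q where "q = (if (s, w) \<in> rels P then w else v)"
      have sq: "(s, q) \<in> rels P" using s(1) by (auto simp: S_def q_def)
      have ne: "(s, q) \<noteq> (u, v)" using sw 3 by auto
      have lay: "layer P {(u, v), (s, q)} \<noteq> {}"
      proof (rule move_block[OF P L, where i = "L s" and j = "L w"])
        show "L s \<noteq> L w" using fib[OF sw(3)] sw by auto
        show "L (mark P n) \<noteq> L w" if "n \<le> 4" for n
          using fib[OF valid_mark[OF P], of n] wE(2)[OF that] that 3 by (auto simp: Mk_def)
        show "L p \<le> L s" if pq: "(p, q) \<in> rels P" "L q = L w" "L p \<noteq> L w" for p q
        proof -
          have "q = w \<or> q = v" using fib pq valid_rels[OF P pq(1)] by auto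
          then have "p \<in> S" using pq valid_rels[OF P pq(1)] by (auto simp: S_def)
          then show ?thesis by (rule smax)
        qed
        show "L s \<le> L q'" if pq: "(p, q') \<in> rels P" "L p = L w" "L q' \<noteq> L w" for p q'
          using m[OF sq] m[OF pq(1)] pq Luv 3 by (auto simp: q_def split: if_splits)
        show "p \<in> elems P \<and> q' \<in> elems P \<and> (L p = L q' \<or> L p \<in> {L s, L w} \<and> L q' \<in> {L s, L w})"
          if "(p, q') \<in> {(u, v), (s, q)}" for p q'
          using that uvE sw Luv 3 by (auto simp: q_def split: if_splits)
      qed (use sw wE ne in auto)
      have sF: "(s, q) \<in> facets P"
      proof (cases "(s, w) \<in> rels P")
        case True
        then show ?thesis using layer2_split(5)[OF P kr sq ne lay] 3 by (simp add: q_def)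
      next
        case False
        then show ?thesis using layer2_split(4)[OF P kr sq ne lay] 3 by (simp add: q_def)
      qed
      have ks: "c k = c (s, q)" using c[OF k sF] lay ne kd by auto
      show ?thesis
      proof (cases "(s, w) \<in> rels P")
        case True
        then have qw: "q = w" by (simp add: q_def)
        obtain L' where L': "L' \<in> layer P {(s, w)}" using sF qw by (auto simp: facets_def)
        have "L' s \<le> L' z" using zmax[OF True layer_mono[OF L']] .
        then have "L' z = L' s" using layer_mono[OF L' zw] layer_eq[OF L', of s w] by simp
        then have "z = s" using fibre_pair[OF P True L' zE(1)] zE(2) by auto
        then show ?thesis using ks qw by simp
      next
        case False
        then have "q = v" by (simp add: q_def)
        then show ?thesis using ks off_w[OF sF] sw 3 uvE by auto
      qed
    next
      case 4
      have w'E: "w' \<in> elems P" "w' \<notin> {fst (u, v), snd (u, v)}" using w' 4 by auto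
      \<comment> \<open>The block now contains a mark and cannot slide, so \<open>w'\<close> rises
        to its lowest successor \<open>t\<close> instead. The relation \<open>(w', t)\<close> avoids
        \<open>w\<close>, below which there are only marks.\<close>
      define S where "S = {t \<in> elems P. (w', t) \<in> rels P}"
      have Sf: "finite S" using fin by (simp add: S_def)
      have w'4: "w' \<noteq> mark P 4" using w' by (auto simp: Mk_def)
      have zS: "mark P 4 \<in> S" using valid_top[OF P w'E(1) w'4] valid_mark[OF P] by (simp add: S_def)
      have "Min (L ` S) \<in> L ` S" using Sf zS by (intro Min_in) auto
      then obtain t where t: "t \<in> S" "L t = Min (L ` S)" by auto
      have tmin: "L t \<le> L t'" if "t' \<in> S" for t' using that t Sf by (simp add: Min_le)
      have sing: "t' = w'" if "t' \<in> elems P" "L t' = L w'" for t'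
        using fibre_singleton[OF P kr L w'E that] .
      have wt: "(w', t) \<in> rels P" "t \<in> elems P" using t(1) by (auto simp: S_def)
      have tw': "t \<noteq> w'" using valid_rels[OF P wt(1)] by auto
      have tw: "t \<noteq> w" using pw[of w'] wt w' by auto
      have ww': "(w', w) \<notin> rels P" using pw[of w'] w' by auto
      have ne: "(w', t) \<noteq> (u, v)" using w'E by auto
      have lay: "layer P {(u, v), (w', t)} \<noteq> {}"
      proof (rule move_block[OF P L, where i = "L t" and j = "L w'"])
        show "L t \<noteq> L w'" using sing[OF wt(2)] tw' by auto
        show "L (mark P n) \<noteq> L w'" if "n \<le> 4" for n
          using sing[OF valid_mark[OF P], of n] w' that by (auto simp: Mk_def)
        show "L p \<le> L t" if pq: "(p, q) \<in> rels P" "L q = L w'" "L p \<noteq> L w'" for p q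
          using m[OF wt(1)] m[OF pq(1)] pq by simp
        show "L t \<le> L q'" if pq: "(p, q') \<in> rels P" "L p = L w'" "L q' \<noteq> L w'" for p q'
        proof -
          have "p = w'" using sing pq valid_rels[OF P pq(1)] by auto
          then have "q' \<in> S" using pq valid_rels[OF P pq(1)] by (auto simp: S_def)
          then show ?thesis by (rule tmin)
        qed
        show "p \<in> elems P \<and> q' \<in> elems P \<and> (L p = L q' \<or> L p \<in> {L t, L w'} \<and> L q' \<in> {L t, L w'})"
          if "(p, q') \<in> {(u, v), (w', t)}" for p q'
          using that uvE w'E wt Luv by auto
      qed (use w'E wt ne in auto)
      have tF: "(w', t) \<in> facets P"
      proof (cases "t = v")
        case True
        then show ?thesis using layer2_split(4)[OF P kr wt(1) ne lay] ww' 4 by simp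
      next
        case False
        then show ?thesis using layer2_split(1)[OF P kr wt(1) ne lay] w'E tw 4 by simp
      qed
      have "c k = c (w', t)" using c[OF k tF] lay ne kd by auto
      then show ?thesis using off_w[OF tF] w' tw by auto
    qed
  qed
  show ?thesis using all[OF kl(1)] all[OF kl(2)] by simp
qed

subsection \<open>The Lorentzian property by induction\<close>

text \<open>At most one positive eigenvalue, written as a reversed Cauchy-Schwarz inequality: the
  shape used for facets in the induction and for counts at the end.\<close>

definition lorentzian :: "'b marked \<Rightarrow> (int \<times> int \<times> int \<Rightarrow> real) \<Rightarrow> bool" where
  "lorentzian P \<omega> \<longleftrightarrow> (\<forall>x y. 0 < bilin P \<omega> y y \<longrightarrow> bilin P \<omega> x x * bilin P \<omega> y y \<le> (bilin P \<omega> x y)\<^sup>2)"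

lemma bilin_combine:
  "bilin P \<omega> (\<lambda>k. s * x k + t * y k) (\<lambda>k. s * x k + t * y k) =
    s\<^sup>2 * bilin P \<omega> x x + 2 * s * t * bilin P \<omega> x y + t\<^sup>2 * bilin P \<omega> y y"
proof -
  have r: "frow P \<omega> (\<lambda>k. s * x k + t * y k) k = s * frow P \<omega> x k + t * frow P \<omega> y k" for k
    by (simp only: frow_add frow_scale)
  have "bilin P \<omega> (\<lambda>k. s * x k + t * y k) (\<lambda>k. s * x k + t * y k) =
    s\<^sup>2 * bilin P \<omega> x x + s * t * bilin P \<omega> x y + s * t * bilin P \<omega> y x + t\<^sup>2 * bilin P \<omega> y y"
    unfolding bilin_def r sum_distrib_left sum.distrib[symmetric]
    by (intro sum.cong refl) (simp add: algebra_simps power2_eq_square)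
  then show ?thesis by (simp add: bilin_sym[of _ _ y x])
qed

text \<open>A vector \<open>y\<close> with positive value lies off the hyperplane
  \<open>g = 0\<close>, so a multiple of \<open>y\<close> moves any \<open>x\<close> into it;
  completing the square in that multiple gives the inequality.\<close>

lemma lorentzianI:
  fixes g :: "('b \<times> 'b \<Rightarrow> real) \<Rightarrow> real"
  assumes lin: "\<And>s x t y. g (\<lambda>k. s * x k + t * y k) = s * g x + t * g y"
    and neg: "\<And>x. g x = 0 \<Longrightarrow> bilin P \<omega> x x \<le> 0"
  shows "lorentzian P \<omega>"
  unfolding lorentzian_def
proof (intro allI impI)
  fix x y assume y: "0 < bilin P \<omega> y y"
  let ?a = "bilin P \<omega> x x" and ?b = "bilin P \<omega> x y" and ?c = "bilin P \<omega> y y"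
  have gy: "g y \<noteq> 0" using neg[of y] y by auto
  have "g (\<lambda>k. 1 * x k + (- (g x / g y)) * y k) = 0" unfolding lin using gy by simp
  from neg[OF this] have "?a - 2 * (g x / g y) * ?b + (g x / g y)\<^sup>2 * ?c \<le> 0"
    unfolding bilin_combine by simp
  then have 1: "(?a - 2 * (g x / g y) * ?b + (g x / g y)\<^sup>2 * ?c) * ?c \<le> 0" using y by (simp add: mult_nonpos_nonneg)
  have "(?a - 2 * (g x / g y) * ?b + (g x / g y)\<^sup>2 * ?c) * ?c = ?a * ?c - ?b\<^sup>2 + (?b - g x / g y * ?c)\<^sup>2"
    by (simp add: power2_eq_square algebra_simps)
  then show "?a * ?c \<le> ?b\<^sup>2" using 1 zero_le_power2[of "?b - g x / g y * ?c"] by linarith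
qed

text \<open>On each facet the induction hypothesis is applied with the restricted field
  \<open>df a\<close> as positive vector. Its value there is the row \<open>b k\<close>, and the
  pairing with \<open>w\<close> is a row of the form of \<open>P\<close>. The sum of restrictions is
  thus bounded by the squared rows over \<open>b\<close>, as \<open>nonpos_on_complement\<close>
  requires.\<close>

theorem lorentzian_step:
  fixes P :: "'b marked"
  assumes P: "valid P" and \<tau>s: "\<forall>\<tau>\<in>set (\<tau> # \<tau>s). pos_dir \<tau>" and card: "card (elems P) = 7 + length \<tau>s"
    and IH: "\<And>k. k \<in> facets P \<Longrightarrow> lorentzian (contract P k) (wt \<tau>s)"
  shows "lorentzian P (wt (\<tau> # \<tau>s))"
proof -
  let ?\<omega> = "wt (\<tau> # \<tau>s)"
  have s: "supported (wt \<tau>s)" "supported ?\<omega>" by (rule supported_wt)+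
  have pos: "\<forall>s. 0 \<le> wt \<tau>s s" using wt_nonneg \<tau>s by auto
  obtain a where ga: "gaps P a = \<tau>" and "pos_dir \<tau> \<longrightarrow> (\<forall>k\<in>rels P. 0 < df a k)"
    using exists_field[OF P] by metis
  then have a: "0 < df a k" if "k \<in> facets P" for k using \<tau>s facets_rels[OF that] by auto
  have sh: "shift (gaps P a) (wt \<tau>s) = ?\<omega>" by (simp add: ga)
  define b where "b k = frow P ?\<omega> (df a) k" for k
  have bpos: "0 < b k" if k: "k \<in> facets P" for k
  proof -
    have "b k = vol P {k} (wt (\<tau> # \<tau> # \<tau>s))" unfolding b_def using frow_df[OF P k s(2)] ga by simp
    also have "\<dots> > 0" using \<tau>s k card by (intro vol_wt_pos[OF P]) (auto simp: facets_def)
    finally show ?thesis .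
  qed
  show ?thesis
  proof (rule lorentzianI[where g = "\<lambda>x. \<Sum>k\<in>facets P. b k * x k"])
    show "(\<Sum>k\<in>facets P. b k * (s * x k + t * y k)) = s * (\<Sum>k\<in>facets P. b k * x k) + t * (\<Sum>k\<in>facets P. b k * y k)"
      for s x t y by (simp add: sum_distrib_left distrib_left sum.distrib mult_ac)
    fix x assume x: "(\<Sum>k\<in>facets P. b k * x k) = 0"
    have "(\<Sum>k\<in>facets P. x k * (\<Sum>l\<in>facets P. form P ?\<omega> k l * x l)) \<le> 0"
    proof (rule nonpos_on_complement[where v = "df a" and b = b])
      show "finite (facets P)" by (rule finite_facets[OF P])
      show "form P ?\<omega> k l = form P ?\<omega> l k" for k l by (rule form_sym)
      show "0 \<le> form P ?\<omega> k l" if "k \<noteq> l" for k l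
        using that vol_nonneg[of ?\<omega> P "{k, l}"] wt_nonneg[OF \<tau>s] by (simp add: form_def)
      show "(\<Sum>l\<in>facets P. form P ?\<omega> k l * df a l) = b k" for k by (simp add: b_def frow_def)
      show "c k = c l" if h: "\<And>k l. k \<in> facets P \<Longrightarrow> l \<in> facets P \<Longrightarrow> k \<noteq> l \<Longrightarrow> form P ?\<omega> k l \<noteq> 0 \<Longrightarrow> c k = c l"
        and kl: "k \<in> facets P" "l \<in> facets P" for c :: "'b \<times> 'b \<Rightarrow> real" and k l
      proof (rule facets_connected[OF P _ _ kl])
        fix k l assume "k \<in> facets P" "l \<in> facets P" and ne: "k \<noteq> l" and lay: "layer P {k, l} \<noteq> {}"
        moreover have "0 < vol P {k, l} ?\<omega>" using \<tau>s card ne by (intro vol_wt_pos[OF P _ lay]) auto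
        ultimately show "c k = c l" using h[of k l] ne by (simp add: form_def)
      qed (use card in simp)
      show "(\<Sum>k\<in>facets P. w k * (\<Sum>l\<in>facets P. form P ?\<omega> k l * w l)) \<le>
          (\<Sum>k\<in>facets P. df a k * (\<Sum>l\<in>facets P. form P ?\<omega> k l * w l)\<^sup>2 / b k)" for w
      proof -
        have "bilin P ?\<omega> w w \<le> (\<Sum>k\<in>facets P. df a k * bilin (contract P k) (wt \<tau>s) (restr P k w) (restr P k w))"
          using bilin_le_sum_facets[OF P s(1) pos, of a w] a unfolding sh by (simp add: less_imp_le)
        also have "\<dots> \<le> (\<Sum>k\<in>facets P. df a k * (frow P ?\<omega> w k)\<^sup>2 / b k)"
        proof (rule sum_mono)
          fix k assume k: "k \<in> facets P"
          have 1: "bilin (contract P k) (wt \<tau>s) (restr P k y) (restr P k (df a)) = frow P ?\<omega> y k" for y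
            using bilin_restr_df[OF P k s(1), of y a] unfolding sh .
          have "bilin (contract P k) (wt \<tau>s) (restr P k w) (restr P k w) * b k \<le> (frow P ?\<omega> w k)\<^sup>2"
            using IH[OF k] bpos[OF k] unfolding lorentzian_def 1[symmetric] b_def by blast
          then have "bilin (contract P k) (wt \<tau>s) (restr P k w) (restr P k w) \<le> (frow P ?\<omega> w k)\<^sup>2 / b k"
            using bpos[OF k] by (simp add: pos_le_divide_eq)
          then show "df a k * bilin (contract P k) (wt \<tau>s) (restr P k w) (restr P k w) \<le> df a k * (frow P ?\<omega> w k)\<^sup>2 / b k"
            using a[OF k] by (metis mult_left_mono less_imp_le times_divide_eq_right)
        qed
        finally show ?thesis by (simp add: bilin_def frow_def)
      qed
    qed (use a bpos x in auto)
    then show "bilin P ?\<omega> x x \<le> 0" by (simp add: bilin_def frow_def)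
  qed
qed

subsection \<open>Two degrees of freedom\<close>

text \<open>The polytope is a polygon in the position of \<open>u\<close> and the common shift of the rigid set \<open>Bs\<close>.
  Translating \<open>u\<close> alone gives a null vector of the form, and a Picone identity for this null vector
  leaves at most two squares with a positive sign; the translation of \<open>Bs\<close> reduces them to one.\<close>

lemma lorentzian_rigid:
  fixes P :: "'b marked" and Bs Os :: "'b set" and u :: 'b
  defines "Full \<equiv> {L. \<exists>k l. k \<noteq> l \<and> L \<in> layer P {k, l}}"
  assumes P: "valid P" and pos: "\<forall>s. 0 \<le> \<omega> s" and sup: "supported \<omega>"
    and E: "elems P - {u} = Os \<union> Bs" "Os \<inter> Bs = {}" "u \<in> elems P"
    and gu: "gaps P (\<lambda>e. if e = u then 1 else (0::real)) = (0, 0, 0)"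
    and gB: "gaps P (\<lambda>e. if e \<in> Bs then 1 else (0::real)) = (0, 0, 0)"
    and r1: "\<And>L L' x. L \<in> Full \<Longrightarrow> L' \<in> Full \<Longrightarrow> x \<in> Os \<Longrightarrow> L x = L' x"
    and r2: "\<And>L L' x y. L \<in> Full \<Longrightarrow> L' \<in> Full \<Longrightarrow> x \<in> Bs \<Longrightarrow> y \<in> Bs \<Longrightarrow> L x - L y = L' x - L' y"
    and r3: "\<And>L. L \<in> Full \<Longrightarrow> inj_on L Os \<and> inj_on L Bs"
    and r4: "\<And>L x x' y y'. L \<in> Full \<Longrightarrow> x \<in> Os \<Longrightarrow> x' \<in> Os \<Longrightarrow> y \<in> Bs \<Longrightarrow> y' \<in> Bs \<Longrightarrow>
      L x = L y \<Longrightarrow> L x' = L y' \<Longrightarrow> x = x'"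
  shows "lorentzian P \<omega>"
proof -
  let ?F = "facets P" and ?M = "form P \<omega>"
  define p where "p = df (\<lambda>e. if e = u then 1 else (0::real))"
  define \<beta> where "\<beta> = df (\<lambda>e. if e \<in> Bs then 1 else (0::real))"
  define S where "S = {k \<in> ?F. fst k = u \<or> snd k = u}"
  \<comment> \<open>In the plane of the shift and the position of \<open>u\<close>, members of
    \<open>Q\<close> are edges on which the shift is extreme. Members of \<open>Z\<close> meet in
    vertices where \<open>u\<close> is squeezed between \<open>Os\<close> and \<open>Bs\<close>, so
    the shift is extreme there too.\<close>
  define Q where "Q = {k \<in> ?F. fst k \<noteq> u \<and> snd k \<noteq> u \<and> (\<exists>l\<in>?F. l \<noteq> k \<and> layer P {k, l} \<noteq> {})}"
  define Z where "Z = {(k, l). k \<in> ?F \<and> l \<in> ?F \<and> snd k = u \<and> fst l = u \<and> layer P {k, l} \<noteq> {}}"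
  have FullI: "L \<in> Full" if "k \<noteq> l" "L \<in> layer P {k, l}" for k l L
    unfolding Full_def by (rule CollectI, rule exI[of _ k], rule exI[of _ l], rule conjI[OF that])
  have fin: "finite ?F" by (rule finite_facets[OF P])
  have FE: "fst k \<in> elems P" "snd k \<in> elems P" "fst k \<noteq> snd k" "(fst k, snd k) \<in> rels P" if "k \<in> ?F" for k
    using facets_rels[OF that] valid_rels[OF P, of "fst k" "snd k"] by auto
  have row0: "frow P \<omega> p k = 0" "frow P \<omega> \<beta> k = 0" if "k \<in> ?F" for k
    using frow_df[OF P that sup] by (simp_all add: p_def \<beta>_def gu gB shift_zero)
  have Moff: "0 \<le> ?M k l" if "k \<noteq> l" for k l using that vol_nonneg[OF pos] by (simp add: form_def)
  have p_S: "p k = (if snd k = u then 1 else -1)" "(p k)\<^sup>2 = 1" if "k \<in> S" for k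
    using that FE(3)[of k] by (auto simp: S_def p_def df_def)
  have p_nS: "p k = 0" if "k \<in> ?F" "k \<notin> S" for k using that by (auto simp: S_def p_def df_def)
  \<comment> \<open>Two coincidences that bound the shift from the same side happen at the same
    shift, and there \<open>r4\<close> and injectivity identify them.\<close>
  have uniq: "x1 = x2 \<and> y1 = y2" if L: "L1 \<in> Full" "L2 \<in> Full" and x: "x1 \<in> Os" "x2 \<in> Os" and y: "y1 \<in> Bs" "y2 \<in> Bs"
    and e: "L1 x1 = L1 y1" "L2 x2 = L2 y2"
    and o: "L2 x1 \<le> L2 y1 \<and> L1 x2 \<le> L1 y2 \<or> L2 y1 \<le> L2 x1 \<and> L1 y2 \<le> L1 x2" for L1 L2 x1 x2 y1 y2
  proof -
    have "L2 x1 = L1 x1" "L2 x2 = L1 x2" "L1 y1 - L1 y2 = L2 y1 - L2 y2"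
      using r1[OF L(2,1)] r2[OF L] x y by auto
    then have e2: "L1 x2 = L1 y2" using e o by auto
    have x12: "x1 = x2" by (rule r4[OF L(1) x y e(1) e2])
    then have "L1 y1 = L1 y2" using e(1) e2 by simp
    then show ?thesis using x12 r3[OF L(1)] y by (auto dest: inj_onD)
  qed
  have mem: "x \<in> Os \<or> x \<in> Bs" if "x \<in> elems P" "x \<noteq> u" for x using that E(1) by blast
  have cross: "(x \<in> Os \<and> y \<in> Bs) \<or> (x \<in> Bs \<and> y \<in> Os)"
    if "L \<in> Full" "L x = L y" "x \<noteq> y" "x \<in> elems P" "y \<in> elems P" "x \<noteq> u" "y \<noteq> u" for L x y
    using mem[OF that(4,6)] mem[OF that(5,7)] r3[OF that(1)] that(2,3) by (auto dest: inj_onD)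
  have Qw: "\<exists>L\<in>Full. L (fst q) = L (snd q)" if "q \<in> Q" for q
  proof -
    have "\<exists>l\<in>?F. l \<noteq> q \<and> layer P {q, l} \<noteq> {}" using \<open>q \<in> Q\<close> by (simp add: Q_def)
    then obtain l where ne: "q \<noteq> l" and "layer P {q, l} \<noteq> {}" by metis
    then obtain L where L: "L \<in> layer P {q, l}" by blast
    have "L \<in> Full" by (rule FullI[OF ne L])
    then show ?thesis using layer_eq[OF L, of "fst q" "snd q"] by auto
  qed
  have Zw: "\<exists>L\<in>Full. L (fst k) = L (snd l)" if z: "(k, l) \<in> Z" for k l
  proof -
    have ne: "k \<noteq> l" using z FE(3)[of k] by (auto simp: Z_def)
    obtain L where L: "L \<in> layer P {k, l}" using z by (auto simp: Z_def)
    have "L \<in> Full" by (rule FullI[OF ne L])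
    moreover have "L (fst k) = L (snd l)"
      using layer_eq[OF L, of "fst k" "snd k"] layer_eq[OF L, of "fst l" "snd l"] z by (auto simp: Z_def)
    ultimately show ?thesis by auto
  qed
  have Fmono: "L x \<le> L y" if L: "L \<in> Full" and "(x, y) \<in> rels P" for L x y
    using L layer_mono[OF _ that(2)] by (auto simp: Full_def)
  have Zr: "(fst k, u) \<in> rels P" "(u, snd l) \<in> rels P" "fst k \<noteq> u" "snd l \<noteq> u" "fst k \<in> elems P" "snd l \<in> elems P"
    "fst k \<noteq> snd l" if z: "(k, l) \<in> Z" for k l
    using z FE[of k] FE[of l] valid_asym[OF P, of "fst k" u] by (auto simp: Z_def)
  \<comment> \<open>The functionals reading off \<open>w\<close> at one extreme of the shift:
    \<open>Os\<close> below \<open>Bs\<close> is the lower extreme, \<open>Bs\<close> below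
    \<open>Os\<close> the upper one. Each extreme is a single edge or a single squeezed vertex, so
    it has at most one functional.\<close>
  define obj where "obj X Y = {((\<lambda>w. w q) :: (('b \<times> 'b) \<Rightarrow> real) \<Rightarrow> real) | q. q \<in> Q \<and> fst q \<in> X \<and> snd q \<in> Y} \<union>
    {(\<lambda>w. w k + w l) | k l. (k, l) \<in> Z \<and> fst k \<in> X \<and> snd l \<in> Y}" for X Y
  have obj_eq: "f = f'" if f: "f \<in> obj X Y" "f' \<in> obj X Y" and XY: "(X, Y) = (Os, Bs) \<or> (X, Y) = (Bs, Os)" for f f' X Y
  proof -
    define R where "R f x y \<longleftrightarrow> x \<in> X \<and> y \<in> Y \<and> (\<exists>L\<in>Full. L x = L y) \<and> (\<forall>L\<in>Full. L x \<le> L y) \<and>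
      ((\<exists>q\<in>Q. f = (\<lambda>w. w q) \<and> q = (x, y)) \<or>
       (\<exists>k l. (k, l) \<in> Z \<and> f = (\<lambda>w. w k + w l) \<and> k = (x, u) \<and> l = (u, y)))"
      for f :: "(('b \<times> 'b) \<Rightarrow> real) \<Rightarrow> real" and x y
    have R: "\<exists>x y. R f x y" if "f \<in> obj X Y" for f
    proof -
      from that consider q where "f = (\<lambda>w. w q)" "q \<in> Q" "fst q \<in> X" "snd q \<in> Y"
        | k l where "f = (\<lambda>w. w k + w l)" "(k, l) \<in> Z" "fst k \<in> X" "snd l \<in> Y"
        by (auto simp: obj_def)
      then show ?thesis
      proof cases
        case 1
        have "q \<in> ?F" using 1 by (simp add: Q_def)
        then have "R f (fst q) (snd q)" unfolding R_def using 1 Qw[of q] Fmono FE(4) by auto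
        then show ?thesis by blast
      next
        case 2
        have "L (fst k) \<le> L (snd l)" if "L \<in> Full" for L
          using Fmono[OF that Zr(1)[OF 2(2)]] Fmono[OF that Zr(2)[OF 2(2)]] by simp
        moreover have "k = (fst k, u)" "l = (u, snd l)" using 2(2) by (auto simp: Z_def prod_eq_iff)
        ultimately have "R f (fst k) (snd l)" unfolding R_def using 2 Zw[OF 2(2)] by blast
        then show ?thesis by blast
      qed
    qed
    obtain x y where xy: "R f x y" using R f by blast
    obtain x' y' where xy': "R f' x' y'" using R f by blast
    obtain L where L: "L \<in> Full" "L x = L y" using xy unfolding R_def by blast
    obtain L' where L': "L' \<in> Full" "L' x' = L' y'" using xy' unfolding R_def by blast
    have le: "L' x \<le> L' y" "L x' \<le> L y'" using xy xy' L(1) L'(1) unfolding R_def by blast+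
    have XY': "x \<in> X" "y \<in> Y" "x' \<in> X" "y' \<in> Y" using xy xy' unfolding R_def by blast+
    have eq: "x = x' \<and> y = y'"
      using XY
    proof
      assume "(X, Y) = (Os, Bs)"
      then show ?thesis using uniq[OF L(1) L'(1), of x x' y y'] L L' le xy xy' by (auto simp: R_def)
    next
      assume "(X, Y) = (Bs, Os)"
      then show ?thesis using uniq[OF L(1) L'(1), of y y' x x'] L L' le xy xy' by (auto simp: R_def)
    qed
    have noboth: False if "(x, y) \<in> Q" "((x, u), (u, y)) \<in> Z"
      using facet_no_between[OF P, of x y u] that Zr(1,2)[OF that(2)] by (auto simp: Q_def)
    show "f = f'" using xy xy' noboth unfolding R_def eq[THEN conjunct1, symmetric] eq[THEN conjunct2, symmetric] by auto
  qed
  have obj_lin: "f (\<lambda>k. s * w k + t * w' k) = s * f w + t * f w'" if "f \<in> obj X Y" for f X Y s t w w'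
    using that by (auto simp: obj_def algebra_simps)
  have obj_\<beta>: "f \<beta> = (if X = Os then 1 else -1)" if "f \<in> obj X Y" and XY: "(X, Y) = (Os, Bs) \<or> (X, Y) = (Bs, Os)" for f X Y
  proof -
    have 1: "Os \<noteq> Bs \<or> Os = {}" using E(2) by auto
    have uB: "u \<notin> Bs" using E by auto
    show ?thesis using that 1 E(2) uB FE(3) by (auto simp: obj_def \<beta>_def df_def Z_def)
  qed
  \<comment> \<open>An extreme without edge or squeezed vertex imposes no condition, hence the zero
    functional as default.\<close>
  define pick where "pick X Y = (if obj X Y = {} then (\<lambda>_. 0) else SOME f. f \<in> obj X Y)" for X Y
  have pick_in: "pick X Y \<in> obj X Y" if "obj X Y \<noteq> {}" for X Y
    using that some_in_eq[of "obj X Y"] by (simp add: pick_def)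
  have pick_lin: "pick X Y (\<lambda>k. s * w k + t * w' k) = s * pick X Y w + t * pick X Y w'" for X Y s t w w'
    by (cases "obj X Y = {}") (simp add: pick_def, rule obj_lin[OF pick_in])
  define lo where "lo = pick Os Bs"
  define up where "up = pick Bs Os"
  have lo: "lo (\<lambda>k. s * w k + t * w' k) = s * lo w + t * lo w'" "f \<in> obj Os Bs \<Longrightarrow> f = lo" for s t w w' f
    unfolding lo_def using pick_lin obj_eq[OF _ pick_in, of f Os Bs] by auto
  have up: "up (\<lambda>k. s * w k + t * w' k) = s * up w + t * up w'" "f \<in> obj Bs Os \<Longrightarrow> f = up" for s t w w' f
    unfolding up_def using pick_lin obj_eq[OF _ pick_in, of f Bs Os] by auto
  \<comment> \<open>The entries of \<open>p\<close> on \<open>S\<close> are 1 or -1, and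
    \<open>bilin P \<omega> w w\<close> is minus half a sum of squares of \<open>e k - e l\<close>
    weighted by the form and the signs. Meeting facets of opposite sign squeeze \<open>u\<close>,
    and there \<open>e k = e l\<close>.\<close>
  have key: "bilin P \<omega> w w \<le> 0" if w0: "\<And>q. q \<in> Q \<Longrightarrow> w q = 0" and wZ: "\<And>k l. (k, l) \<in> Z \<Longrightarrow> w k + w l = 0" for w
  proof -
    define e where "e k = w k * p k" for k
    have we: "w k = e k * p k" if "k \<in> S" for k
      using p_S(2)[OF that] by (simp add: e_def power2_eq_square mult.assoc)
    have zero: "?M k l * w l * w k = 0" if "k \<in> ?F" "l \<in> ?F" "k \<notin> S" for k l
    proof (cases "k \<in> Q")
      case False
      then have none: "layer P {k, m} = {}" if "m \<in> ?F" "m \<noteq> k" for m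
        using that \<open>k \<in> ?F\<close> \<open>k \<notin> S\<close> by (auto simp: Q_def S_def)
      have v0: "vol P {k, m} \<omega> = 0" if "m \<in> ?F" "m \<noteq> k" for m by (rule vol_empty[OF none[OF that]])
      have "(\<Sum>m\<in>?F - {k}. vol P {k, m} \<omega> * df (offset P k) m) = 0"
      proof (rule sum.neutral, rule ballI)
        fix m assume "m \<in> ?F - {k}"
        then show "vol P {k, m} \<omega> * df (offset P k) m = 0" using v0[of m] by simp
      qed
      then have "?M k l = 0" using v0[OF that(2)] by (auto simp: form_def)
      then show ?thesis by simp
    qed (use w0 in auto)
    have "bilin P \<omega> w w = (\<Sum>k\<in>?F. \<Sum>l\<in>?F. ?M k l * w l * w k)"
      unfolding bilin_def frow_def sum_distrib_left by (intro sum.cong refl) simp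
    also have "\<dots> = (\<Sum>k\<in>S. \<Sum>l\<in>?F. ?M k l * w l * w k)"
    proof (rule sum.mono_neutral_right[OF fin])
      show "\<forall>k\<in>?F - S. (\<Sum>l\<in>?F. ?M k l * w l * w k) = 0"
      proof (intro ballI sum.neutral)
        fix k l assume "k \<in> ?F - S" "l \<in> ?F"
        then show "?M k l * w l * w k = 0" using zero[of k l] by blast
      qed
    qed (simp add: S_def)
    also have "\<dots> = (\<Sum>k\<in>S. \<Sum>l\<in>S. ?M k l * w l * w k)"
    proof (rule sum.cong[OF refl])
      fix k assume "k \<in> S"
      then have "k \<in> ?F" by (simp add: S_def)
      show "(\<Sum>l\<in>?F. ?M k l * w l * w k) = (\<Sum>l\<in>S. ?M k l * w l * w k)"
      proof (rule sum.mono_neutral_right[OF fin])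
        show "\<forall>l\<in>?F - S. ?M k l * w l * w k = 0"
        proof
          fix l assume "l \<in> ?F - S"
          then show "?M k l * w l * w k = 0" using zero[of l k] \<open>k \<in> ?F\<close> by (simp add: form_sym[of _ _ k l] mult_ac)
        qed
      qed (simp add: S_def)
    qed
    finally have 1: "bilin P \<omega> w w = (\<Sum>k\<in>S. \<Sum>l\<in>S. ?M k l * p k * p l * (e k * e l))"
      by (simp add: we mult_ac)
    have Mp: "(\<Sum>l\<in>S. ?M k l * p l) = 0" if "k \<in> S" for k
    proof -
      have "(\<Sum>l\<in>S. ?M k l * p l) = (\<Sum>l\<in>?F. ?M k l * p l)"
        by (rule sum.mono_neutral_left[OF fin]) (use p_nS in \<open>auto simp: S_def\<close>)
      also have "\<dots> = 0" using row0(1)[of k] that by (simp add: S_def frow_def)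
      finally show ?thesis .
    qed
    have z1: "(\<Sum>k\<in>S. \<Sum>l\<in>S. ?M k l * p k * p l * (e k)\<^sup>2) = 0"
    proof (rule sum.neutral, rule ballI)
      fix k assume "k \<in> S"
      have "(\<Sum>l\<in>S. ?M k l * p k * p l * (e k)\<^sup>2) = p k * (e k)\<^sup>2 * (\<Sum>l\<in>S. ?M k l * p l)"
        unfolding sum_distrib_left by (intro sum.cong refl) simp
      then show "(\<Sum>l\<in>S. ?M k l * p k * p l * (e k)\<^sup>2) = 0" using Mp[OF \<open>k \<in> S\<close>] by simp
    qed
    have z2: "(\<Sum>k\<in>S. \<Sum>l\<in>S. ?M k l * p k * p l * (e l)\<^sup>2) = 0"
      using z1 by (subst sum.swap) (simp add: form_sym mult_ac)
    have "(\<Sum>k\<in>S. \<Sum>l\<in>S. ?M k l * p k * p l * (e k - e l)\<^sup>2) =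
        (\<Sum>k\<in>S. \<Sum>l\<in>S. ?M k l * p k * p l * (e k)\<^sup>2) + (\<Sum>k\<in>S. \<Sum>l\<in>S. ?M k l * p k * p l * (e l)\<^sup>2)
        - 2 * (\<Sum>k\<in>S. \<Sum>l\<in>S. ?M k l * p k * p l * (e k * e l))"
      unfolding sum_distrib_left sum.distrib[symmetric] sum_subtractf[symmetric]
      by (intro sum.cong refl) (simp add: power2_eq_square algebra_simps)
    then have "(\<Sum>k\<in>S. \<Sum>l\<in>S. ?M k l * p k * p l * (e k - e l)\<^sup>2) = - 2 * bilin P \<omega> w w"
      unfolding z1 z2 1 by simp
    moreover have "0 \<le> (\<Sum>k\<in>S. \<Sum>l\<in>S. ?M k l * p k * p l * (e k - e l)\<^sup>2)"
    proof (intro sum_nonneg)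
      fix k l assume k: "k \<in> S" and l: "l \<in> S"
      have kF: "k \<in> ?F" "l \<in> ?F" using k l by (auto simp: S_def)
      have Z: "e k = e l" if kl: "k \<in> S" "l \<in> S" "snd k = u" "snd l \<noteq> u" "layer P {k, l} \<noteq> {}" for k l
      proof -
        have "(k, l) \<in> Z" using kl by (auto simp: Z_def S_def)
        then show ?thesis using wZ[of k l] p_S(1)[OF kl(1)] p_S(1)[OF kl(2)] kl by (simp add: e_def)
      qed
      show "0 \<le> ?M k l * p k * p l * (e k - e l)\<^sup>2"
      proof (cases "p k = p l \<or> k = l \<or> layer P {k, l} = {}")
        case True
        then consider "k = l" | "k \<noteq> l" "layer P {k, l} = {}" | "k \<noteq> l" "p k = p l" by blast
        then show ?thesis
        proof cases
          case 2
          then show ?thesis by (simp add: form_def vol_empty)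
        next
          case 3
          have eq: "?M k l * p k * p l * (e k - e l)\<^sup>2 = ?M k l * ((p l)\<^sup>2 * (e k - e l)\<^sup>2)"
            unfolding 3(2) power2_eq_square by (simp only: mult_ac)
          show ?thesis unfolding eq by (intro mult_nonneg_nonneg Moff[OF 3(1)] zero_le_power2)
        qed simp
      next
        case False
        then have ne: "layer P {k, l} \<noteq> {}" "layer P {l, k} \<noteq> {}" by (simp_all add: insert_commute)
        have "snd k = u \<and> snd l \<noteq> u \<or> snd k \<noteq> u \<and> snd l = u"
          using False p_S(1)[OF k] p_S(1)[OF l] by (auto split: if_splits)
        then have "e k = e l" using Z[OF k l] Z[OF l k] ne by auto
        then show ?thesis by simp
      qed
    qed
    ultimately show ?thesis by simp
  qed
  show ?thesis
  proof (rule lorentzianI[where g = "\<lambda>w. lo w + up w"])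
    show "lo (\<lambda>k. s * w k + t * w' k) + up (\<lambda>k. s * w k + t * w' k) = s * (lo w + up w) + t * (lo w' + up w')"
      for s t w w' unfolding lo(1) up(1) by (simp add: algebra_simps)
    fix w assume g: "lo w + up w = 0"
    \<comment> \<open>Subtracting a multiple of the null vector \<open>\<beta>\<close> keeps the
      value of the form and moves \<open>lo\<close> and \<open>up\<close> in opposite directions, so
      under \<open>g\<close> one multiple makes both vanish.\<close>
    define w' where "w' = (\<lambda>k. 1 * w k + (- lo w) * \<beta> k)"
    have "bilin P \<omega> x \<beta> = 0" for x unfolding bilin_def using row0(2) by simp
    then have "bilin P \<omega> w' w' = bilin P \<omega> w w" unfolding w'_def bilin_combine by simp
    moreover have "bilin P \<omega> w' w' \<le> 0"
    proof (rule key)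
      have lo0: "f w' = 0" if f: "f \<in> obj Os Bs" for f
      proof -
        have "f = lo" by (rule lo(2)[OF f])
        moreover have "f \<beta> = 1" using obj_\<beta>[OF f] by simp
        ultimately show ?thesis unfolding w'_def by (simp only: lo(1))
      qed
      have up0: "f w' = 0" if f: "f \<in> obj Bs Os" for f
      proof -
        have fu: "f = up" by (rule up(2)[OF f])
        have "Bs \<noteq> {} \<and> Os \<noteq> {}" using f by (auto simp: obj_def)
        then have "Bs \<noteq> Os" using E(2) by auto
        then have "f \<beta> = -1" using obj_\<beta>[OF f] by simp
        then show ?thesis using g unfolding w'_def fu by (simp only: up(1))
      qed
      show "w' q = 0" if q: "q \<in> Q" for q
      proof -
        obtain L where L: "L \<in> Full" "L (fst q) = L (snd q)" using Qw[OF q] by blast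
        have qF: "q \<in> ?F" "fst q \<noteq> u" "snd q \<noteq> u" using q by (auto simp: Q_def)
        from cross[OF L FE(3)[OF qF(1)] FE(1,2)[OF qF(1)] qF(2,3)]
        have "(\<lambda>w. w q) \<in> obj Os Bs \<or> (\<lambda>w. w q) \<in> obj Bs Os" using q unfolding obj_def by blast
        then show ?thesis using lo0 up0 by blast
      qed
      show "w' k + w' l = 0" if z: "(k, l) \<in> Z" for k l
      proof -
        obtain L where L: "L \<in> Full" "L (fst k) = L (snd l)" using Zw[OF z] by blast
        from cross[OF L Zr(7)[OF z] Zr(5,6)[OF z] Zr(3,4)[OF z]]
        have "(\<lambda>w. w k + w l) \<in> obj Os Bs \<or> (\<lambda>w. w k + w l) \<in> obj Bs Os" using z unfolding obj_def by blast
        then show ?thesis using lo0 up0 by blast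
      qed
    qed
    ultimately show "bilin P \<omega> w w \<le> 0" by simp
  qed
qed


text \<open>Two identifications among six elements leave four levels, so at every vertex all gaps
  equal 1 and only the level of mark 1 is open. With five distinct marks, the middle three shift
  rigidly past bottom and top. With four, all marks are fixed and one of the two unmarked elements
  is the rigid set.\<close>

theorem lorentzian_base:
  fixes P :: "'b marked"
  assumes P: "valid P" and card: "card (elems P) = 6"
  shows "lorentzian P (wt [])"
proof -
  let ?c = "mark P"
  define Full where "Full = {L. \<exists>k l. k \<noteq> l \<and> L \<in> layer P {k, l}}"
  define Mk where "Mk = ?c ` {..4}"
  have Mk5: "Mk = {?c 0, ?c 1, ?c 2, ?c 3, ?c 4}"
  proof -
    have "{..4::nat} = {0, 1, 2, 3, 4}" by auto
    then show ?thesis by (simp add: Mk_def)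
  qed
  have fin: "finite (elems P)" using valid_finite[OF P] .
  have MkE: "Mk \<subseteq> elems P" using valid_mark[OF P] by (auto simp: Mk_def)
  have Full: "L (?c 0) = 0" "L (?c 4) = 3" "L (?c 2) = L (?c 1) + 1" "L (?c 3) = L (?c 1) + 2"
    "L (?c 1) = 0 \<or> L (?c 1) = 1" if LF: "L \<in> Full" for L
  proof -
    obtain k l where kl: "k \<noteq> l" and L: "L \<in> layer P {k, l}" using LF unfolding Full_def by blast
    show 0: "L (?c 0) = 0" by (rule layer_bot[OF P L])
    show 4: "L (?c 4) = 3" using layer_top[OF P L] kl card by simp
    obtain s1 s2 s3 where g: "gaps P L = (s1, s2, s3)" by (metis prod_cases3)
    have "s1 + s2 + s3 = 3" using sum_gaps_layer[OF P L g] kl card by simp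
    moreover have "1 \<le> s1" "1 \<le> s2" "1 \<le> s3" using layer_positive[OF L] g by (auto simp: pos_gaps_def)
    ultimately have "s1 = 1" "s2 = 1" "s3 = 1" by auto
    then show 23: "L (?c 2) = L (?c 1) + 1" "L (?c 3) = L (?c 1) + 2" using g by (auto simp: gaps_def)
    have "L (?c 0) \<le> L (?c 1)" "L (?c 3) \<le> L (?c 4)" by (rule mark_chain[OF P layer_mono[OF L]], simp_all)+
    then show "L (?c 1) = 0 \<or> L (?c 1) = 1" using 0 4 23 by auto
  qed
  obtain C where C: "C \<in> layer P {}" using valid_nonempty[OF P] by auto
  have C_marks: "C (?c 1) < C (?c 2)" "C (?c 2) < C (?c 3)" "C (?c 0) \<le> C (?c 1)" "C (?c 3) \<le> C (?c 4)"
    "C (?c 0) < C (?c 1) \<or> C (?c 3) < C (?c 4)"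
  proof -
    have "pos_gaps (gaps P C) \<longleftrightarrow> C (?c 1) < C (?c 2) \<and> C (?c 2) < C (?c 3) \<and>
      (C (?c 0) < C (?c 1) \<or> C (?c 3) < C (?c 4))"
      using P layer_mono[OF C] by (rule pos_gaps_iff)
    then show "C (?c 1) < C (?c 2)" "C (?c 2) < C (?c 3)" "C (?c 0) < C (?c 1) \<or> C (?c 3) < C (?c 4)"
      using layer_positive[OF C] by auto
    show "C (?c 0) \<le> C (?c 1)" "C (?c 3) \<le> C (?c 4)" by (rule mark_chain[OF P layer_mono[OF C]], simp_all)+
  qed
  have d: "?c 1 \<noteq> ?c 2" "?c 2 \<noteq> ?c 3" "?c 1 \<noteq> ?c 3" "?c 0 \<noteq> ?c 2" "?c 0 \<noteq> ?c 3" "?c 1 \<noteq> ?c 4" "?c 2 \<noteq> ?c 4"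
    "?c 0 \<noteq> ?c 4" "?c 0 \<noteq> ?c 1 \<or> ?c 3 \<noteq> ?c 4"
    using C_marks by auto
  have gfree: "gaps P (\<lambda>e. if e = u then 1 else (0::real)) = (0, 0, 0)" if "u \<notin> Mk" for u
    using that unfolding Mk5 by (auto simp: gaps_def)
  show ?thesis
  proof (cases "?c 0 \<noteq> ?c 1 \<and> ?c 3 \<noteq> ?c 4")
    case True
    then have c5: "card Mk = 5" unfolding Mk5 using d by simp
    then have "card (elems P - Mk) = 1" using card MkE fin by (simp add: card_Diff_subset finite_subset)
    then obtain u where u: "elems P - Mk = {u}" by (auto simp: card_1_singleton_iff)
    let ?Bs = "{?c 1, ?c 2, ?c 3}" and ?Os = "{?c 0, ?c 4}"
    show ?thesis
    proof (rule lorentzian_rigid[OF P _ supported_wt, where u = u and Bs = ?Bs and Os = ?Os, folded Full_def])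
      show "\<forall>s. 0 \<le> wt [] s" by simp
      have "u \<notin> Mk" "u \<in> elems P" using u by auto
      then show "elems P - {u} = ?Os \<union> ?Bs" using u MkE unfolding Mk5 by auto
      show "gaps P (\<lambda>e. if e \<in> ?Bs then 1 else (0::real)) = (0, 0, 0)" using d True by (auto simp: gaps_def)
      show "L x = L' x" if "L \<in> Full" "L' \<in> Full" "x \<in> ?Os" for L L' x
        using that(3) Full[OF that(1)] Full[OF that(2)] by auto
      show "L x - L y = L' x - L' y" if "L \<in> Full" "L' \<in> Full" "x \<in> ?Bs" "y \<in> ?Bs" for L L' x y
        using that(3,4) Full[OF that(1)] Full[OF that(2)] by auto
      show "inj_on L ?Os \<and> inj_on L ?Bs" if "L \<in> Full" for L
        using Full[OF that] by auto
      show "x = x'" if "L \<in> Full" "x \<in> ?Os" "x' \<in> ?Os" "y \<in> ?Bs" "y' \<in> ?Bs" "L x = L y" "L x' = L y'" for L x x' y y'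
        using that(2-) Full[OF that(1)] by auto
    qed (use u d True gfree in \<open>auto simp: Mk5\<close>)
  next
    case False
    then have c4: "card Mk = 4" unfolding Mk5 using d by (auto simp: insert_absorb card_insert_if)
    then have "card (elems P - Mk) = 2" using card MkE fin by (simp add: card_Diff_subset finite_subset)
    then obtain u v where uv: "elems P - Mk = {u, v}" "u \<noteq> v" by (auto simp: card_2_iff)
    have uvM: "u \<notin> Mk" "v \<notin> Mk" "u \<in> elems P" "v \<in> elems P" using uv by blast+
    show ?thesis
    proof (rule lorentzian_rigid[OF P _ supported_wt, where u = u and Bs = "{v}" and Os = Mk, folded Full_def])
      show "\<forall>s. 0 \<le> wt [] s" by simp
      show "elems P - {u} = Mk \<union> {v}" using uv uvM MkE by auto
      show "gaps P (\<lambda>e. if e \<in> {v} then 1 else (0::real)) = (0, 0, 0)" using gfree[OF uvM(2)] by simp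
      have c1: "L (?c 1) = (if ?c 0 = ?c 1 then 0 else 1)" if "L \<in> Full" for L
        using Full[OF that] False by auto
      show "L x = L' x" if "L \<in> Full" "L' \<in> Full" "x \<in> Mk" for L L' x
        using that(3) Full[OF that(1)] Full[OF that(2)] c1[OF that(1)] c1[OF that(2)] by (auto simp: Mk5)
      have injM: "inj_on L Mk" if "L \<in> Full" for L
        using Full[OF that] c1[OF that] False d unfolding Mk5 by (auto split: if_splits)
      show "inj_on L Mk \<and> inj_on L {v}" if "L \<in> Full" for L using injM[OF that] by simp
      show "x = x'" if "L \<in> Full" "x \<in> Mk" "x' \<in> Mk" "y \<in> {v}" "y' \<in> {v}" "L x = L y" "L x' = L y'" for L x x' y y'
        using inj_onD[OF injM[OF that(1)], of x x'] that by simp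
    qed (use uvM gfree in auto)
  qed
qed

theorem lorentzian_wt:
  assumes "valid P" "\<forall>\<tau>\<in>set \<tau>s. pos_dir \<tau>" "card (elems P) = 6 + length \<tau>s"
  shows "lorentzian P (wt \<tau>s)"
  using assms
proof (induction \<tau>s arbitrary: P)
  case Nil
  then show ?case by (intro lorentzian_base) auto
next
  case (Cons \<tau> \<tau>s)
  show ?case
  proof (rule lorentzian_step)
    fix k assume k: "k \<in> facets P"
    show "lorentzian (contract P k) (wt \<tau>s)"
      using Cons.prems card_elems_contract[OF Cons.prems(1) facets_rels[OF k]]
      by (intro Cons.IH valid_contract[OF Cons.prems(1) k]) auto
  qed (use Cons.prems in auto)
qed

section \<open>From positive directions to unit directions\<close>

lemma lorentzian_vol:
  assumes P: "valid P" and \<tau>s: "\<forall>\<tau>\<in>set \<tau>s. pos_dir \<tau>" and c: "card (elems P) = 6 + length \<tau>s"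
    and pos: "0 < vol P {} (shift \<upsilon> (shift \<upsilon> (wt \<tau>s)))"
  shows "vol P {} (shift \<sigma> (shift \<sigma> (wt \<tau>s))) * vol P {} (shift \<upsilon> (shift \<upsilon> (wt \<tau>s)))
    \<le> (vol P {} (shift \<sigma> (shift \<upsilon> (wt \<tau>s))))\<^sup>2"
proof -
  obtain a where a: "gaps P a = \<sigma>" using exists_field[OF P] by metis
  obtain b where b: "gaps P b = \<upsilon>" using exists_field[OF P] by metis
  have "lorentzian P (wt \<tau>s)" using P \<tau>s c by (rule lorentzian_wt)
  then show ?thesis
    using pos unfolding lorentzian_def a[symmetric] b[symmetric]
    unfolding bilin_df[OF P supported_wt, symmetric] by blast
qed

lemma continuous_wt: "continuous_on UNIV (\<lambda>\<epsilon>::real. wt (map (\<lambda>e. e + (\<epsilon>, \<epsilon>, \<epsilon>)) es) s)"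
  by (induction es arbitrary: s) (auto simp: shift_def split_beta intro!: continuous_intros)

text \<open>Unit directions have zero entries and are not covered by the induction. They are
  approached by adding \<open>\<epsilon>\<close> to every entry; the strict inequality in the
  hypothesis persists for small \<open>\<epsilon>\<close>.\<close>

lemma lorentzian_vol_limit:
  assumes P: "valid P" and es: "set es \<subseteq> {(1, 0, 0), (0, 1, 0), (0, 0, 1)}"
    and c: "card (elems P) = 6 + length es"
    and pos: "0 < vol P {} (shift \<upsilon> (shift \<upsilon> (wt es)))"
  shows "vol P {} (shift \<sigma> (shift \<sigma> (wt es))) * vol P {} (shift \<upsilon> (shift \<upsilon> (wt es)))
    \<le> (vol P {} (shift \<sigma> (shift \<upsilon> (wt es))))\<^sup>2"
proof -
  define V where "V \<rho> \<rho>' \<epsilon> = vol P {} (shift \<rho> (shift \<rho>' (wt (map (\<lambda>e. e + (\<epsilon>, \<epsilon>, \<epsilon>)) es))))"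
    for \<rho> \<rho>' and \<epsilon> :: real
  have "continuous_on UNIV (V \<rho> \<rho>')" for \<rho> \<rho>'
    unfolding V_def vol_def shift_def split_beta
    by (intro continuous_intros continuous_wt)
  then have "(V \<rho> \<rho>' \<longlongrightarrow> V \<rho> \<rho>' 0) (at 0)" for \<rho> \<rho>'
    by (simp add: continuous_on_def)
  then have lim: "(V \<rho> \<rho>' \<longlongrightarrow> V \<rho> \<rho>' 0) (at_right 0)" for \<rho> \<rho>'
    by (rule tendsto_within_subset) simp
  have V0: "V \<rho> \<rho>' 0 = vol P {} (shift \<rho> (shift \<rho>' (wt es)))" for \<rho> \<rho>'
  proof -
    have "map (\<lambda>e. e + (0, 0, 0)) es = es" by (simp add: zero_prod_def[symmetric])
    then show ?thesis by (simp add: V_def)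
  qed
  have "\<forall>\<^sub>F \<epsilon> in at_right 0. 0 < V \<upsilon> \<upsilon> \<epsilon>"
    using lim pos unfolding V0[symmetric] by (rule order_tendstoD)
  moreover have "\<forall>\<^sub>F \<epsilon> in at_right 0. (0::real) < \<epsilon>" by (rule eventually_at_right_less)
  ultimately have "\<forall>\<^sub>F \<epsilon> in at_right 0. V \<sigma> \<sigma> \<epsilon> * V \<upsilon> \<upsilon> \<epsilon> \<le> (V \<sigma> \<upsilon> \<epsilon>)\<^sup>2"
  proof eventually_elim
    case (elim \<epsilon>)
    have "\<forall>\<tau>\<in>set (map (\<lambda>e. e + (\<epsilon>, \<epsilon>, \<epsilon>)) es). pos_dir \<tau>"
      using es elim(2) by (auto simp: pos_dir_def dest!: subsetD)
    then show ?case using lorentzian_vol[OF P _ _ elim(1)[unfolded V_def]] c unfolding V_def by simp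
  qed
  then have "V \<sigma> \<sigma> 0 * V \<upsilon> \<upsilon> 0 \<le> (V \<sigma> \<upsilon> 0)\<^sup>2"
    using tendsto_le[OF trivial_limit_at_right_real tendsto_power[OF lim] tendsto_mult[OF lim lim]] by blast
  then show ?thesis unfolding V0 .
qed

lemma shift_unit:
  "shift (1, 0, 0) \<omega> = (\<lambda>(a, b, c). \<omega> (a - 1, b, c))"
  "shift (0, 1, 0) \<omega> = (\<lambda>(a, b, c). \<omega> (a, b - 1, c))"
  "shift (0, 0, 1) \<omega> = (\<lambda>(a, b, c). \<omega> (a, b, c - 1))"
  by (simp_all add: shift_def)

text \<open>A product of unit directions is a monomial, so its weight singles out one gap
  triple.\<close>

lemma wt_unit:
  "wt (replicate i (1, 0, 0) @ replicate j (0, 1, 0) @ replicate m (0, 0, 1)) =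
    (\<lambda>s. if s = (1 + int i, 1 + int j, 1 + int m) then 1 else 0)"
proof (induction i)
  case 0
  show ?case
  proof (induction j)
    case 0
    show ?case by (induction m) (auto simp: shift_unit fun_eq_iff)
  next
    case (Suc j)
    then show ?case by (auto simp: shift_unit fun_eq_iff)
  qed
next
  case (Suc i)
  then show ?case by (auto simp: shift_unit fun_eq_iff)
qed

section \<open>Log-concavity of the counts\<close>

definition gap_count :: "'b marked \<Rightarrow> int \<times> int \<times> int \<Rightarrow> nat" where
  "gap_count P s = card {L \<in> layer P {}. gaps P L = s}"

lemma vol_indicator:
  assumes "valid P" shows "vol P {} (\<lambda>s. if s = t then 1 else 0) = real (gap_count P t)"
  unfolding vol_def gap_count_def using finite_layer[OF assms] by (simp add: sum.If_cases Int_def)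

text \<open>All but two directions are unit vectors spelling the monomial of
  \<open>(a, b, c)\<close>; the three choices of two unit vectors for the remaining slots give the
  three inequalities.\<close>

lemma gap_count_log_concave:
  assumes P: "valid P" and pos: "1 \<le> a" "1 \<le> b" "1 \<le> c" and sum: "a + b + c = int (card (elems P)) - 3"
  shows "gap_count P (a + 2, b, c) * gap_count P (a, b, c + 2) \<le> (gap_count P (a + 1, b, c + 1))\<^sup>2"
    and "gap_count P (a, b + 2, c) * gap_count P (a, b, c + 2) \<le> (gap_count P (a, b + 1, c + 1))\<^sup>2"
    and "gap_count P (a + 2, b, c) * gap_count P (a, b + 2, c) \<le> (gap_count P (a + 1, b + 1, c))\<^sup>2"
proof -
  define es :: "(real \<times> real \<times> real) list" where "es = replicate (nat (a - 1)) (1, 0, 0) @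
    replicate (nat (b - 1)) (0, 1, 0) @ replicate (nat (c - 1)) (0, 0, 1)"
  have wt: "wt es = (\<lambda>s. if s = (a, b, c) then 1 else 0)"
    unfolding es_def wt_unit using pos by simp
  have es: "set es \<subseteq> {(1, 0, 0), (0, 1, 0), (0, 0, 1)}" by (auto simp: es_def)
  have len: "card (elems P) = 6 + length es" using pos sum by (simp add: es_def)
  have unit:
    "shift (1, 0, 0) (\<lambda>s. if s = (i, j, m) then 1 else 0) = (\<lambda>s. if s = (i + 1, j, m) then 1 else 0)"
    "shift (0, 1, 0) (\<lambda>s. if s = (i, j, m) then 1 else 0) = (\<lambda>s. if s = (i, j + 1, m) then 1 else 0)"
    "shift (0, 0, 1) (\<lambda>s. if s = (i, j, m) then 1 else 0) = (\<lambda>s. if s = (i, j, m + 1) then 1 else 0)"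
    for i j m by (auto simp: shift_unit fun_eq_iff)
  have main: "n1 * n2 \<le> n3\<^sup>2"
    if "vol P {} (shift \<sigma> (shift \<sigma> (wt es))) = real n1" "vol P {} (shift \<upsilon> (shift \<upsilon> (wt es))) = real n2"
      "vol P {} (shift \<sigma> (shift \<upsilon> (wt es))) = real n3" for \<sigma> \<upsilon> n1 n2 n3
  \<comment> \<open>The reversed Cauchy-Schwarz inequality needs a positive second count; otherwise
    the left-hand side is zero.\<close>
  proof (cases "n2 = 0")
    case False
    then have "real n1 * real n2 \<le> (real n3)\<^sup>2"
      using lorentzian_vol_limit[OF P es len, of \<upsilon> \<sigma>] unfolding that by simp
    then show ?thesis by (metis of_nat_le_iff of_nat_mult of_nat_power)
  qed simp
  show "gap_count P (a + 2, b, c) * gap_count P (a, b, c + 2) \<le> (gap_count P (a + 1, b, c + 1))\<^sup>2"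
    by (rule main[of "(1, 0, 0)" _ "(0, 0, 1)"]) (simp_all add: wt unit vol_indicator[OF P] add.assoc)
  show "gap_count P (a, b + 2, c) * gap_count P (a, b, c + 2) \<le> (gap_count P (a, b + 1, c + 1))\<^sup>2"
    by (rule main[of "(0, 1, 0)" _ "(0, 0, 1)"]) (simp_all add: wt unit vol_indicator[OF P] add.assoc)
  show "gap_count P (a + 2, b, c) * gap_count P (a, b + 2, c) \<le> (gap_count P (a + 1, b + 1, c))\<^sup>2"
    by (rule main[of "(1, 0, 0)" _ "(0, 1, 0)"]) (simp_all add: wt unit vol_indicator[OF P] add.assoc)
qed

text \<open>Only positive gaps are counted, so \<open>(x, y)\<close> and \<open>(y, z)\<close> may
  be imposed as relations; if the order contradicts them, there is no layer and the counts are zero.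
  \<open>Inr False\<close> is the bottom and \<open>Inr True\<close> the top.\<close>

definition bounded_poset :: "'a set \<Rightarrow> ('a \<Rightarrow> 'a \<Rightarrow> bool) \<Rightarrow> 'a \<Rightarrow> 'a \<Rightarrow> 'a \<Rightarrow> ('a + bool) marked" where
  "bounded_poset X lt x y z =
    \<lparr>elems = Inl ` X \<union> {Inr False, Inr True},
     rels = {(Inl u, Inl v) |u v. u \<in> X \<and> v \<in> X \<and> (lt u v \<or> (u, v) = (x, y) \<or> (u, v) = (y, z))} \<union>
       {Inr False} \<times> insert (Inr True) (Inl ` X) \<union> insert (Inr False) (Inl ` X) \<times> {Inr True},
     mark = (\<lambda>i. if i = 0 then Inr False else if i = 1 then Inl x else if i = 2 then Inl y
       else if i = 3 then Inl z else Inr True)\<rparr>"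

lemma bounded_poset_simps [simp]:
  "elems (bounded_poset X lt x y z) = Inl ` X \<union> {Inr False, Inr True}"
  "gaps (bounded_poset X lt x y z) f =
    (f (Inl y) - f (Inl x), f (Inl z) - f (Inl y), f (Inl x) - f (Inr False) + (f (Inr True) - f (Inl z)))"
  by (simp_all add: bounded_poset_def gaps_def)

lemma card_bounded_poset: "finite X \<Longrightarrow> card (elems (bounded_poset X lt x y z)) = card X + 2"
  by (simp add: card_insert_if image_iff card_image)

lemma valid_bounded_poset:
  assumes "finite X" "strict_poset_on X lt" "x \<in> X" "y \<in> X" "z \<in> X" "x \<noteq> y" "y \<noteq> z"
    "layer (bounded_poset X lt x y z) {} \<noteq> {}"
  shows "valid (bounded_poset X lt x y z)"
  unfolding valid_def
proof (intro conjI)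
  let ?P = "bounded_poset X lt x y z"
  show "layer ?P {} \<noteq> {}" by fact
  show "irrefl (rels ?P)"
  proof (rule irreflI)
    have "\<not> lt u u" if "u \<in> X" for u using assms(2) that by (simp add: strict_poset_on_def irreflp_on_def)
    then show "(e, e) \<notin> rels ?P" for e using assms(6,7) by (cases e) (auto simp: bounded_poset_def)
  qed
  show "rels ?P \<subseteq> elems ?P \<times> elems ?P" by (auto simp: bounded_poset_def)
  show "\<forall>e\<in>elems ?P. e \<noteq> mark ?P 0 \<longrightarrow> (mark ?P 0, e) \<in> rels ?P"
    by (auto simp: bounded_poset_def)
  show "\<forall>e\<in>elems ?P. e \<noteq> mark ?P 4 \<longrightarrow> (e, mark ?P 4) \<in> rels ?P"
    by (auto simp: bounded_poset_def)
  show "\<forall>i. mark ?P i \<in> elems ?P" using assms(3-5) by (simp add: bounded_poset_def)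
qed (use assms(1,3-5) in \<open>simp_all add: bounded_poset_def\<close>)

text \<open>Linear extensions of \<open>X\<close> start at 1, so bottom gets 0 and top
  \<open>card X + 1\<close>. The third gap is what \<open>a\<close> and \<open>b\<close> leave of
  this height, and it is positive since \<open>x\<close> and \<open>z\<close> lie strictly
  inside.\<close>

lemma gap_count_bounded_poset:
  assumes fin: "finite X" and po: "strict_poset_on X lt" and xyz: "x \<in> X" "y \<in> X" "z \<in> X"
    and ne: "x \<noteq> y" "y \<noteq> z" and ab: "1 \<le> a" "1 \<le> b"
  shows "gap_count (bounded_poset X lt x y z) (a, b, int (card X) + 1 - a - b) = F X lt x y z a b"
proof -
  let ?P = "bounded_poset X lt x y z" and ?n = "int (card X)"
  let ?S = "{L \<in> layer ?P {}. gaps ?P L = (a, b, ?n + 1 - a - b)}"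
  let ?T = "{M \<in> linear_extensions X lt. int (M y) - int (M x) = a \<and> int (M z) - int (M y) = b}"
  let ?f = "\<lambda>L. \<lambda>u\<in>X. nat (L (Inl u))"
  let ?g = "\<lambda>M. \<lambda>e\<in>elems ?P. case e of Inl u \<Rightarrow> int (M u) | Inr t \<Rightarrow> if t then ?n + 1 else 0"
  note card = card_bounded_poset[OF fin, of lt x y z]
  have Pm: "mark ?P 0 = Inr False" "mark ?P 4 = Inr True" by (simp_all add: bounded_poset_def)
  have E: "Inl u \<in> elems ?P \<longleftrightarrow> u \<in> X" "Inr t \<in> elems ?P" for u t by auto
  have lay: "L (Inr False) = 0" "L (Inr True) = ?n + 1" "inj_on L (elems ?P)"
      "\<And>p q. (p, q) \<in> rels ?P \<Longrightarrow> L p < L q"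
    if L: "L \<in> layer ?P {}" for L
  proof -
    have V: "valid ?P" using fin po xyz ne L by (intro valid_bounded_poset) auto
    show "L (Inr False) = 0" using layer_bot[OF V L] by (simp add: Pm)
    show "L (Inr True) = ?n + 1" using layer_top[OF V L] by (simp only: Pm card) simp
    show "inj_on L (elems ?P)" by (rule layer_empty_inj[OF V L])
    show "L p < L q" if "(p, q) \<in> rels ?P" for p q by (rule layer_empty_less[OF V L that])
  qed
  have rng: "0 < L (Inl u)" "L (Inl u) < ?n + 1" if L: "L \<in> layer ?P {}" and u: "u \<in> X" for L u
  proof -
    have "(Inr False, Inl u) \<in> rels ?P" "(Inl u, Inr True) \<in> rels ?P"
      using u by (simp_all add: bounded_poset_def)
    then show "0 < L (Inl u)" "L (Inl u) < ?n + 1" using lay(4)[OF L] lay(1,2)[OF L] by fastforce+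
  qed
  have "bij_betw ?f ?S ?T"
  proof (rule bij_betw_byWitness[where f' = ?g])
    show "\<forall>L\<in>?S. ?g (?f L) = L"
    proof
      fix L assume "L \<in> ?S"
      then have L: "L \<in> layer ?P {}" by simp
      show "?g (?f L) = L"
      proof
        fix e :: "'a + bool"
        consider u where "e = Inl u" "u \<in> X" | "e = Inr True" | "e = Inr False" | "e \<notin> elems ?P"
          unfolding bounded_poset_simps by (cases e; auto)
        then show "?g (?f L) e = L e"
        proof cases
          case 1
          then show ?thesis using rng(1)[OF L 1(2)] by simp
        next
          case 4
          then show ?thesis using layer_ext[OF L] by (simp add: extensional_def)
        qed (simp_all add: lay(1,2)[OF L])
      qed
    qed
    show "\<forall>M\<in>?T. ?f (?g M) = M"
      by (auto simp: fun_eq_iff linear_extensions_def extensional_def)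
    show "?f ` ?S \<subseteq> ?T"
    proof (rule image_subsetI)
      fix L assume "L \<in> ?S"
      then have L: "L \<in> layer ?P {}" and g: "L (Inl y) - L (Inl x) = a" "L (Inl z) - L (Inl y) = b"
        by simp_all
      have inj: "inj_on (?f L) X"
      proof (rule inj_onI)
        fix u v assume uv: "u \<in> X" "v \<in> X" and "?f L u = ?f L v"
        then have "nat (L (Inl u)) = nat (L (Inl v))" by simp
        then have "L (Inl u) = L (Inl v)" using rng(1)[OF L uv(1)] rng(1)[OF L uv(2)] by linarith
        then have "Inl u = (Inl v :: 'a + bool)" 
          using inj_onD[OF lay(3)[OF L], of "Inl u" "Inl v"] uv E(1) by blast
        then show "u = v" by simp
      qed
      have "?f L ` X \<subseteq> {1..card X}" using rng[OF L] by force
      then have "?f L ` X = {1..card X}"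
        using card_image[OF inj] by (intro card_subset_eq) auto
      moreover have "?f L u < ?f L v" if "u \<in> X" "v \<in> X" "lt u v" for u v
      proof -
        have "(Inl u, Inl v) \<in> rels ?P" using that by (simp add: bounded_poset_def)
        then show ?thesis using lay(4)[OF L] rng(1)[OF L that(1)] rng(1)[OF L that(2)] that by simp
      qed
      ultimately have "?f L \<in> linear_extensions X lt"
        using inj unfolding linear_extensions_def bij_betw_def by simp
      then show "?f L \<in> ?T" using g rng(1)[OF L xyz(1)] rng(1)[OF L xyz(2)] rng(1)[OF L xyz(3)] xyz by simp
    qed
    show "?g ` ?T \<subseteq> ?S"
    proof (rule image_subsetI)
      fix M assume "M \<in> ?T"
      then have M: "bij_betw M X {1..card X}" "\<And>u v. u \<in> X \<Longrightarrow> v \<in> X \<Longrightarrow> lt u v \<Longrightarrow> M u < M v"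
        and g: "int (M y) - int (M x) = a" "int (M z) - int (M y) = b"
        by (auto simp: linear_extensions_def)
      have Mr: "1 \<le> M u \<and> M u \<le> card X" if "u \<in> X" for u using bij_betwE[OF M(1)] that by auto
      have gg: "gaps ?P (?g M) = (a, b, ?n + 1 - a - b)" using xyz g by simp
      have "?g M \<in> layer ?P {}"
      proof (rule layerI)
        have "?g M ` elems ?P = (\<lambda>u. int (M u)) ` X \<union> {0, ?n + 1}"
          by (simp add: image_Un image_image insert_commute)
        also have "(\<lambda>u. int (M u)) ` X = int ` {1..card X}"
          using M(1) by (simp add: bij_betw_def image_image[of int M, symmetric])
        also have "\<dots> \<union> {0, ?n + 1} = {0..<int (card X + 2)}" by (auto simp: image_int_atLeastAtMost)
        finally show "?g M ` elems ?P = {0..<int (card (elems ?P)) - int (card ({} :: (('a + bool) \<times> ('a + bool)) set))}"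
          by (simp only: card card.empty of_nat_0 diff_zero)
        show "?g M p \<le> ?g M q" if "(p, q) \<in> rels ?P" for p q
          using that Mr M(2) g ab xyz unfolding bounded_poset_def by (auto simp: less_imp_le)
        show "pos_gaps (gaps ?P (?g M))"
          unfolding gg using ab g Mr[OF xyz(1)] Mr[OF xyz(3)] by (simp add: pos_gaps_def)
      qed simp_all
      then show "?g M \<in> ?S" using gg by simp
    qed
  qed
  then show ?thesis unfolding gap_count_def F_def by (rule bij_betw_same_card)
qed

lemma F_eq_0:
  assumes "finite X" "x \<in> X" "z \<in> X" "int (card X) - 1 < a + b"
  shows "F X lt x y z a b = 0"
proof -
  have "int (L z) - int (L x) \<le> int (card X) - 1" if "L \<in> linear_extensions X lt" for L
  proof -
    have "L ` X = {1..card X}" using that by (auto simp: linear_extensions_def bij_betw_def)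
    then have "L x \<in> {1..card X}" "L z \<in> {1..card X}" using assms(2,3) by blast+
    then show ?thesis by auto
  qed
  then have "{L \<in> linear_extensions X lt. int (L y) - int (L x) = a \<and> int (L z) - int (L y) = b} = {}"
    using assms(4) by force
  then show ?thesis unfolding F_def by (metis card.empty)
qed

lemma F_log_concave:
  assumes fin: "finite X" and po: "strict_poset_on X lt" and xyz: "x \<in> X" "y \<in> X" "z \<in> X"
    and ne: "x \<noteq> y" "y \<noteq> z" and kl: "1 \<le> k" "1 \<le> l"
  shows "F X lt x y z (k + 2) l * F X lt x y z k l \<le> (F X lt x y z (k + 1) l)\<^sup>2"
    and "F X lt x y z k (l + 2) * F X lt x y z k l \<le> (F X lt x y z k (l + 1))\<^sup>2"
    and "F X lt x y z (k + 2) l * F X lt x y z k (l + 2) \<le> (F X lt x y z (k + 1) (l + 1))\<^sup>2"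
proof -
  let ?P = "bounded_poset X lt x y z" and ?n = "int (card X)"
  let ?goal = "F X lt x y z (k + 2) l * F X lt x y z k l \<le> (F X lt x y z (k + 1) l)\<^sup>2 \<and>
    F X lt x y z k (l + 2) * F X lt x y z k l \<le> (F X lt x y z k (l + 1))\<^sup>2 \<and>
    F X lt x y z (k + 2) l * F X lt x y z k (l + 2) \<le> (F X lt x y z (k + 1) (l + 1))\<^sup>2"
  note gc = gap_count_bounded_poset[OF fin po xyz ne]
  have ?goal
  \<comment> \<open>The count \<open>F k l\<close> has third gap \<open>c + 2\<close> with
    \<open>c = card X - 1 - k - l\<close>, and log-concavity wants \<open>c\<close> to be at least
    1. If \<open>k + l + 2\<close> is too large, \<open>F (k + 2) l\<close> and
    \<open>F k (l + 2)\<close> vanish, and with them all left-hand sides.\<close>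
  proof (cases "?n - 1 < k + l + 2 \<or> layer ?P {} = {}")
    case True
    have "F X lt x y z (k + 2) l = 0 \<and> F X lt x y z k (l + 2) = 0"
    proof (cases "?n - 1 < k + l + 2")
      case True
      then show ?thesis using F_eq_0[OF fin xyz(1,3)] by (simp add: algebra_simps)
    next
      case False
      with True have "gap_count ?P s = 0" for s by (simp add: gap_count_def)
      then show ?thesis using gc[of "k + 2" l] gc[of k "l + 2"] kl by simp
    qed
    then show ?thesis by simp
  next
    case False
    have V: "valid ?P" using fin po xyz ne False by (intro valid_bounded_poset) auto
    have "k + l + (?n - 1 - k - l) = int (card (elems ?P)) - 3"
      unfolding card_bounded_poset[OF fin] by simp
    note lc = gap_count_log_concave[OF V kl _ this]
    show ?thesis
      using lc False kl gc[of k l] gc[of "k + 1" l] gc[of k "l + 1"] gc[of "k + 2" l]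
        gc[of k "l + 2"] gc[of "k + 1" "l + 1"]
      by (simp add: algebra_simps)
  qed
  then show "F X lt x y z (k + 2) l * F X lt x y z k l \<le> (F X lt x y z (k + 1) l)\<^sup>2"
    "F X lt x y z k (l + 2) * F X lt x y z k l \<le> (F X lt x y z k (l + 1))\<^sup>2"
    "F X lt x y z (k + 2) l * F X lt x y z k (l + 2) \<le> (F X lt x y z (k + 1) (l + 1))\<^sup>2" by blast+
qed

text \<open>The numbers are the entries of a symmetric matrix indexed by the three unit directions,
  with \<open>F (k + 2) l\<close>, \<open>F k (l + 2)\<close> and \<open>F k l\<close> on the
  diagonal. The hypotheses say that its principal two-by-two minors are nonpositive.\<close>

lemma two_of_three_products:
  fixes a11 a22 a33 a12 a13 a23 :: nat
  assumes "a11 * a33 \<le> a13\<^sup>2" "a22 * a33 \<le> a23\<^sup>2" "a11 * a22 \<le> a12\<^sup>2"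
  defines "A \<equiv> a13 * a23 \<ge> a33 * a12" and "B \<equiv> a11 * a23 \<le> a13 * a12" and "C \<equiv> a22 * a13 \<le> a23 * a12"
  shows "(A \<and> B) \<or> (A \<and> C) \<or> (B \<and> C)"
proof -
  have main: "p \<ge> q \<or> r \<ge> s" if "q * s = w * t" "p * r = v\<^sup>2 * t" "w \<le> v\<^sup>2"
    for p q r s t v w :: nat
  proof (rule ccontr)
    assume "\<not> ?thesis"
    then have "p * r < q * s" by (intro mult_strict_mono) auto
    then show False using that(1,2) mult_right_mono[OF that(3), of t] by simp
  qed
  have "A \<or> B" unfolding A_def B_def
    by (rule main[OF _ _ assms(1), where t = "a12 * a23"]) (simp_all only: power2_eq_square mult_ac)
  moreover have "A \<or> C" unfolding A_def C_def
    by (rule main[OF _ _ assms(2), where t = "a12 * a13"]) (simp_all only: power2_eq_square mult_ac)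
  moreover have "B \<or> C" unfolding B_def C_def
    by (rule main[OF _ _ assms(3), where t = "a13 * a23"]) (simp_all only: power2_eq_square mult_ac)
  ultimately show ?thesis by blast
qed

theorem theorem1p7:
  fixes X :: "'a set" and lt :: "'a \<Rightarrow> 'a \<Rightarrow> bool" and x y z :: 'a and k l :: int
  assumes "finite X" and "strict_poset_on X lt"
    and "x \<in> X" and "y \<in> X" and "z \<in> X"
    and "x \<noteq> y" and "x \<noteq> z" and "y \<noteq> z"
    and "k \<ge> 1" and "l \<ge> 1"
  defines "A \<equiv> F X lt x y z (k + 1) l * F X lt x y z k (l + 1)
                 \<ge> F X lt x y z k l * F X lt x y z (k + 1) (l + 1)"
    and "B \<equiv> F X lt x y z (k + 2) l * F X lt x y z k (l + 1)
                 \<le> F X lt x y z (k + 1) l * F X lt x y z (k + 1) (l + 1)"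
    and "C \<equiv> F X lt x y z k (l + 2) * F X lt x y z (k + 1) l
                 \<le> F X lt x y z k (l + 1) * F X lt x y z (k + 1) (l + 1)"
  shows "(A \<and> B) \<or> (A \<and> C) \<or> (B \<and> C)"
  unfolding A_def B_def C_def
  using assms(1-6,8-10) by (intro two_of_three_products F_log_concave)

end
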